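(* Let $p$ be an odd prime. (i) The permutations $\sigma(x,y,z)=(y,z,x)$, $\alpha(x,y,z)=(x+y,y,z)$, $\beta(x,y,z)=(x+y^2,y,z)$ of the set $\mathbf F_p^3\setminus\{(0,0,0)\}$ (of cardinality $p^3-1$) generate the full alternating group $\mathrm{Alt}(p^3-1)$, and there is $\varepsilon>0$ independent of $p$ such that the Cayley graphs of $\mathrm{Alt}(p^3-1)$ with respect to $\{\sigma^{\pm1},\alpha^{\pm1},\beta^{\pm1}\}$ (degree $6$) are $\varepsilon$-expanders for all odd primes $p$. (ii) The permutations $\rho(x_1,\dots,x_7)=(x_2,x_3,x_4,x_5,x_6,x_7,x_1)$ and $\gamma(x_1,\dots,x_7)=(x_1+x_2,x_2,x_3,x_4+x_6^2,x_5,x_6,x_7)$ of $\mathbf F_p^7\setminus\{0\}$ (of cardinality $p^7-1$) generate $\mathrm{Alt}(p^7-1)$, and there is $\varepsilon>0$ independent of $p$ such that the Cayley graphs of $\mathrm{Alt}(p^7-1)$ with respect to $\{\rho^{\pm1},\gamma^{\pm1}\}$ (degree $4$) are $\varepsilon$-expanders for all odd primes $p$.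
   Context: A finite group $H$ with symmetric generating set $Q$ yields an $\varepsilon$-expander Cayley graph if, for the representation of $H$ on the functions on $H$ orthogonal to the constants (restriction of the regular representation), every unit vector $v$ satisfies $\max_{g\in Q}\|gv-v\|\ge\varepsilon$; equivalently, a family of such Cayley graphs of bounded degree is an expander family when this $\varepsilon$ is uniform. *)

theory Defs
  imports Complex_Main "HOL-Combinatorics.Permutations" "HOL-Computational_Algebra.Primes"
begin

definition Alt :: "'a set \<Rightarrow> ('a \<Rightarrow> 'a) set" where
  "Alt X = {f. f permutes X \<and> evenperm f}"

inductive_set gen_perm :: "('a \<Rightarrow> 'a) set \<Rightarrow> ('a \<Rightarrow> 'a) set" for S where
  gen_id: "id \<in> gen_perm S"
| gen_mul: "f \<in> S \<Longrightarrow> h \<in> gen_perm S \<Longrightarrow> f \<circ> h \<in> gen_perm S"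
| gen_inv: "f \<in> S \<Longrightarrow> h \<in> gen_perm S \<Longrightarrow> inv f \<circ> h \<in> gen_perm S"

text \<open>epsilon-expander condition for the Cayley graph of the finite group H
  (of permutations, product = composition) w.r.t. Q: for every unit vector v in
  the functions H \<rightarrow> complex orthogonal to the constants, some g in Q moves v
  (under the left regular representation (g v)(h) = v(g^-1 h)) by at least eps.\<close>
definition expander_eps :: "('a \<Rightarrow> 'a) set \<Rightarrow> ('a \<Rightarrow> 'a) set \<Rightarrow> real \<Rightarrow> bool" where
  "expander_eps H Q eps \<longleftrightarrow>
     (\<forall>v :: ('a \<Rightarrow> 'a) \<Rightarrow> complex.
        (\<Sum>h\<in>H. v h) = 0 \<and> sqrt (\<Sum>h\<in>H. (cmod (v h))^2) = 1 \<longrightarrow>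
        (\<exists>g\<in>Q. sqrt (\<Sum>h\<in>H. (cmod (v (inv g \<circ> h) - v h))^2) \<ge> eps))"

definition X3 :: "nat \<Rightarrow> (nat \<times> nat \<times> nat) set" where
  "X3 p = {(x, y, z). x < p \<and> y < p \<and> z < p \<and> (x, y, z) \<noteq> (0, 0, 0)}"

definition sigma3 :: "nat \<Rightarrow> nat \<times> nat \<times> nat \<Rightarrow> nat \<times> nat \<times> nat" where
  "sigma3 p = (\<lambda>(x, y, z). if (x, y, z) \<in> X3 p then (y, z, x) else (x, y, z))"

definition alpha3 :: "nat \<Rightarrow> nat \<times> nat \<times> nat \<Rightarrow> nat \<times> nat \<times> nat" where
  "alpha3 p = (\<lambda>(x, y, z). if (x, y, z) \<in> X3 p then ((x + y) mod p, y, z) else (x, y, z))"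

definition beta3 :: "nat \<Rightarrow> nat \<times> nat \<times> nat \<Rightarrow> nat \<times> nat \<times> nat" where
  "beta3 p = (\<lambda>(x, y, z). if (x, y, z) \<in> X3 p then ((x + y^2) mod p, y, z) else (x, y, z))"

text \<open>F_p^7 minus 0 as lists of length 7 (index 0 is x_1).\<close>
definition X7 :: "nat \<Rightarrow> nat list set" where
  "X7 p = {xs. length xs = 7 \<and> (\<forall>i<7. xs ! i < p) \<and> xs \<noteq> replicate 7 0}"

definition rho7 :: "nat \<Rightarrow> nat list \<Rightarrow> nat list" where
  "rho7 p xs = (if xs \<in> X7 p then rotate1 xs else xs)"

definition gamma7 :: "nat \<Rightarrow> nat list \<Rightarrow> nat list" where
  "gamma7 p xs = (if xs \<in> X7 p
     then xs[0 := (xs ! 0 + xs ! 1) mod p, 3 := (xs ! 3 + (xs ! 5)^2) mod p]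
     else xs)"

end

theory Submission
  imports Defs "HOL-Analysis.Convex" "HOL-Library.Poly_Mapping"
    "HOL-Computational_Algebra.Polynomial" "HOL-Number_Theory.Cong"
begin

text \<open>Let \<open>n\<close> be \<open>3\<close> or \<open>7\<close>. A vector \<open>v\<close> of mean zero in the regular representation which is moved by at most
  \<open>\<delta>\<close> by the generators is moved by \<open>O(\<delta>)\<close> by the transvections \<open>x\<^sub>i += x\<^sub>j\<close>, which are words of bounded length.
  Relative property (T) of \<open>(SL\<^sub>2(\<F>\<^sub>p) \<ltimes> \<F>\<^sub>p\<^sup>2, \<F>\<^sub>p\<^sup>2)\<close>, with a constant independent of \<open>p\<close>, extends this to all
  \<open>x\<^sub>i += t x\<^sub>j\<close>, and commutators extend it to all \<open>x\<^sub>i += t x\<^sub>j\<^sup>2\<close>. So \<open>v\<close> is almost fixed by the \<open>2n\<close> cyclic groups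
  \<open>{x\<^sub>i += t x\<^sub>i\<^sub>+\<^sub>1\<^sup>e}\<close>, \<open>e = 1, 2\<close>. Any two of them commute or generate a nilpotent group in which the cosine of
  the angle between their fixed spaces is at most \<open>\<surd>(2/p)\<close>; hence for large \<open>p\<close> the vector \<open>v\<close> is close to a
  vector fixed by all of them. Since these groups generate the alternating group, this vector is \<open>0\<close>, which
  bounds \<open>v\<close>. For each of the finitely many small primes a spectral gap exists because the group is finite.

  For generation, the group contains \<open>x\<^sub>i += h\<close> for enough functions \<open>h\<close> of small support to provide two
  permutations whose supports meet in a single point; their commutator is a 3-cycle.\<close>

section \<open>Projections in inner product spaces\<close>

text \<open>The degree p^n - 1 grows with p, so no estimate may depend on the order of the group or
  on word lengths in it. With n fixed, the 2n cyclic groups meet this: the energy argument needs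
  only pairwise cosines of size about 1/(8n), and these hold once p >= 128 n^2. That the groups
  generate enters the estimate only qualitatively, to force a limit to be 0, so a wasteful proof of
  generation costs nothing.

  The cosine sqrt(2/p) comes from quadratic forms. Substituting y + s z for y in a y^2 + 2 b y z + c
  z^2 acts unipotently on (a, b, c), and the orbit of (1, 0, 0) is the curve (1, s, s^2). Distinct
  points of it are independent three at a time, so the averages over the corresponding lines are
  nearly orthogonal.

  The origin has to be removed because every generator fixes it. Oddness of p makes 2 and 4
  invertible, makes each elementary shear an even permutation, and leaves at least three residues to
  choose from.\<close>

definition oproj :: "('v::real_inner \<Rightarrow> 'v) \<Rightarrow> bool" where
  "oproj P \<longleftrightarrow> linear P \<and> (\<forall>v. P (P v) = P v) \<and> (\<forall>v w. inner (P v) w = inner v (P w))"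

lemma oproj_linear: "oproj P \<Longrightarrow> linear P"
  and oproj_idem: "oproj P \<Longrightarrow> P (P v) = P v"
  and oproj_adj: "oproj P \<Longrightarrow> inner (P v) w = inner v (P w)"
  by (auto simp: oproj_def)

lemma oproj_inner: "oproj P \<Longrightarrow> inner v (P v) = (norm (P v))\<^sup>2"
  by (metis oproj_adj oproj_idem power2_norm_eq_inner)

lemma oproj_inner': "oproj P \<Longrightarrow> inner (P v) v = (norm (P v))\<^sup>2"
  by (metis oproj_adj oproj_inner)

lemma norm_diff_sq: "(norm (v - w :: 'v::real_inner))\<^sup>2 = (norm v)\<^sup>2 - 2 * inner v w + (norm w)\<^sup>2"
  by (simp add: power2_norm_eq_inner inner_diff_left inner_diff_right inner_commute)

lemma norm_add_sq: "(norm (v + w :: 'v::real_inner))\<^sup>2 = (norm v)\<^sup>2 + 2 * inner v w + (norm w)\<^sup>2"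
  by (simp add: power2_norm_eq_inner inner_add_left inner_add_right inner_commute)

lemma oproj_defect_sq: "oproj P \<Longrightarrow> (norm (v - P v))\<^sup>2 = (norm v)\<^sup>2 - (norm (P v))\<^sup>2"
  by (simp add: norm_diff_sq oproj_inner)

lemma oproj_defect_le: "oproj P \<Longrightarrow> norm (v - P v) \<le> norm v"
  by (metis diff_left_mono diff_zero norm_ge_zero oproj_defect_sq power2_le_imp_le zero_le_power2)

lemma oproj_inner_defects:
  assumes "oproj P" "oproj Q"
  shows "inner (v - P v) (v - Q v) = (norm v)\<^sup>2 - (norm (P v))\<^sup>2 - (norm (Q v))\<^sup>2 + inner (P v) (Q v)"
  unfolding inner_diff_left inner_diff_right oproj_inner[OF assms(2)] oproj_inner'[OF assms(1)]
    power2_norm_eq_inner[of v]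
  by simp

text \<open>\<^term>\<open>E\<close> projects to the common fixed vectors, and \<^term>\<open>c\<close> bounds the cosine of the
  angle of the ranges of \<^term>\<open>P\<close> and \<^term>\<open>Q\<close>.\<close>

lemma oproj_pair_angle:
  assumes P: "oproj P" and Q: "oproj Q" and E: "oproj E"
    and PE: "\<And>v. P (E v) = E v" and QE: "\<And>v. Q (E v) = E v"
    and c: "0 \<le> c" "c \<le> 1/4"
    and angle: "\<And>u. Q u = u \<Longrightarrow> E u = 0 \<Longrightarrow> norm (P u) \<le> c * norm u"
  shows "inner (v - P v) (v - Q v) \<ge> - c * ((norm (v - P v))\<^sup>2 + (norm (v - Q v))\<^sup>2)"
proof -
  define w where "w = v - E v"
  \<comment> \<open>Adjoint of \<open>PE\<close>: the range of \<open>E\<close> lies in that of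
    \<open>P\<close>, so applying \<open>P\<close> first does not change \<open>E\<close>. The same
    holds for \<open>Q\<close>.\<close>
  have EP: "E (P u) = E u" for u
  proof -
    have "inner (E (P u) - E u) z = 0" for z
      by (simp add: inner_diff_left oproj_adj[OF E] oproj_adj[OF P] PE)
    from this[of "E (P u) - E u"] show ?thesis by simp
  qed
  have EQ: "E (Q u) = E u" for u
  proof -
    have "inner (E (Q u) - E u) z = 0" for z
      by (simp add: inner_diff_left oproj_adj[OF E] oproj_adj[OF Q] QE)
    from this[of "E (Q u) - E u"] show ?thesis by simp
  qed
  have Ew: "E w = 0"
    by (simp add: w_def linear_diff[OF oproj_linear[OF E]] oproj_idem[OF E])
  have 1: "v - P v = w - P w" "v - Q v = w - Q w"
    by (simp_all add: w_def linear_diff[OF oproj_linear[OF P]] linear_diff[OF oproj_linear[OF Q]] PE QE)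
  define x y where "x = P w" and "y = Q w"
  have "norm (P y) \<le> c * norm y"
    by (rule angle) (simp_all add: y_def oproj_idem[OF Q] EQ Ew)
  \<comment> \<open>\<open>x\<close> lies in the range of \<open>P\<close>, so only the component
    \<open>P y\<close> of \<open>y\<close> pairs with it. This is where the angle enters.\<close>
  then have "\<bar>inner x y\<bar> \<le> norm x * (c * norm y)"
    by (metis Cauchy_Schwarz_ineq2 P dual_order.trans mult_left_mono norm_ge_zero oproj_adj oproj_idem x_def)
  also have "\<dots> \<le> c * (((norm x)\<^sup>2 + (norm y)\<^sup>2) / 2)"
    using mult_left_mono[OF _ c(1), of "norm x * norm y" "((norm x)\<^sup>2 + (norm y)\<^sup>2) / 2"]
      sum_squares_bound[of "norm x" "norm y"] by (simp add: mult_ac)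
  finally have m: "\<bar>inner x y\<bar> \<le> c * (((norm x)\<^sup>2 + (norm y)\<^sup>2) / 2)" .
  define X where "X = (norm x)\<^sup>2 + (norm y)\<^sup>2"
  \<comment> \<open>\<open>x + y\<close> is nearly the projection of \<open>w\<close> to the sum of
    the two ranges. The squared remainder is nonnegative, which bounds \<open>norm w\<close> from
    below.\<close>
  have "0 \<le> (norm (w - (x + y)))\<^sup>2" by simp
  also have "\<dots> = (norm w)\<^sup>2 - X + 2 * inner x y"
    unfolding norm_diff_sq inner_add_right norm_add_sq
    using oproj_inner[OF P, of w] oproj_inner[OF Q, of w] by (simp add: x_def y_def X_def)
  finally have w: "(norm w)\<^sup>2 \<ge> X - 2 * inner x y" by simp
  have D: "(norm (w - P w))\<^sup>2 + (norm (w - Q w))\<^sup>2 = 2 * (norm w)\<^sup>2 - X"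
    using oproj_defect_sq[OF P, of w] oproj_defect_sq[OF Q, of w] by (simp add: x_def y_def X_def)
  have L: "inner (w - P w) (w - Q w) = (norm w)\<^sup>2 - X + inner x y"
    using oproj_inner_defects[OF P Q, of w] by (simp add: x_def y_def X_def)
  have X0: "0 \<le> X" by (simp add: X_def)
  have m': "\<bar>inner x y\<bar> \<le> c * X / 2" using m by (simp add: X_def)
  have cX: "c * X \<le> X / 4" using mult_right_mono[OF c(2) X0] by simp
  \<comment> \<open>By \<open>c \<le> 1/4\<close> the squared defects add up to at least
    \<open>X / 2\<close>, which absorbs the cross term of size at most
    \<open>c * X / 2\<close>.\<close>
  have "c * (2 * (norm w)\<^sup>2 - X) \<ge> c * (X / 2)"
    using w m' cX by (intro mult_left_mono c) linarith
  then have "inner (w - P w) (w - Q w) \<ge> - (c * (2 * (norm w)\<^sup>2 - X))"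
    unfolding L using w m' by linarith
  then show ?thesis unfolding 1 D by simp
qed

text \<open>The gradient flow \<open>v \<mapsto> v - \<Delta>v / N\<close> of the energy \<open>\<langle>\<Delta>v, v\<rangle>\<close>, where \<open>\<Delta> = \<Sum>\<^sub>i (1 - P\<^sub>i)\<close>,
  contracts the energy at a rate depending on \<open>N\<close> only; the constant \<open>\<kappa>\<close> merely ensures that
  the flow tends to \<open>0\<close> and does not enter the bound.\<close>

lemma oproj_family_gap:
  fixes P :: "'i \<Rightarrow> 'v::real_inner \<Rightarrow> 'v" and W :: "'v set"
  assumes fin: "finite I" and N: "card I = N" "N > 0"
    and P: "\<And>i. i \<in> I \<Longrightarrow> oproj (P i)"
    and pair: "\<And>i j v. i \<in> I \<Longrightarrow> j \<in> I \<Longrightarrow> i \<noteq> j \<Longrightarrow>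
      inner (v - P i v) (v - P j v) \<ge> - c * ((norm (v - P i v))\<^sup>2 + (norm (v - P j v))\<^sup>2)"
    and c: "4 * c * N \<le> 1" "0 \<le> c"
    and W: "subspace W" "\<And>i v. i \<in> I \<Longrightarrow> v \<in> W \<Longrightarrow> P i v \<in> W"
    and K: "\<And>v. v \<in> W \<Longrightarrow> (norm v)\<^sup>2 \<le> \<kappa> * (\<Sum>i\<in>I. (norm (v - P i v))\<^sup>2)"
    and v: "v \<in> W"
  shows "norm v \<le> 4 * N * sqrt (\<Sum>i\<in>I. (norm (v - P i v))\<^sup>2)"
proof -
  define E where "E v = (\<Sum>i\<in>I. (norm (v - P i v))\<^sup>2)" for v
  define D where "D v = (\<Sum>i\<in>I. v - P i v)" for v
  define F where "F v = v - (1 / real N) *\<^sub>R D v" for v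
  have E0: "E v \<ge> 0" for v by (simp add: E_def sum_nonneg)
  \<comment> \<open>The diagonal of the expanded square is \<open>E v\<close>; the bounds for the
    mixed terms cost at most \<open>2 * c * N * E v\<close>, which is at most half of it.\<close>
  have DE: "(norm (D v))\<^sup>2 \<ge> E v / 2" for v
  proof -
    let ?a = "\<lambda>i. (norm (v - P i v))\<^sup>2"
    have 1: "(norm (D v))\<^sup>2 = (\<Sum>i\<in>I. \<Sum>j\<in>I. inner (v - P i v) (v - P j v))"
      unfolding D_def power2_norm_eq_inner inner_sum_left inner_sum_right
      by (intro sum.cong refl inner_commute)
    have 2: "?a i + (\<Sum>j\<in>I. - c * (?a i + ?a j)) \<le> (\<Sum>j\<in>I. inner (v - P i v) (v - P j v))"
      if i: "i \<in> I" for i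
    proof -
      have "(\<Sum>j\<in>I. - c * (?a i + ?a j)) \<le> (\<Sum>j\<in>I-{i}. - c * (?a i + ?a j))"
        by (subst sum.remove[OF fin i]) (use c in simp)
      also have "\<dots> \<le> (\<Sum>j\<in>I-{i}. inner (v - P i v) (v - P j v))"
        by (intro sum_mono) (use pair i in auto)
      finally show ?thesis
        by (subst (2) sum.remove[OF fin i]) (simp add: power2_norm_eq_inner)
    qed
    have "(\<Sum>i\<in>I. ?a i + (\<Sum>j\<in>I. - c * (?a i + ?a j))) = E v - c * (2 * N * E v)"
      unfolding E_def distrib_left sum.distrib sum_distrib_left[symmetric] sum_constant N
      by (simp add: algebra_simps)
    moreover have "c * (2 * N * E v) \<le> E v / 2"
      using mult_right_mono[OF c(1) E0[of v]] by simp
    moreover have "(\<Sum>i\<in>I. ?a i + (\<Sum>j\<in>I. - c * (?a i + ?a j))) \<le> (norm (D v))\<^sup>2"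
      unfolding 1 by (intro sum_mono 2)
    ultimately show ?thesis by linarith
  qed
  have DE': "(norm (D v))\<^sup>2 \<le> N * E v" for v
  proof -
    have "norm (D v) \<le> (\<Sum>i\<in>I. norm (v - P i v))" by (simp add: D_def norm_sum)
    then have "(norm (D v))\<^sup>2 \<le> (\<Sum>i\<in>I. norm (v - P i v) * 1)\<^sup>2" by (intro power_mono) auto
    also have "\<dots> \<le> (\<Sum>i\<in>I. (norm (v - P i v))\<^sup>2) * (\<Sum>i\<in>I. 1\<^sup>2)" by (rule Convex.Cauchy_Schwarz_ineq_sum)
    finally show ?thesis by (simp add: E_def N mult.commute)
  qed
  have Ein: "E v = inner (D v) v" for v
    unfolding E_def D_def inner_sum_left
    by (intro sum.cong refl) (simp add: oproj_defect_sq[OF P] inner_diff_left oproj_inner'[OF P] power2_norm_eq_inner[of v])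
  have lin: "linear D" unfolding D_def
    by (intro linear_compose_sum linear_compose_sub ballI) (auto intro: oproj_linear[OF P] linear_ident)
  have adj: "inner (D v) w = inner v (D w)" for v w
    unfolding D_def inner_sum_left inner_sum_right
    by (intro sum.cong refl) (simp add: inner_diff_left inner_diff_right oproj_adj[OF P])
  have En: "E w \<le> N * (norm w)\<^sup>2" for w
  proof -
    have "E w \<le> (\<Sum>i\<in>I. (norm w)\<^sup>2)" unfolding E_def
      by (intro sum_mono power_mono oproj_defect_le P) auto
    then show ?thesis by (simp add: N)
  qed
  \<comment> \<open>For the step 1/N, the second-order term is at most half of the first-order gain,
    since the energy never exceeds \<open>N\<close> times the squared norm.\<close>
  have EF: "E (F v) \<le> (1 - 1 / (2 * N)) * E v" for v
  proof -
    let ?t = "1 / real N"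
    have "E (F v) = E v - 2 * ?t * (norm (D v))\<^sup>2 + ?t\<^sup>2 * E (D v)"
      unfolding Ein F_def linear_diff[OF lin] linear_scale[OF lin] inner_diff_left inner_diff_right
        inner_scaleR_left inner_scaleR_right adj[of "D v" v] power2_norm_eq_inner
      by (simp add: power2_eq_square algebra_simps)
    also have "?t\<^sup>2 * E (D v) \<le> ?t\<^sup>2 * (N * (norm (D v))\<^sup>2)"
      by (intro mult_left_mono En) simp
    also have "E v - 2 * ?t * (norm (D v))\<^sup>2 + ?t\<^sup>2 * (N * (norm (D v))\<^sup>2) = E v - ?t * (norm (D v))\<^sup>2"
      using N(2) by (simp add: power2_eq_square field_simps)
    also have "\<dots> \<le> E v - ?t * (E v / 2)"
      by (intro diff_left_mono mult_left_mono DE) simp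
    finally show ?thesis by (simp add: algebra_simps)
  qed
  have FW: "F v \<in> W" if "v \<in> W" for v
    unfolding F_def D_def using that W fin
    by (intro subspace_diff subspace_scale subspace_sum) auto
  \<comment> \<open>Rate for the square root of the energy: q^2 dominates the factor 1 - 1/(2N), and
    1/(1 - q) = 4N becomes the constant of the conclusion.\<close>
  define q where "q = 1 - 1 / (4 * real N)"
  have q: "0 \<le> q" "q < 1" "1 - 1 / (2 * real N) \<le> q\<^sup>2"
    using N(2) by (auto simp: q_def power2_eq_square field_simps)
  have step: "norm (v - F v) \<le> sqrt (E v)" for v
  proof -
    have "norm (D v) \<le> real N * sqrt (E v)"
    proof (rule power2_le_imp_le)
      have "(norm (D v))\<^sup>2 \<le> N * E v" by (rule DE')
      also have "\<dots> \<le> N * (N * E v)" using N(2) E0[of v]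
        by (intro mult_left_mono) (auto simp: mult_le_cancel_right1)
      finally show "(norm (D v))\<^sup>2 \<le> (real N * sqrt (E v))\<^sup>2"
        using E0[of v] by (simp add: power_mult_distrib power2_eq_square[of "real N"] mult.assoc)
    qed (use E0 in auto)
    then show ?thesis using N(2) by (simp add: F_def field_simps)
  qed
  define u where "u k = (F ^^ k) v" for k
  have uW: "u k \<in> W" for k by (induction k) (auto simp: u_def v FW)
  have uE: "sqrt (E (u k)) \<le> q ^ k * sqrt (E v)" for k
  proof (induction k)
    case (Suc k)
    have "E (u (Suc k)) \<le> q\<^sup>2 * E (u k)"
      using EF[of "u k"] mult_right_mono[OF q(3) E0[of "u k"]] by (simp add: u_def)
    then have "sqrt (E (u (Suc k))) \<le> q * sqrt (E (u k))"
      using q(1) by (metis real_sqrt_le_iff real_sqrt_mult real_sqrt_abs abs_of_nonneg)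
    also have "\<dots> \<le> q * (q ^ k * sqrt (E v))" by (intro mult_left_mono Suc q)
    finally show ?case by (simp add: mult.assoc)
  qed (simp add: u_def)
  \<comment> \<open>Telescoping along the flow: each step is no longer than the square root of the
    current energy.\<close>
  have sums: "norm v \<le> norm (u k) + sqrt (E v) * (\<Sum>j<k. q ^ j)" for k
  proof (induction k)
    case (Suc k)
    have "norm (u k) \<le> norm (u (Suc k)) + norm (u k - F (u k))"
      using norm_triangle_ineq[of "F (u k)" "u k - F (u k)"] by (simp add: u_def)
    also have "norm (u k - F (u k)) \<le> q ^ k * sqrt (E v)"
      using step[of "u k"] uE[of k] by simp
    finally show ?case using Suc by (simp add: algebra_simps)
  qed (simp add: u_def)
  have "(\<Sum>j<k. q ^ j) \<le> 4 * N" for k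
  proof -
    have "(\<Sum>j<k. q ^ j) \<le> 1 / (1 - q)"
      using q sum_le_suminf[of "\<lambda>j. q ^ j" "{..<k}"] suminf_geometric[of q]
      by (simp add: summable_geometric)
    then show ?thesis by (simp add: q_def)
  qed
  then have B: "norm v \<le> norm (u k) + sqrt (E v) * (4 * N)" for k
    using order_trans[OF sums[of k]] mult_left_mono[OF _ real_sqrt_ge_zero[OF E0[of v]]] 
    by (meson add_left_mono)
  have "(\<lambda>k. norm (u k)) \<longlonglongrightarrow> 0"
  proof (rule tendsto_sandwich[OF _ _ tendsto_const])
    show "\<forall>\<^sub>F k in sequentially. norm (u k) \<le> sqrt (\<bar>\<kappa>\<bar>) * (q ^ k * sqrt (E v))"
    proof (intro always_eventually allI)
      fix k
      have "(norm (u k))\<^sup>2 \<le> \<bar>\<kappa>\<bar> * E (u k)"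
        using K[OF uW[of k]] E0[of "u k"] unfolding E_def[symmetric]
        by (smt (verit) mult_right_mono)
      then have "norm (u k) \<le> sqrt \<bar>\<kappa>\<bar> * sqrt (E (u k))"
        by (metis real_le_rsqrt real_sqrt_mult)
      then show "norm (u k) \<le> sqrt (\<bar>\<kappa>\<bar>) * (q ^ k * sqrt (E v))"
        using mult_left_mono[OF uE[of k], of "sqrt \<bar>\<kappa>\<bar>"] by simp
    qed
    have "(\<lambda>k. q ^ k) \<longlonglongrightarrow> 0" using q by (intro LIMSEQ_realpow_zero) auto
    from tendsto_mult[OF tendsto_const tendsto_mult[OF this tendsto_const]]
    show "(\<lambda>k. sqrt (\<bar>\<kappa>\<bar>) * (q ^ k * sqrt (E v))) \<longlonglongrightarrow> 0"
      by fastforce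
  qed auto
  then have "(\<lambda>k. norm (u k) + sqrt (E v) * (4 * N)) \<longlonglongrightarrow> 0 + sqrt (E v) * (4 * N)"
    by (rule tendsto_add[OF _ tendsto_const])
  then have "norm v \<le> 0 + sqrt (E v) * (4 * N)"
    by (rule LIMSEQ_le_const) (use B in blast)
  then show ?thesis by (simp add: E_def mult_ac)
qed

section \<open>Averages over cyclic groups\<close>

lemma sum_periodic_shift:
  fixes F :: "int \<Rightarrow> 'a::comm_monoid_add" and p :: int
  assumes p: "p > 0" and F: "\<And>t. F (t mod p) = F t"
  shows "(\<Sum>t\<in>{0..<p}. F (t + s)) = (\<Sum>t\<in>{0..<p}. F t)"
proof (rule sum.reindex_bij_witness[where i = "\<lambda>t. (t - s) mod p" and j = "\<lambda>t. (t + s) mod p"])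
  fix t assume "t \<in> {0..<p}"
  then show "((t + s) mod p - s) mod p = t" by (simp add: mod_diff_left_eq)
  show "(t + s) mod p \<in> {0..<p}" using p by simp
  show "F ((t + s) mod p) = F (t + s)" by (rule F)
next
  fix t assume "t \<in> {0..<p}"
  then show "((t - s) mod p + s) mod p = t" by (simp add: mod_add_left_eq)
  show "(t - s) mod p \<in> {0..<p}" using p by simp
qed

lemma sum_periodic_neg:
  fixes F :: "int \<Rightarrow> 'a::comm_monoid_add" and p :: int
  assumes p: "p > 0" and F: "\<And>t. F (t mod p) = F t"
  shows "(\<Sum>t\<in>{0..<p}. F (- t)) = (\<Sum>t\<in>{0..<p}. F t)"
proof (rule sum.reindex_bij_witness[where i = "\<lambda>t. (- t) mod p" and j = "\<lambda>t. (- t) mod p"])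
  fix t assume "t \<in> {0..<p}"
  then show "(- ((- t) mod p)) mod p = t" by (simp add: mod_minus_eq)
  show "(- t) mod p \<in> {0..<p}" using p by simp
  show "F ((- t) mod p) = F (- t)" by (rule F)
next
  fix t assume "t \<in> {0..<p}"
  then show "(- ((- t) mod p)) mod p = t" by (simp add: mod_minus_eq)
  show "(- t) mod p \<in> {0..<p}" using p by simp
qed

text \<open>An isometric representation of Z/p, indexed periodically by all integers so that
  parameters can be added and multiplied without reduction.\<close>

definition cyc_rep :: "int \<Rightarrow> (int \<Rightarrow> 'v::real_inner \<Rightarrow> 'v) \<Rightarrow> bool" where
  "cyc_rep p R \<longleftrightarrow> p > 0 \<and> (\<forall>t. orthogonal_transformation (R t)) \<and>
     (\<forall>s t v. R (s + t) v = R s (R t v)) \<and> (\<forall>t. R (t mod p) = R t)"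

text \<open>This is the orthogonal projection to the fixed vectors of the representation.\<close>

definition avg :: "int \<Rightarrow> (int \<Rightarrow> 'v::real_inner \<Rightarrow> 'v) \<Rightarrow> 'v \<Rightarrow> 'v" where
  "avg p R v = (1 / of_int p) *\<^sub>R (\<Sum>t\<in>{0..<p}. R t v)"

context
  fixes p :: int and R :: "int \<Rightarrow> 'v::real_inner \<Rightarrow> 'v"
  assumes R: "cyc_rep p R"
begin

lemma cyc_rep_pos: "p > 0"
  and cyc_rep_linear: "linear (R t)"
  and cyc_rep_inner: "inner (R t v) (R t w) = inner v w"
  and cyc_rep_norm: "norm (R t v) = norm v"
  and cyc_rep_add: "R (s + t) v = R s (R t v)"
  and cyc_rep_mod: "R (t mod p) = R t"
  using R by (auto simp: cyc_rep_def orthogonal_transformation)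
    (simp add: orthogonal_transformation_def[unfolded orthogonal_transformation] orthogonal_transformation[symmetric] orthogonal_transformation_def)

text \<open>The axioms do not mention the identity, but \<open>R 0\<close> is idempotent and,
  preserving norms, injective.\<close>

lemma cyc_rep_0: "R 0 v = v"
proof -
  have "R 0 (R 0 v - v) = 0"
    using cyc_rep_add[of 0 0 v] by (simp add: linear_diff[OF cyc_rep_linear])
  then have "R 0 v - v = 0" by (metis cyc_rep_norm norm_eq_zero)
  then show ?thesis by simp
qed

lemma cyc_rep_neg: "R (- t) (R t v) = v" "R t (R (- t) v) = v"
  using cyc_rep_add[of "- t" t v] cyc_rep_add[of t "- t" v] by (auto simp: cyc_rep_0)

lemma cyc_rep_adj: "inner (R t v) w = inner v (R (- t) w)"
  by (metis cyc_rep_inner cyc_rep_neg(2))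

lemma cyc_rep_invariant: assumes "R 1 v = v" shows "R t v = v"
proof -
  have N: "R (int n) v = v" for n
  proof (induction n)
    case (Suc n)
    then show ?case using cyc_rep_add[of 1 "int n" v] assms by simp
  qed (simp add: cyc_rep_0)
  have "R (t mod p) v = v"
    using N[of "nat (t mod p)"] cyc_rep_pos by simp
  then show ?thesis by (simp add: cyc_rep_mod)
qed

lemma avg_invariant: "R s (avg p R v) = avg p R v"
proof -
  have "(\<Sum>t\<in>{0..<p}. R (t + s) v) = (\<Sum>t\<in>{0..<p}. R t v)"
    by (rule sum_periodic_shift[OF cyc_rep_pos]) (simp add: cyc_rep_mod)
  then show ?thesis
    by (simp add: avg_def linear_scale[OF cyc_rep_linear] linear_sum[OF cyc_rep_linear] cyc_rep_add[symmetric] add.commute)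
qed

lemma avg_fixed: assumes "\<And>t. R t v = v" shows "avg p R v = v"
  using cyc_rep_pos by (simp add: avg_def assms sum_constant_scaleR)

lemma avg_oproj: "oproj (avg p R)"
  unfolding oproj_def
proof (intro conjI allI)
  have "linear (\<lambda>v. \<Sum>t\<in>{0..<p}. R t v)"
    by (intro linear_compose_sum ballI cyc_rep_linear)
  from linear_compose_scale_right[OF this, of "1 / of_int p"] show "linear (avg p R)"
    by (simp add: avg_def[abs_def])
  show "avg p R (avg p R v) = avg p R v" for v
    by (rule avg_fixed) (rule avg_invariant)
  show "inner (avg p R v) w = inner v (avg p R w)" for v w
  proof -
    have "(\<Sum>t\<in>{0..<p}. inner v (R (- t) w)) = (\<Sum>t\<in>{0..<p}. inner v (R t w))"
      by (rule sum_periodic_neg[OF cyc_rep_pos]) (simp add: cyc_rep_mod)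
    then show ?thesis
      by (simp add: avg_def inner_sum_left inner_sum_right cyc_rep_adj)
  qed
qed

lemma avg_commute:
  assumes "linear f" "\<And>t v. f (R t v) = R t (f v)"
  shows "f (avg p R v) = avg p R (f v)"
  using assms by (simp add: avg_def linear_scale linear_sum)

lemma avg_defect_le:
  assumes "\<And>t. norm (R t v - v) \<le> c"
  shows "norm (v - avg p R v) \<le> c"
proof -
  have p: "real_of_int p > 0" using cyc_rep_pos by simp
  have "v - avg p R v = (1 / of_int p) *\<^sub>R (\<Sum>t\<in>{0..<p}. v - R t v)"
    using p by (simp add: avg_def sum_subtractf sum_constant_scaleR scaleR_diff_right)
  also have "norm \<dots> = (1 / of_int p) * norm (\<Sum>t\<in>{0..<p}. v - R t v)" using p by simp
  also have "\<dots> \<le> (1 / of_int p) * (\<Sum>t\<in>{0..<p}. c)"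
  proof (rule mult_left_mono)
    have "norm (\<Sum>t\<in>{0..<p}. v - R t v) \<le> (\<Sum>t\<in>{0..<p}. norm (v - R t v))" by (rule norm_sum)
    also have "\<dots> \<le> (\<Sum>t\<in>{0..<p}. c)"
      by (intro sum_mono) (metis assms norm_minus_commute)
    finally show "norm (\<Sum>t\<in>{0..<p}. v - R t v) \<le> (\<Sum>t\<in>{0..<p}. c)" .
  qed (use p in simp)
  finally show ?thesis using p by simp
qed

end

lemma avg_avg_commute:
  assumes "cyc_rep p R" "cyc_rep p S" "\<And>s t v. R s (S t v) = S t (R s v)"
  shows "avg p R (avg p S v) = avg p S (avg p R v)"
proof (rule avg_commute[OF assms(2)])
  show "linear (avg p R)" by (rule oproj_linear[OF avg_oproj[OF assms(1)]])
  fix t v show "avg p R (S t v) = S t (avg p R v)"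
    by (rule avg_commute[OF assms(1), symmetric])
      (use assms cyc_rep_linear[OF assms(2)] in auto)
qed

lemma oproj_compose:
  assumes "oproj P" "oproj Q" "\<And>v. P (Q v) = Q (P v)"
  shows "oproj (\<lambda>v. P (Q v))"
  unfolding oproj_def
proof (intro conjI allI)
  show "linear (\<lambda>v. P (Q v))"
    using linear_compose[OF oproj_linear[OF assms(2)] oproj_linear[OF assms(1)]] by (simp add: o_def)
  show "P (Q (P (Q v))) = P (Q v)" for v
    by (metis assms oproj_idem)
  show "inner (P (Q v)) w = inner v (P (Q w))" for v w
    by (metis assms oproj_adj)
qed

lemma bessel:
  fixes P :: "'i \<Rightarrow> 'v::real_inner \<Rightarrow> 'v"
  assumes "finite I" "\<And>i. i \<in> I \<Longrightarrow> oproj (P i)"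
    and orth: "\<And>i j. i \<in> I \<Longrightarrow> j \<in> I \<Longrightarrow> i \<noteq> j \<Longrightarrow> inner (P i w) (P j w) = 0"
  shows "(\<Sum>i\<in>I. (norm (P i w))\<^sup>2) \<le> (norm w)\<^sup>2"
proof -
  let ?S = "\<Sum>i\<in>I. P i w"
  have "inner (P i w) ?S = (norm (P i w))\<^sup>2" if "i \<in> I" for i
  proof -
    have "(\<Sum>j\<in>I-{i}. inner (P i w) (P j w)) = 0"
      by (intro sum.neutral) (use orth that in auto)
    then show ?thesis
      by (simp add: sum.remove[OF assms(1) that] inner_add_right inner_sum_right power2_norm_eq_inner)
  qed
  then have "inner ?S ?S = (\<Sum>i\<in>I. (norm (P i w))\<^sup>2)"
    by (subst inner_sum_left) simp
  moreover have "inner w ?S = (\<Sum>i\<in>I. (norm (P i w))\<^sup>2)"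
    using assms(2) by (simp add: inner_sum_right oproj_inner)
  ultimately show ?thesis
    using norm_diff_sq[of w ?S] by (simp add: power2_norm_eq_inner[of ?S]) 
      (smt (verit) zero_le_power2)
qed

section \<open>Angles between root subgroups\<close>

lemma mod_inverse_exists:
  fixes p d :: int
  assumes "prime p" "\<not> p dvd d"
  obtains e where "(d * e) mod p = 1"
proof -
  have "coprime d p" using assms by (metis coprime_commute prime_imp_coprime)
  then obtain e where "[d * e = 1] (mod p)" using cong_solve_coprime_int by blast
  then show ?thesis using that assms(1) prime_gt_1_int by (auto simp: cong_def)
qed

text \<open>The quadratic curve \<open>s \<mapsto> (1, s, s\<^sup>2)\<close> in \<open>\<F>\<^sub>p\<^sup>3\<close> has no three linearly dependent points.\<close>

lemma vandermonde_subgroup: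
  fixes p s1 s2 s3 :: int and G :: "(int \<times> int \<times> int) set"
  assumes p: "prime p"
    and add: "\<And>a b c a' b' c'. (a,b,c) \<in> G \<Longrightarrow> (a',b',c') \<in> G \<Longrightarrow> (a+a', b+b', c+c') \<in> G"
    and mult: "\<And>k a b c. (a,b,c) \<in> G \<Longrightarrow> (k*a, k*b, k*c) \<in> G"
    and per: "\<And>a b c. (a mod p, b mod p, c mod p) \<in> G \<Longrightarrow> (a,b,c) \<in> G"
    and per': "\<And>a b c. (a, b, c) \<in> G \<Longrightarrow> (a mod p,b mod p,c mod p) \<in> G"
    and s: "\<not> p dvd s2 - s1" "\<not> p dvd s3 - s1" "\<not> p dvd s3 - s2"
    and in_G: "(1, s1, s1\<^sup>2) \<in> G" "(1, s2, s2\<^sup>2) \<in> G" "(1, s3, s3\<^sup>2) \<in> G"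
  shows "(a, b, c) \<in> G"
proof -
  have diff: "(a-a', b-b', c-c') \<in> G" if "(a,b,c) \<in> G" "(a',b',c') \<in> G" for a b c a' b' c'
    using add[OF that(1) mult[OF that(2), of "-1"]] by simp
  \<comment> \<open>Divided difference of two curve points: (t^2 - s1^2) / (t - s1) = s1 + t. Two of
    these differ by a multiple of the third basis vector, from which the other basis vectors are
    recovered.\<close>
  have line: "(0, 1, s1 + t) \<in> G" if t: "(1, t, t\<^sup>2) \<in> G" "\<not> p dvd t - s1" for t
  proof -
    from mod_inverse_exists[OF p t(2)] obtain e where e: "((t - s1) * e) mod p = 1" by blast
    from mult[OF diff[OF t(1) in_G(1)], of e]
    have "(0, e * (t - s1), e * ((t - s1) * (s1 + t))) \<in> G"
      by (simp add: power2_eq_square algebra_simps)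
    from per'[OF this] have G: "(0, (e * (t - s1)) mod p, (e * ((t - s1) * (s1 + t))) mod p) \<in> G" by simp
    have e': "(e * (t - s1)) mod p = 1" using e by (simp only: mult.commute)
    have "(e * ((t - s1) * (s1 + t))) mod p = ((e * (t - s1)) mod p * (s1 + t)) mod p"
      by (simp only: mod_mult_left_eq mult.assoc)
    then have "(e * ((t - s1) * (s1 + t))) mod p = (s1 + t) mod p" by (simp only: e' mult_1)
    with G e' have "(0 mod p, 1 mod p, (s1 + t) mod p) \<in> G" using prime_gt_1_int[OF p] by simp
    from per[OF this] show ?thesis .
  qed
  from diff[OF line[OF in_G(3) s(2)] line[OF in_G(2) s(1)]] have "(0, 0, s3 - s2) \<in> G" by simp
  from mod_inverse_exists[OF p s(3)] obtain e where e: "((s3 - s2) * e) mod p = 1" by blast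
  from mult[OF \<open>(0, 0, s3 - s2) \<in> G\<close>, of e] have "(0, 0, (s3 - s2) * e) \<in> G" by (simp add: mult.commute)
  from per'[OF this] have "(0 mod p, 0 mod p, 1 mod p) \<in> G" using e prime_gt_1_int[OF p] by simp
  from per[OF this] have e3: "(0, 0, 1) \<in> G" .
  from diff[OF line[OF in_G(2) s(1)] mult[OF e3, of "s1 + s2"]] have e2: "(0, 1, 0) \<in> G" by simp
  from diff[OF diff[OF in_G(1) mult[OF e2, of s1]] mult[OF e3, of "s1\<^sup>2"]] have e1: "(1, 0, 0) \<in> G" by simp
  from add[OF add[OF mult[OF e1, of a] mult[OF e2, of b]] mult[OF e3, of c]] show ?thesis by simp
qed

text \<open>\<open>g\<close> is the adjoint of \<open>f\<close>. Since \<open>g\<close> preserves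
  the range of \<open>P\<close>, \<open>f\<close> preserves its orthogonal complement; together with
  invariance of the range under \<open>f\<close> this is commutation.\<close>

lemma oproj_commute_orthogonal:
  assumes P: "oproj P" and f: "linear f" "\<And>v w. inner (f v) w = inner v (g w)"
    and fW: "\<And>v. P v = v \<Longrightarrow> P (f v) = f v" and gW: "\<And>v. P v = v \<Longrightarrow> P (g v) = g v"
  shows "P (f v) = f (P v)"
proof -
  define u where "u = v - P v"
  have Pu: "P u = 0" by (simp add: u_def linear_diff[OF oproj_linear[OF P]] oproj_idem[OF P])
  have "inner (P (f u)) z = 0" for z
  proof -
    have "inner (P (f u)) z = inner u (P (g (P z)))"
      by (simp add: oproj_adj[OF P] f(2) gW[OF oproj_idem[OF P]])
    also have "\<dots> = 0" by (simp add: oproj_adj[OF P, symmetric] Pu)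
    finally show ?thesis .
  qed
  then have "P (f u) = 0" by (metis inner_eq_zero_iff)
  then show ?thesis
    using fW[OF oproj_idem[OF P], of v]
    by (simp add: u_def linear_diff[OF f(1)] linear_diff[OF oproj_linear[OF P]])
qed

text \<open>\<open>n\<close> is an action of F_p^3, read as coefficient triples of a y^2 + 2 b y z +
  c z^2, and \<open>conj\<close> says that \<open>B s\<close> substitutes y + s z for y. The action
  need not be faithful: commuting pairs and pairs with a linear first member are instances as well,
  so a single angle estimate serves all pairs.\<close>

locale quadratic_pair =
  fixes p :: int and n :: "int \<Rightarrow> int \<Rightarrow> int \<Rightarrow> 'v::real_inner \<Rightarrow> 'v" and B :: "int \<Rightarrow> 'v \<Rightarrow> 'v"
  assumes p: "prime p"
    and orth: "orthogonal_transformation (n a b c)"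
    and add: "n (a + a') (b + b') (c + c') v = n a b c (n a' b' c' v)"
    and per: "n (a mod p) (b mod p) (c mod p) = n a b c"
    and B: "cyc_rep p B"
    and conj: "B (- s) (n a b c (B s v)) = n a (b + a * s) (c + 2 * b * s + a * s\<^sup>2) v"
begin

lemma p_pos: "p > 0"
  using p prime_gt_0_int by blast

lemma line_rep: "cyc_rep p (\<lambda>t. n (t * x) (t * y) (t * z))"
proof -
  have "n (t mod p * x) (t mod p * y) (t mod p * z) = n (t * x) (t * y) (t * z)" for t
    using per[of "t mod p * x" "t mod p * y" "t mod p * z"] per[of "t * x" "t * y" "t * z"]
    by (simp add: mod_mult_left_eq)
  then show ?thesis
    by (simp add: cyc_rep_def p_pos orth distrib_right add)
qed

text \<open>The factors 1 and 0 stay unsimplified so that the facts about averages over lines, such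
  as \<open>line_rep\<close>, match syntactically.\<close>

definition "L1 = avg p (\<lambda>t. n (t * 1) (t * 0) (t * 0))"
definition "L2 = avg p (\<lambda>t. n (t * 0) (t * 1) (t * 0))"
definition "L3 = avg p (\<lambda>t. n (t * 0) (t * 0) (t * 1))"

definition "PN v = L1 (L2 (L3 v))"

definition "PA = avg p (\<lambda>t. n (t * 1) (t * 0) (t * 0))"

definition "PB = avg p B"

definition "Q s = avg p (\<lambda>t. n (t * 1) (t * s) (t * s\<^sup>2))"

lemma n_commute: "n a b c (n a' b' c' v) = n a' b' c' (n a b c v)"
  by (metis add add.commute)

lemma line_avg_commute:
  "avg p (\<lambda>t. n (t * x) (t * y) (t * z)) (avg p (\<lambda>t. n (t * x') (t * y') (t * z')) v)
    = avg p (\<lambda>t. n (t * x') (t * y') (t * z')) (avg p (\<lambda>t. n (t * x) (t * y) (t * z)) v)"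
  by (intro avg_avg_commute line_rep n_commute)

lemma line_oproj: "oproj (avg p (\<lambda>t. n (t * x) (t * y) (t * z)))"
  by (intro avg_oproj line_rep)

lemma PA_oproj: "oproj PA" and Q_oproj: "oproj (Q s)" and PB_oproj: "oproj PB"
  unfolding PA_def Q_def PB_def by (intro line_oproj avg_oproj B)+

lemma L_commute: "L1 (L2 v) = L2 (L1 v)" "L1 (L3 v) = L3 (L1 v)" "L2 (L3 v) = L3 (L2 v)"
  unfolding L1_def L2_def L3_def by (rule line_avg_commute)+

lemma PN_oproj: "oproj PN"
proof -
  have o: "oproj L1" "oproj L2" "oproj L3"
    unfolding L1_def L2_def L3_def by (rule line_oproj)+
  have "oproj (\<lambda>v. L1 (L2 (L3 v)))"
    by (rule oproj_compose[OF o(1) oproj_compose[OF o(2,3) L_commute(3)]]) (simp only: L_commute)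
  then show ?thesis unfolding PN_def[abs_def] .
qed

lemma line_avg_fixed: "n (s * x) (s * y) (s * z) (avg p (\<lambda>t. n (t * x) (t * y) (t * z)) v)
    = avg p (\<lambda>t. n (t * x) (t * y) (t * z)) v"
  using avg_invariant[OF line_rep] .

text \<open>The three axis averages commute, so each can be brought to the front, where its own axis
  group acts trivially on the result.\<close>

lemma PN_fixed: "n a b c (PN v) = PN v"
proof -
  have 1: "n (a * 1) (a * 0) (a * 0) (PN v) = PN v"
    unfolding PN_def L1_def by (rule line_avg_fixed)
  have "PN v = L2 (L1 (L3 v))" by (simp only: PN_def L_commute)
  then have 2: "n (b * 0) (b * 1) (b * 0) (PN v) = PN v"
    unfolding L2_def by (simp only: line_avg_fixed)
  have "PN v = L3 (L1 (L2 v))" by (simp only: PN_def L_commute)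
  then have 3: "n (c * 0) (c * 0) (c * 1) (PN v) = PN v"
    unfolding L3_def by (simp only: line_avg_fixed)
  show ?thesis
    using 1 2 3 add[of a 0 b 0 c 0 "PN v"] add[of a 0 0 b 0 c "PN v"] add[of 0 0 b 0 0 c "PN v"]
      add[of a 0 0 b 0 0 "PN v"] add[of a 0 b 0 0 c "PN v"]
    by simp
qed

lemma PN_of_fixed: assumes "\<And>a b c. n a b c v = v" shows "PN v = v"
  unfolding PN_def L1_def L2_def L3_def by (simp add: avg_fixed[OF line_rep[of 1 0 0, simplified]]
    avg_fixed[OF line_rep[of 0 1 0, simplified]] avg_fixed[OF line_rep[of 0 0 1, simplified]] assms)

lemma PN_eq_iff: "PN v = v \<longleftrightarrow> (\<forall>a b c. n a b c v = v)"
  using PN_fixed PN_of_fixed by metis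

lemma B_conj: "n a b c (B s v) = B s (n a (b + a * s) (c + 2 * b * s + a * s\<^sup>2) v)"
  using conj[of s a b c v] cyc_rep_neg[OF B] by metis

text \<open>\<open>B s\<close> and its inverse normalise the action \<open>n\<close>, so both
  preserve its fixed space.\<close>

lemma PN_B: "PN (B s v) = B s (PN v)"
proof (rule oproj_commute_orthogonal[OF PN_oproj cyc_rep_linear[OF B] cyc_rep_adj[OF B]])
  show "PN (B t v) = B t v" if "PN v = v" for t v
    using that unfolding PN_eq_iff by (simp add: B_conj)
  then show "PN (B (- s) v) = B (- s) v" if "PN v = v" for v
    using that by simp
qed

lemma PN_PB: "PN (PB v) = PB (PN v)"
  unfolding PB_def
  by (rule avg_commute[where f = PN, OF B oproj_linear[OF PN_oproj] PN_B])

text \<open>For a \<open>B\<close>-invariant vector the averages over the lines of the curve are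
  translates of \<open>PA u\<close>. One vector thus becomes \<open>p\<close> vectors of equal
  norm.\<close>

lemma Q_eq: assumes "PB u = u" shows "Q s u = B (- s) (PA u)"
proof -
  have fx: "B t u = u" for t using assms avg_invariant[OF B] unfolding PB_def by metis
  have "n t (t * s) (t * s\<^sup>2) u = B (- s) (n t 0 0 u)" for t
    using conj[of s t 0 0 u] by (simp add: fx)
  then show ?thesis
    by (simp add: Q_def PA_def avg_def linear_scale[OF cyc_rep_linear[OF B]] linear_sum[OF cyc_rep_linear[OF B]])
qed

lemma PN_Q: "PN (Q s v) = PN v"
proof -
  have "inner (PN (Q s v)) z = inner (PN v) z" for z
  proof -
    have "Q s (PN z) = PN z"
      unfolding Q_def by (rule avg_fixed[OF line_rep]) (rule PN_fixed)
    then show ?thesis by (simp add: oproj_adj[OF PN_oproj] oproj_adj[OF Q_oproj])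
  qed
  then show ?thesis by (metis inner_diff_left inner_eq_zero_iff right_minus_eq)
qed

lemma Q_commute: "Q s (Q t v) = Q t (Q s v)"
  unfolding Q_def by (rule line_avg_commute)

text \<open>The product is fixed by three lines that span F_p^3, hence by all of \<open>n\<close>.
  But its projection to the \<open>n\<close>-fixed vectors is \<open>PN u\<close>, which
  vanishes.\<close>

lemma Q_triple:
  assumes s: "s1 \<in> {0..<p}" "s2 \<in> {0..<p}" "s3 \<in> {0..<p}" "s1 \<noteq> s2" "s1 \<noteq> s3" "s2 \<noteq> s3"
    and u: "PN u = 0"
  shows "Q s1 (Q s2 (Q s3 u)) = 0"
proof -
  define w where "w = Q s1 (Q s2 (Q s3 u))"
  define G where "G = {(a, b, c). n a b c w = w}"
  have nd: "\<not> p dvd t - s" if "s \<in> {0..<p}" "t \<in> {0..<p}" "s \<noteq> t" for s t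
    using that by (metis atLeastLessThan_iff mod_eq_dvd_iff mod_pos_pos_trivial)
  have fx: "n 1 s (s\<^sup>2) (Q s v) = Q s v" for s v
    using line_avg_fixed[of 1 1 s "s\<^sup>2" v] by (simp add: Q_def)
  have "(a, b, c) \<in> G" for a b c
  proof (rule vandermonde_subgroup[OF p])
    show "(k * a, k * b, k * c) \<in> G" if "(a, b, c) \<in> G" for k a b c
    proof -
      have "n (1 * a) (1 * b) (1 * c) w = w" using that by (simp add: G_def)
      from cyc_rep_invariant[OF line_rep[of a b c] this] show ?thesis by (simp add: G_def)
    qed
    show "(1, s1, s1\<^sup>2) \<in> G" unfolding G_def w_def by (simp add: fx)
    have w2: "w = Q s2 (Q s1 (Q s3 u))" unfolding w_def by (rule Q_commute)
    have w3: "w = Q s3 (Q s1 (Q s2 u))" unfolding w_def Q_commute[of s2 s3] by (rule Q_commute)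
    have "n 1 s2 (s2\<^sup>2) w = w" by (subst (1 2) w2) (rule fx)
    then show "(1, s2, s2\<^sup>2) \<in> G" by (simp add: G_def)
    have "n 1 s3 (s3\<^sup>2) w = w" by (subst (1 2) w3) (rule fx)
    then show "(1, s3, s3\<^sup>2) \<in> G" by (simp add: G_def)
    show "\<not> p dvd s2 - s1" "\<not> p dvd s3 - s1" "\<not> p dvd s3 - s2"
      using nd[OF s(1,2,4)] nd[OF s(1,3,5)] nd[OF s(2,3,6)] by blast+
  qed (auto simp: G_def add per)
  then have "PN w = w" unfolding PN_eq_iff by (simp add: G_def)
  moreover have "PN w = 0" unfolding w_def by (simp add: PN_Q u)
  ultimately show ?thesis by (simp add: w_def)
qed

text \<open>The vectors \<open>Q s u\<close> have the norm of \<open>PA u\<close> and are almost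
  orthogonal on average. With x = ||PA u||^2, their sum \<open>S\<close> satisfies <S, u> = p x and
  ||S||^2 <= 2 p x, and Cauchy-Schwarz compares the two.\<close>

lemma angle_bound:
  assumes u: "PB u = u" "PN u = 0"
  shows "p * (norm (PA u))\<^sup>2 \<le> 2 * (norm u)\<^sup>2"
proof -
  let ?I = "{0..<p}"
  define x where "x = (norm (PA u))\<^sup>2"
  define S where "S = (\<Sum>s\<in>?I. Q s u)"
  have x: "(norm (Q s u))\<^sup>2 = x" for s
    by (simp add: Q_eq[OF u(1)] cyc_rep_norm[OF B] x_def)
  have Su: "inner S u = p * x"
    using p_pos by (simp add: S_def inner_sum_left oproj_inner'[OF Q_oproj] x)
  have cross: "inner (Q s u) (Q t u) = (norm (Q t (Q s u)))\<^sup>2" for s t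
  proof -
    have "(norm (Q t (Q s u)))\<^sup>2 = inner (Q s u) (Q t (Q s u))"
      by (simp add: oproj_inner[OF Q_oproj])
    also have "\<dots> = inner (Q s u) (Q t u)"
      by (metis Q_commute Q_oproj oproj_adj oproj_idem)
    finally show ?thesis by simp
  qed
  \<comment> \<open>The diagonal contributes \<open>x\<close>. The other terms are the squared norms
    of \<open>Q t (Q s u)\<close>, which are orthogonal for distinct \<open>t\<close> by
    \<open>Q_triple\<close>; Bessel bounds their sum by another \<open>x\<close>.\<close>
  have row: "(\<Sum>t\<in>?I. inner (Q s u) (Q t u)) \<le> 2 * x" if s: "s \<in> ?I" for s
  proof -
    have "(\<Sum>t\<in>?I-{s}. (norm (Q t (Q s u)))\<^sup>2) \<le> (norm (Q s u))\<^sup>2"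
    proof (rule bessel)
      fix i j assume "i \<in> ?I - {s}" "j \<in> ?I - {s}" "i \<noteq> j"
      then have "Q j (Q i (Q s u)) = 0" using s u(2) by (intro Q_triple) auto
      then show "inner (Q i (Q s u)) (Q j (Q s u)) = 0"
        by (metis Q_oproj inner_zero_left oproj_adj)
    qed (auto intro: Q_oproj)
    then show ?thesis
      by (simp add: sum.remove[OF _ s] x power2_norm_eq_inner[symmetric] flip: cross)
  qed
  have "(norm S)\<^sup>2 = (\<Sum>s\<in>?I. \<Sum>t\<in>?I. inner (Q s u) (Q t u))"
    unfolding S_def power2_norm_eq_inner inner_sum_left inner_sum_right
    by (intro sum.cong refl inner_commute)
  also have "\<dots> \<le> (\<Sum>s\<in>?I. 2 * x)" by (intro sum_mono row)
  also have "\<dots> = 2 * (p * x)" using p_pos by simp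
  finally have S: "(norm S)\<^sup>2 \<le> 2 * (p * x)" .
  have px: "0 \<le> p * x" using p_pos by (simp add: x_def)
  have "p * x \<le> norm S * norm u"
    using norm_cauchy_schwarz[of S u] Su by simp
  then have "(p * x)\<^sup>2 \<le> (norm S)\<^sup>2 * (norm u)\<^sup>2"
    using power_mono[OF _ px, of "norm S * norm u" 2] by (simp add: power_mult_distrib)
  also have "\<dots> \<le> 2 * (p * x) * (norm u)\<^sup>2"
    by (intro mult_right_mono S) simp
  finally have le: "(p * x) * (p * x) \<le> (p * x) * (2 * (norm u)\<^sup>2)"
    by (simp add: power2_eq_square mult_ac)
  have "p * x \<le> 2 * (norm u)\<^sup>2"
  proof (cases "p * x = 0")
    case False
    with px have "0 < p * x" by (metis order_le_less)
    then show ?thesis using le mult_le_cancel_left_pos by blast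
  qed (metis mult_nonneg_nonneg zero_le_numeral zero_le_power2)
  then show ?thesis unfolding x_def .
qed

text \<open>The third condition on \<open>c\<close> says sqrt(2/p) <= c. The common fixed vectors
  are taken to be those of \<open>B\<close> and of all of \<open>n\<close>, with projection
  \<open>PN (PB v)\<close>.\<close>

lemma pair_angle:
  fixes c :: real
  assumes c: "0 \<le> c" "c \<le> 1/4" "2 \<le> c\<^sup>2 * p"
  shows "inner (v - PA v) (v - PB v) \<ge> - c * ((norm (v - PA v))\<^sup>2 + (norm (v - PB v))\<^sup>2)"
proof (rule oproj_pair_angle[OF PA_oproj PB_oproj oproj_compose[OF PN_oproj PB_oproj PN_PB] _ _ c(1,2)])
  show "PA (PN (PB v)) = PN (PB v)" for v
    unfolding PA_def by (rule avg_fixed[OF line_rep]) (rule PN_fixed)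
  show "PB (PN (PB v)) = PN (PB v)" for v
    by (simp add: PN_PB oproj_idem[OF PB_oproj])
  fix u assume u: "PB u = u" "PN (PB u) = 0"
  have "p * (norm (PA u))\<^sup>2 \<le> (c\<^sup>2 * p) * (norm u)\<^sup>2"
    using angle_bound[of u] u mult_right_mono[OF c(3), of "(norm u)\<^sup>2"] by simp
  then have "(norm (PA u))\<^sup>2 \<le> (c * norm u)\<^sup>2"
    using p_pos by (simp add: power_mult_distrib mult_ac)
  then show "norm (PA u) \<le> c * norm u"
    by (rule power2_le_imp_le) (use c in simp)
qed

end

section \<open>Relative property (T) of the affine plane\<close>

lemma dirichlet_kernel:
  "2 * sin (t / 2) * (\<Sum>c\<in>{- int m..int m}. cos (of_int c * t)) = 2 * sin ((2 * real m + 1) * t / 2)"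
proof (induction m)
  case (Suc m)
  have "{- int (Suc m)..int (Suc m)} = insert (int (Suc m)) (insert (- int (Suc m)) {- int m..int m})"
    by auto
  then have "(\<Sum>c\<in>{- int (Suc m)..int (Suc m)}. cos (of_int c * t))
      = 2 * cos (real (Suc m) * t) + (\<Sum>c\<in>{- int m..int m}. cos (of_int c * t))"
    using cos_minus[of "t + t * real m"] by (simp add: algebra_simps)
  then have "2 * sin (t / 2) * (\<Sum>c\<in>{- int (Suc m)..int (Suc m)}. cos (of_int c * t))
      = 2 * (2 * sin (t / 2) * cos (real (Suc m) * t)) + 2 * sin ((2 * real m + 1) * t / 2)"
    using Suc by (simp add: algebra_simps)
  also have "2 * sin (t / 2) * cos (real (Suc m) * t)
      = sin (real (Suc m) * t + t / 2) - sin (real (Suc m) * t - t / 2)"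
    by (simp add: sin_add sin_diff)
  also have "real (Suc m) * t + t / 2 = (2 * real (Suc m) + 1) * t / 2" by (simp add: field_simps)
  also have "real (Suc m) * t - t / 2 = (2 * real m + 1) * t / 2" by (simp add: field_simps)
  finally show ?case by simp
qed simp

text \<open>Orthogonality of the characters of Z/p. With residues symmetric about 0 the sine parts
  cancel, so real functions suffice.\<close>

lemma sum_cos_character:
  fixes x :: int
  assumes p: "p = 2 * int m + 1"
  shows "(\<Sum>c\<in>{- int m..int m}. cos (2 * pi / p * (c * x))) = (if p dvd x then p else 0)"
proof (cases "p dvd x")
  case True
  then obtain k where k: "x = p * k" by blast
  have "cos (2 * pi / p * (c * x)) = 1" for c
  proof -
    have "2 * pi / p * (c * x) = of_int (c * k) * (2 * pi)" using p by (simp add: k)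
    then show ?thesis by (metis cos_int_2pin mult.commute)
  qed
  then show ?thesis using True p by simp
next
  case False
  have p0: "p > 0" using p by simp
  define t where "t = 2 * pi / p * x"
  have "sin (t / 2) \<noteq> 0"
  proof
    assume "sin (t / 2) = 0"
    then obtain k :: int where "t / 2 = k * pi" using sin_zero_iff_int2 by blast
    then have "real_of_int x = of_int k * of_int p" using p0 by (simp add: t_def field_simps)
    then have "x = k * p" by (metis of_int_eq_iff of_int_mult)
    then show False using False by simp
  qed
  moreover have "sin ((2 * real m + 1) * t / 2) = 0"
  proof -
    have "2 * real m + 1 = of_int p" using p by simp
    then have "(2 * real m + 1) * t / 2 = of_int x * pi" using p0 by (simp add: t_def field_simps)
    then show ?thesis by (simp add: sin_zero_iff_int2)
  qed
  ultimately have "(\<Sum>c\<in>{- int m..int m}. cos (of_int c * t)) = 0"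
    using dirichlet_kernel[of t m] by simp
  then show ?thesis using False by (simp add: t_def mult_ac)
qed

lemma sum_sin_symmetric: "(\<Sum>c\<in>{- int m..int m}. sin (y * (of_int c * x))) = (0::real)"
proof -
  have "(\<Sum>c\<in>{- int m..int m}. sin (y * (of_int c * x))) = (\<Sum>c\<in>{- int m..int m}. sin (y * (of_int (- c) * x)))"
    by (rule sum.reindex_bij_witness[where i = uminus and j = uminus]) auto
  then show ?thesis by (simp add: sum_negf)
qed

lemma sum_cos_character2:
  fixes x y :: int
  assumes p: "p = 2 * int m + 1"
  shows "(\<Sum>c\<in>{- int m..int m}. \<Sum>d\<in>{- int m..int m}. cos (2 * pi / p * (c * x + d * y)))
    = (if p dvd x \<and> p dvd y then p\<^sup>2 else 0)"
proof -
  let ?w = "2 * pi / p"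
  have "(\<Sum>c\<in>{- int m..int m}. \<Sum>d\<in>{- int m..int m}. cos (?w * (c * x + d * y)))
    = (\<Sum>c\<in>{- int m..int m}. \<Sum>d\<in>{- int m..int m}. cos (?w * (c * x)) * cos (?w * (d * y)) - sin (?w * (c * x)) * sin (?w * (d * y)))"
    by (simp add: distrib_left cos_add)
  also have "\<dots> = (\<Sum>c\<in>{- int m..int m}. cos (?w * (c * x))) * (\<Sum>d\<in>{- int m..int m}. cos (?w * (d * y)))
     - (\<Sum>c\<in>{- int m..int m}. sin (?w * (c * x))) * (\<Sum>d\<in>{- int m..int m}. sin (?w * (d * y)))"
    by (simp add: sum_subtractf sum_product)
  also have "(\<Sum>c\<in>{- int m..int m}. sin (?w * (c * x))) = 0"
    using sum_sin_symmetric[of "?w" "real_of_int x" m] by simp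
  finally show ?thesis
    unfolding sum_cos_character[OF p] by (simp add: power2_eq_square)
qed

section \<open>Fourier analysis on the plane over F_p\<close>

locale plane_rep =
  fixes p :: int and m :: nat and U :: "int \<Rightarrow> int \<Rightarrow> 'v::real_inner \<Rightarrow> 'v"
  assumes p: "p = 2 * int m + 1" and m: "m > 0"
    and orth: "orthogonal_transformation (U a b)"
    and add: "U (a + a') (b + b') v = U a b (U a' b' v)"
    and per: "U (a mod p) (b mod p) = U a b"
begin

definition "K \<phi> v = (1 / of_int p ^ 2) *\<^sub>R (\<Sum>a\<in>{0..<p}. \<Sum>b\<in>{0..<p}. \<phi> a b *\<^sub>R U a b v)" for \<phi> :: "int \<Rightarrow> int \<Rightarrow> real"

definition ang :: "int \<Rightarrow> real" where "ang x = 2 * pi / of_int p * of_int x"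

definition "C c d = K (\<lambda>a b. cos (ang (c * a + d * b)))"
definition "S c d = K (\<lambda>a b. sin (ang (c * a + d * b)))"
text \<open>The spectral measure of \<open>v\<close> at the character (c, d): \<open>C c d v\<close>
  and \<open>S c d v\<close> are, up to sign, the real and imaginary parts of its Fourier component,
  which avoids complexifying the space.\<close>

definition "\<mu> v c d = (norm (C c d v))\<^sup>2 + (norm (S c d v))\<^sup>2"

abbreviation "B \<equiv> {- int m..int m}"

definition biper :: "(int \<Rightarrow> int \<Rightarrow> 'b) \<Rightarrow> bool" where
  "biper \<phi> \<longleftrightarrow> (\<forall>a b. \<phi> (a mod p) b = \<phi> a b \<and> \<phi> a (b mod p) = \<phi> a b)"

lemma p_pos: "p > 0" using p by simp

lemma U_linear: "linear (U a b)" using orth orthogonal_transformation_linear by blast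

lemma per1: "U (a mod p) b = U a b" and per2: "U a (b mod p) = U a b"
  using per[of "a mod p" b] per[of a "b mod p"] per[of a b] by simp_all

lemma ang_diff: "ang (x - y) = ang x - ang y"
  by (simp add: ang_def algebra_simps diff_divide_distrib)

lemma cos_ang_mod: "x mod p = y mod p \<Longrightarrow> cos (ang x) = cos (ang y)"
  and sin_ang_mod: "x mod p = y mod p \<Longrightarrow> sin (ang x) = sin (ang y)"
proof -
  assume "x mod p = y mod p"
  then obtain k where "x - y = p * k" by (metis dvd_def mod_eq_dvd_iff)
  then have "x = y + p * k" by simp
  then have "ang x = ang y + 2 * pi * of_int k" using p_pos by (simp add: ang_def field_simps)
  then show "cos (ang x) = cos (ang y)" "sin (ang x) = sin (ang y)" by (simp_all add: cos_add sin_add)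
qed

lemma biper_cos: "biper (\<lambda>a b. cos (ang (c * a + d * b)))"
  and biper_sin: "biper (\<lambda>a b. sin (ang (c * a + d * b)))"
proof -
  have "(c * (a mod p) + d * b) mod p = (c * a + d * b) mod p" "(c * a + d * (b mod p)) mod p = (c * a + d * b) mod p" for a b
    by (metis mod_add_left_eq mod_mult_right_eq) (metis mod_add_right_eq mod_mult_right_eq)
  then show "biper (\<lambda>a b. cos (ang (c * a + d * b)))" "biper (\<lambda>a b. sin (ang (c * a + d * b)))"
    unfolding biper_def using cos_ang_mod sin_ang_mod by blast+
qed

lemma K_linear: "linear (K \<phi>)"
proof -
  have "linear (\<lambda>v. \<Sum>a\<in>{0..<p}. \<Sum>b\<in>{0..<p}. \<phi> a b *\<^sub>R U a b v)"
    by (intro linear_compose_sum ballI linear_compose_scale_right U_linear)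
  from linear_compose_scale_right[OF this] show ?thesis unfolding K_def[abs_def] .
qed

lemma K_add: "K (\<lambda>a b. \<phi> a b + \<psi> a b) v = K \<phi> v + K \<psi> v"
  and K_diff: "K (\<lambda>a b. \<phi> a b - \<psi> a b) v = K \<phi> v - K \<psi> v"
  and K_scale: "K (\<lambda>a b. r * \<phi> a b) v = r *\<^sub>R K \<phi> v"
  by (simp_all add: K_def scaleR_add_left scaleR_diff_left sum.distrib sum_subtractf
      scaleR_add_right scaleR_diff_right scaleR_sum_right mult.left_commute mult.assoc)

lemma C_linear: "linear (C c d)" and S_linear: "linear (S c d)"
  unfolding C_def S_def by (rule K_linear)+

lemma sum_shift1: assumes "biper F"
  shows "(\<Sum>a\<in>{0..<p}. \<Sum>b\<in>{0..<p}. F (a + s) b) = (\<Sum>a\<in>{0..<p}. \<Sum>b\<in>{0..<p}. F a b :: 'b::comm_monoid_add)"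
  by (rule sum_periodic_shift[OF p_pos, where F = "\<lambda>a. \<Sum>b\<in>{0..<p}. F a b"])
    (use assms in \<open>simp add: biper_def\<close>)

lemma sum_shear1: assumes "biper F"
  shows "(\<Sum>a\<in>{0..<p}. \<Sum>b\<in>{0..<p}. F a (b + k * a)) = (\<Sum>a\<in>{0..<p}. \<Sum>b\<in>{0..<p}. F a b :: 'b::comm_monoid_add)"
  by (intro sum.cong refl sum_periodic_shift[OF p_pos]) (use assms in \<open>simp add: biper_def\<close>)

lemma sum_shear2: assumes "biper F"
  shows "(\<Sum>a\<in>{0..<p}. \<Sum>b\<in>{0..<p}. F (a + k * b) b) = (\<Sum>a\<in>{0..<p}. \<Sum>b\<in>{0..<p}. F a b :: 'b::comm_monoid_add)"
  by (subst (1 2) sum.swap) (intro sum.cong refl sum_periodic_shift[OF p_pos], use assms in \<open>simp add: biper_def\<close>)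

lemma biper_U: "biper \<phi> \<Longrightarrow> biper (\<lambda>a b. \<phi> a b *\<^sub>R U a b v)"
  by (simp add: biper_def per1 per2)

lemma biper_cong: 
  assumes \<phi>: "biper \<phi>" and x: "\<And>a b. x (a mod p) b mod p = x a b mod p" "\<And>a b. x a (b mod p) mod p = x a b mod p"
    and y: "\<And>a b. y (a mod p) b mod p = y a b mod p" "\<And>a b. y a (b mod p) mod p = y a b mod p"
  shows "biper (\<lambda>a b. \<phi> (x a b) (y a b))"
proof -
  have "\<phi> a b = \<phi> (a mod p) (b mod p)" for a b using \<phi> by (simp add: biper_def)
  then show ?thesis unfolding biper_def using x y by metis
qed

lemma K_U1: assumes "biper \<phi>" shows "K \<phi> (U 1 0 v) = K (\<lambda>a b. \<phi> (a - 1) b) v"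
proof -
  have b: "biper (\<lambda>a b. \<phi> (a - 1) b)"
    by (rule biper_cong[OF assms]) (simp_all add: mod_diff_left_eq)
  have eq: "\<phi> a b *\<^sub>R U a b (U 1 0 v) = \<phi> (a + 1 - 1) b *\<^sub>R U (a + 1) b v" for a b
    using add[of a 1 b 0 v] by simp
  show ?thesis unfolding K_def eq
    using sum_shift1[OF biper_U[OF b], of 1 v] by simp
qed

lemma K_U2: assumes "biper \<phi>" shows "K \<phi> (U 0 1 v) = K (\<lambda>a b. \<phi> a (b - 1)) v"
proof -
  have b: "biper (\<lambda>a b. \<phi> a (b - 1))"
    by (rule biper_cong[OF assms]) (simp_all add: mod_diff_left_eq)
  have eq: "\<phi> a b *\<^sub>R U a b (U 0 1 v) = \<phi> a (b + 1 - 1) *\<^sub>R U a (b + 1) v" for a b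
    using add[of a 0 b 1 v] by simp
  have "(\<Sum>a\<in>{0..<p}. \<Sum>b\<in>{0..<p}. \<phi> a (b + 1 - 1) *\<^sub>R U a (b + 1) v) = (\<Sum>a\<in>{0..<p}. \<Sum>b\<in>{0..<p}. \<phi> a (b - 1) *\<^sub>R U a b v)"
    using biper_U[OF b, of v] unfolding biper_def
    by (intro sum.cong refl sum_periodic_shift[OF p_pos, where F = "\<lambda>b. \<phi> _ (b - 1) *\<^sub>R U _ b v"]) auto
  then show ?thesis unfolding K_def eq by simp
qed

text \<open>Translation rotates the pair of \<open>C\<close> and \<open>S\<close> by the angle of
  the character, and |exp(i t) - 1|^2 = 2 - 2 cos t.\<close>

lemma \<mu>_U:
  shows "\<mu> (U 1 0 v - v) c d = (2 - 2 * cos (ang c)) * \<mu> v c d"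
    and "\<mu> (U 0 1 v - v) c d = (2 - 2 * cos (ang d)) * \<mu> v c d"
proof -
  have rot: "(norm (x *\<^sub>R u + y *\<^sub>R w - u))\<^sup>2 + (norm (x *\<^sub>R w - y *\<^sub>R u - w))\<^sup>2 = (2 - 2 * x) * ((norm u)\<^sup>2 + (norm w)\<^sup>2)"
    if "x\<^sup>2 + y\<^sup>2 = 1" for x y :: real and u w :: 'v
  proof -
    have "(norm (x *\<^sub>R u + y *\<^sub>R w - u))\<^sup>2 + (norm (x *\<^sub>R w - y *\<^sub>R u - w))\<^sup>2 = ((x\<^sup>2 + y\<^sup>2) + 1 - 2 * x) * (inner u u + inner w w)"
      unfolding power2_norm_eq_inner inner_diff_left inner_diff_right inner_add_left inner_add_right inner_scaleR_left inner_scaleR_right inner_commute[of w u]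
      by (simp add: power2_eq_square algebra_simps)
    then show ?thesis using that by (simp add: power2_norm_eq_inner)
  qed
  have e: "c * (a - 1) + d * b = c * a + d * b - c" "c * a + d * (b - 1) = c * a + d * b - d" for a b
    by (simp_all add: algebra_simps)
  have "C c d (U 1 0 v) = cos (ang c) *\<^sub>R C c d v + sin (ang c) *\<^sub>R S c d v"
    "S c d (U 1 0 v) = cos (ang c) *\<^sub>R S c d v - sin (ang c) *\<^sub>R C c d v"
    "C c d (U 0 1 v) = cos (ang d) *\<^sub>R C c d v + sin (ang d) *\<^sub>R S c d v"
    "S c d (U 0 1 v) = cos (ang d) *\<^sub>R S c d v - sin (ang d) *\<^sub>R C c d v"
    unfolding C_def S_def K_U1[OF biper_cos] K_U1[OF biper_sin] K_U2[OF biper_cos] K_U2[OF biper_sin]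
      K_add[symmetric] K_diff[symmetric] K_scale[symmetric]
      e ang_diff cos_diff sin_diff
    by (simp_all only: mult.commute)
  then show "\<mu> (U 1 0 v - v) c d = (2 - 2 * cos (ang c)) * \<mu> v c d"
    "\<mu> (U 0 1 v - v) c d = (2 - 2 * cos (ang d)) * \<mu> v c d"
    unfolding \<mu>_def linear_diff[OF C_linear] linear_diff[OF S_linear]
    by (simp_all only: rot[OF sin_cos_squared_add2])
qed

text \<open>After expanding the squares, summing over the characters first leaves only pairs of
  equal group elements, all contributing the same norm.\<close>

lemma parseval: "(\<Sum>c\<in>B. \<Sum>d\<in>B. \<mu> v c d) = (norm v)\<^sup>2"
proof -
  let ?N = "{0..<p} \<times> {0..<p}"
  define an :: "int \<Rightarrow> int \<Rightarrow> int \<times> int \<Rightarrow> real" where "an c d n = ang (c * fst n + d * snd n)" for c d n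
  define V where "V n = U (fst n) (snd n) v" for n
  have K: "K (\<lambda>a b. f (ang (c * a + d * b))) v = (1 / of_int p ^ 2) *\<^sub>R (\<Sum>n\<in>?N. f (an c d n) *\<^sub>R V n)" for f c d
    by (simp add: K_def an_def V_def sum.cartesian_product case_prod_unfold)
  have mu: "\<mu> v c d = (1 / of_int p ^ 4) * (\<Sum>n\<in>?N. \<Sum>n'\<in>?N. cos (an c d n - an c d n') * inner (V n) (V n'))" for c d
  proof -
    have "\<mu> v c d = (1 / of_int p ^ 4) * ((\<Sum>n\<in>?N. \<Sum>n'\<in>?N. (cos (an c d n) * cos (an c d n')) * inner (V n) (V n'))
      + (\<Sum>n\<in>?N. \<Sum>n'\<in>?N. (sin (an c d n) * sin (an c d n')) * inner (V n) (V n')))"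
    proof -
      have "(norm ((1 / of_int p ^ 2 :: real) *\<^sub>R (\<Sum>n\<in>?N. f n *\<^sub>R V n)))\<^sup>2 = (1 / of_int p ^ 4) * (\<Sum>n\<in>?N. \<Sum>n'\<in>?N. (f n * f n') * inner (V n) (V n'))" for f
      proof -
        have "inner (\<Sum>n\<in>?N. f n *\<^sub>R V n) (\<Sum>n\<in>?N. f n *\<^sub>R V n) = (\<Sum>n\<in>?N. \<Sum>n'\<in>?N. (f n * f n') * inner (V n) (V n'))"
          unfolding inner_sum_left unfolding inner_sum_right by (simp add: mult.assoc mult.left_commute)
        moreover have "(1 / of_int p ^ 2)\<^sup>2 = (1 / of_int p ^ 4 :: real)"
          by (simp add: power_divide flip: power_mult)
        ultimately show ?thesis by (simp only: norm_scaleR power_mult_distrib power2_abs power2_norm_eq_inner)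
      qed
      then show ?thesis unfolding \<mu>_def C_def S_def K by (simp only: distrib_left)
    qed
    then show ?thesis by (simp only: cos_diff distrib_right sum.distrib)
  qed
  have ch: "(\<Sum>c\<in>B. \<Sum>d\<in>B. cos (an c d n - an c d n')) = (if n = n' then of_int p ^ 2 else 0)"
    if n: "n \<in> ?N" "n' \<in> ?N" for n n'
  proof -
    have "an c d n - an c d n' = 2 * pi / p * (c * (fst n - fst n') + d * (snd n - snd n'))" for c d
      by (simp add: an_def ang_diff[symmetric]) (use p_pos in \<open>simp add: ang_def field_simps\<close>)
    moreover have "p dvd (fst n - fst n') \<longleftrightarrow> fst n = fst n'" "p dvd (snd n - snd n') \<longleftrightarrow> snd n = snd n'"
      using n by (auto simp: mod_eq_dvd_iff[symmetric])
    ultimately show ?thesis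
      using sum_cos_character2[OF p, of "fst n - fst n'" "snd n - snd n'"] by (auto simp: prod_eq_iff)
  qed
  have "(\<Sum>c\<in>B. \<Sum>d\<in>B. \<mu> v c d) = (1 / of_int p ^ 4) * (\<Sum>c\<in>B. \<Sum>d\<in>B. \<Sum>n\<in>?N. \<Sum>n'\<in>?N. cos (an c d n - an c d n') * inner (V n) (V n'))"
    by (simp only: mu sum_distrib_left)
  also have "(\<Sum>c\<in>B. \<Sum>d\<in>B. \<Sum>n\<in>?N. \<Sum>n'\<in>?N. cos (an c d n - an c d n') * inner (V n) (V n'))
     = (\<Sum>c\<in>B. \<Sum>n\<in>?N. \<Sum>n'\<in>?N. \<Sum>d\<in>B. cos (an c d n - an c d n') * inner (V n) (V n'))"
    by (intro sum.cong refl, subst sum.swap, intro sum.cong refl, rule sum.swap)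
  also have "\<dots> = (\<Sum>n\<in>?N. \<Sum>n'\<in>?N. \<Sum>c\<in>B. \<Sum>d\<in>B. cos (an c d n - an c d n') * inner (V n) (V n'))"
    by (subst sum.swap, intro sum.cong refl, rule sum.swap)
  also have "\<dots> = (\<Sum>n\<in>?N. \<Sum>n'\<in>?N. (if n = n' then of_int p ^ 2 else 0) * inner (V n) (V n'))"
    by (intro sum.cong refl) (simp only: sum_distrib_right[symmetric] ch)
  also have "\<dots> = (\<Sum>n\<in>?N. of_int p ^ 2 * inner (V n) (V n))"
    by (intro sum.cong refl) (simp add: if_distrib[of "\<lambda>x. x * _"] sum.delta cong: if_cong)
  also have "\<dots> = (\<Sum>n\<in>?N. of_int p ^ 2 * (norm v)\<^sup>2)"
    by (intro sum.cong refl) (simp add: V_def orthogonal_transformation_norm[OF orth] flip: power2_norm_eq_inner)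
  also have "\<dots> = of_int p ^ 4 * (norm v)\<^sup>2"
    using p_pos by (simp add: power4_eq_xxxx power2_eq_square)
  finally show ?thesis using p_pos by simp
qed

lemma \<mu>_nonneg: "\<mu> v c d \<ge> 0"
  by (simp add: \<mu>_def)

text \<open>The free weight keeps the factor of the main term below 2, without which the doubling
  argument in \<open>no_mass_at_zero_bound\<close> would not close.\<close>

lemma norm_add_weighted:
  fixes x y :: "'v"
  assumes "e > 0"
  shows "(norm (x + y))\<^sup>2 \<le> (1 + e) * (norm x)\<^sup>2 + (1 + 1 / e) * (norm y)\<^sup>2"
proof -
  have "0 \<le> (norm (sqrt e *\<^sub>R x - (1 / sqrt e) *\<^sub>R y))\<^sup>2" by simp
  also have "\<dots> = e * (norm x)\<^sup>2 - 2 * inner x y + (1 / e) * (norm y)\<^sup>2"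
    using assms by (simp add: norm_diff_sq power_mult_distrib power_divide)
  finally show ?thesis by (simp add: norm_add_sq algebra_simps)
qed

lemma \<mu>_add:
  assumes "e > 0"
  shows "\<mu> (v + w) c d \<le> (1 + e) * \<mu> v c d + (1 + 1 / e) * \<mu> w c d"
  using norm_add_weighted[OF assms, of "C c d v" "C c d w"] norm_add_weighted[OF assms, of "S c d v" "S c d w"]
  by (simp add: \<mu>_def linear_add[OF C_linear] linear_add[OF S_linear] algebra_simps)

lemma sum_\<mu>_le:
  assumes "A \<subseteq> B \<times> B"
  shows "(\<Sum>(c, d)\<in>A. \<mu> v c d) \<le> (norm v)\<^sup>2"
proof -
  have "(\<Sum>(c, d)\<in>A. \<mu> v c d) \<le> (\<Sum>(c, d)\<in>B \<times> B. \<mu> v c d)"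
    by (intro sum_mono2 assms) (auto simp: \<mu>_nonneg)
  then show ?thesis by (simp add: sum.cartesian_product[symmetric] parseval)
qed

text \<open>An operator \<^term>\<open>g\<close> acting on the spectral side through the injection \<^term>\<open>f\<close> cannot
  change the spectral measure by more than its displacement of the vector.\<close>

lemma sum_\<mu>_transport:
  assumes e: "e > 0" and A: "A \<subseteq> B \<times> B"
    and \<mu>: "\<And>c d. (c, d) \<in> A \<Longrightarrow> \<mu> (g v) (fst (f (c, d))) (snd (f (c, d))) = \<mu> v c d"
    and f: "inj_on f A" "f ` A \<subseteq> B \<times> B"
  shows "(\<Sum>(c, d)\<in>A. \<mu> v c d) \<le> (1 + e) * (\<Sum>(c, d)\<in>f ` A. \<mu> v c d) + (1 + 1 / e) * (norm (g v - v))\<^sup>2"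
proof -
  have "(\<Sum>(c, d)\<in>A. \<mu> v c d) = (\<Sum>x\<in>A. \<mu> (g v) (fst (f x)) (snd (f x)))"
    by (intro sum.cong refl) (auto simp: \<mu>)
  also have "\<dots> \<le> (\<Sum>x\<in>A. (1 + e) * \<mu> v (fst (f x)) (snd (f x)) + (1 + 1 / e) * \<mu> (g v - v) (fst (f x)) (snd (f x)))"
    using \<mu>_add[OF e, of v "g v - v"] by (intro sum_mono) simp
  also have "\<dots> = (1 + e) * (\<Sum>(c, d)\<in>f ` A. \<mu> v c d) + (1 + 1 / e) * (\<Sum>(c, d)\<in>f ` A. \<mu> (g v - v) c d)"
    by (simp add: sum.distrib sum_distrib_left sum.reindex[OF f(1)] case_prod_unfold)
  also have "\<dots> \<le> (1 + e) * (\<Sum>(c, d)\<in>f ` A. \<mu> v c d) + (1 + 1 / e) * (norm (g v - v))\<^sup>2"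
    by (intro add_left_mono mult_left_mono sum_\<mu>_le f) (use e in auto)
  finally show ?thesis .
qed

text \<open>The same estimate with the map on the other side of the equation. It handles the
  quadrants with c d < 0, where the inverse shears are the expanding ones.\<close>

lemma sum_\<mu>_transport':
  assumes e: "e > 0" and A: "A \<subseteq> B \<times> B"
    and \<mu>: "\<And>c d. (c, d) \<in> A \<Longrightarrow> \<mu> (g v) c d = \<mu> v (fst (f (c, d))) (snd (f (c, d)))"
    and f: "inj_on f A" "f ` A \<subseteq> B \<times> B"
  shows "(\<Sum>(c, d)\<in>A. \<mu> v c d) \<le> (1 + e) * (\<Sum>(c, d)\<in>f ` A. \<mu> v c d) + (1 + 1 / e) * (norm (g v - v))\<^sup>2"
proof -
  have "(\<Sum>(c, d)\<in>A. \<mu> v c d) \<le> (\<Sum>(c, d)\<in>A. (1 + e) * \<mu> (g v) c d + (1 + 1 / e) * \<mu> (v - g v) c d)"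
    using \<mu>_add[OF e, of "g v" "v - g v"] by (intro sum_mono) auto
  also have "\<dots> = (1 + e) * (\<Sum>(c, d)\<in>A. \<mu> (g v) c d) + (1 + 1 / e) * (\<Sum>(c, d)\<in>A. \<mu> (v - g v) c d)"
    by (simp add: sum.distrib sum_distrib_left case_prod_unfold)
  also have "(\<Sum>(c, d)\<in>A. \<mu> (g v) c d) = (\<Sum>(c, d)\<in>f ` A. \<mu> v c d)"
    by (simp add: sum.reindex[OF f(1)] case_prod_unfold) (intro sum.cong refl, use \<mu> in auto)
  also have "(1 + e) * (\<Sum>(c, d)\<in>f ` A. \<mu> v c d) + (1 + 1 / e) * (\<Sum>(c, d)\<in>A. \<mu> (v - g v) c d)
     \<le> (1 + e) * (\<Sum>(c, d)\<in>f ` A. \<mu> v c d) + (1 + 1 / e) * (norm (v - g v))\<^sup>2"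
    by (intro add_left_mono mult_left_mono sum_\<mu>_le A) (use e in auto)
  finally show ?thesis by (simp add: norm_minus_commute)
qed

section \<open>Ping-pong on the dual plane\<close>

lemma cos_ang_nonpos:
  assumes "\<bar>c\<bar> \<le> int m" "4 * \<bar>c\<bar> \<ge> p"
  shows "cos (ang c) \<le> 0"
proof -
  have "cos (ang c) = cos (ang \<bar>c\<bar>)"
    by (cases "c \<ge> 0") (auto simp: ang_def)
  moreover have "ang \<bar>c\<bar> \<ge> pi / 2"
  proof -
    have "real_of_int p \<le> 4 * of_int \<bar>c\<bar>"
      using assms(2) of_int_le_iff[of p "4 * \<bar>c\<bar>", where 'a = real] by simp
    then have "pi * of_int p \<le> pi * (4 * of_int \<bar>c\<bar>)" by (intro mult_left_mono) auto
    then show ?thesis using p_pos by (simp add: ang_def field_simps)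
  qed
  moreover have "ang \<bar>c\<bar> \<le> pi"
  proof -
    have "2 * \<bar>c\<bar> \<le> p" using assms(1) p by simp
    then have "2 * real_of_int \<bar>c\<bar> \<le> of_int p"
      using of_int_le_iff[of "2 * \<bar>c\<bar>" p, where 'a = real] by simp
    then have "pi * (2 * of_int \<bar>c\<bar>) \<le> pi * of_int p" by (intro mult_left_mono) auto
    then show ?thesis using p_pos by (simp add: ang_def field_simps)
  qed
  ultimately show ?thesis
    using cos_monotone_0_pi_le[of "pi / 2" "ang \<bar>c\<bar>"] by simp
qed

text \<open>Near-invariance under translations concentrates the measure in the box \<open>X\<close>
  about the origin. There the two shears send the part with c d > 0 injectively to disjoint subsets
  of the same sign region, so it would have to carry almost twice its own mass; inverse shears do
  this for c d < 0, and the axes are sheared off into c d > 0.\<close>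

lemma no_mass_at_zero_bound:
  assumes g: "\<And>c d. \<mu> (g v) c d = \<mu> v (c - d) d" and h: "\<And>c d. \<mu> (h v) c d = \<mu> v c (d - c)"
    and \<delta>: "norm (U 1 0 v - v) \<le> \<delta>" "norm (U 0 1 v - v) \<le> \<delta>" "norm (g v - v) \<le> \<delta>" "norm (h v - v) \<le> \<delta>"
    and zero: "\<mu> v 0 0 = 0"
  shows "(norm v)\<^sup>2 \<le> 100 * \<delta>\<^sup>2"
proof -
  define M where "M A = (\<Sum>(c, d)\<in>A. \<mu> v c d)" for A
  define O1 where "O1 = {(c, d) \<in> B \<times> B. 4 * \<bar>c\<bar> \<ge> p}"
  define O2 where "O2 = {(c, d) \<in> B \<times> B. 4 * \<bar>d\<bar> \<ge> p}"
  define X where "X = {(c, d) \<in> B \<times> B. 4 * \<bar>c\<bar> < p \<and> 4 * \<bar>d\<bar> < p}"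
  define Qp where "Qp = {(c, d) \<in> X. c * d > 0}"
  define Qn where "Qn = {(c, d) \<in> X. c * d < 0}"
  define A1 where "A1 = {(c, d) \<in> X. d = 0 \<and> c \<noteq> 0}"
  define A2 where "A2 = {(c, d) \<in> X. c = 0 \<and> d \<noteq> 0}"
  have fin: "finite (B \<times> B)" by simp
  have sub: "O1 \<subseteq> B \<times> B" "O2 \<subseteq> B \<times> B" "X \<subseteq> B \<times> B" "Qp \<subseteq> B \<times> B" "Qn \<subseteq> B \<times> B" "A1 \<subseteq> B \<times> B" "A2 \<subseteq> B \<times> B"
    by (auto simp: O1_def O2_def X_def Qp_def Qn_def A1_def A2_def)
  note finA = finite_subset[OF _ fin]
  have M_mono: "M A \<le> M A'" if "A \<subseteq> A'" "A' \<subseteq> B \<times> B" for A A'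
    unfolding M_def by (intro sum_mono2 finA that) (auto simp: \<mu>_nonneg)
  have M_Un: "M (A \<union> A') \<le> M A + M A'" if "A \<subseteq> B \<times> B" "A' \<subseteq> B \<times> B" for A A'
    unfolding M_def using finA[OF that(1)] finA[OF that(2)]
    by (subst sum.union_inter[symmetric]) (auto intro!: sum_nonneg simp: \<mu>_nonneg)
  have M_disj: "M A + M A' \<le> M A''" if "A \<subseteq> A''" "A' \<subseteq> A''" "A \<inter> A' = {}" "A'' \<subseteq> B \<times> B" for A A' A''
  proof -
    have "M A + M A' = M (A \<union> A')"
      unfolding M_def using that finA by (subst sum.union_disjoint) (auto intro: finite_subset[OF _ fin])
    also have "\<dots> \<le> M A''" using that by (intro M_mono) auto
    finally show ?thesis .
  qed
  have sq: "(norm (U 1 0 v - v))\<^sup>2 \<le> \<delta>\<^sup>2" "(norm (U 0 1 v - v))\<^sup>2 \<le> \<delta>\<^sup>2" "(norm (g v - v))\<^sup>2 \<le> \<delta>\<^sup>2" "(norm (h v - v))\<^sup>2 \<le> \<delta>\<^sup>2"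
    using \<delta> by (auto intro: power_mono)
  \<comment> \<open>Where |c| or |d| is at least p/4, the cosine is at most 0, so one of the two
    unit translations multiplies the measure of the difference by at least 2.\<close>
  have tail: "2 * M O1 \<le> \<delta>\<^sup>2" "2 * M O2 \<le> \<delta>\<^sup>2"
  proof -
    have "2 * M O1 = (\<Sum>(c, d)\<in>O1. 2 * \<mu> v c d)" by (simp add: M_def sum_distrib_left case_prod_unfold)
    also have "\<dots> \<le> (\<Sum>(c, d)\<in>O1. \<mu> (U 1 0 v - v) c d)"
    proof (intro sum_mono, clarify)
      fix c d assume "(c, d) \<in> O1"
      then have "cos (ang c) \<le> 0" by (intro cos_ang_nonpos) (auto simp: O1_def)
      then show "2 * \<mu> v c d \<le> \<mu> (U 1 0 v - v) c d"
        unfolding \<mu>_U by (intro mult_right_mono \<mu>_nonneg) simp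
    qed
    also have "\<dots> \<le> \<delta>\<^sup>2" using sum_\<mu>_le[OF sub(1)] sq(1) by (rule order_trans)
    finally show "2 * M O1 \<le> \<delta>\<^sup>2" .
    have "2 * M O2 = (\<Sum>(c, d)\<in>O2. 2 * \<mu> v c d)" by (simp add: M_def sum_distrib_left case_prod_unfold)
    also have "\<dots> \<le> (\<Sum>(c, d)\<in>O2. \<mu> (U 0 1 v - v) c d)"
    proof (intro sum_mono, clarify)
      fix c d assume "(c, d) \<in> O2"
      then have "cos (ang d) \<le> 0" by (intro cos_ang_nonpos) (auto simp: O2_def)
      then show "2 * \<mu> v c d \<le> \<mu> (U 0 1 v - v) c d"
        unfolding \<mu>_U by (intro mult_right_mono \<mu>_nonneg) simp
    qed
    also have "\<dots> \<le> \<delta>\<^sup>2" using sum_\<mu>_le[OF sub(2)] sq(2) by (rule order_trans)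
    finally show "2 * M O2 \<le> \<delta>\<^sup>2" .
  qed
  \<comment> \<open>Entries below p/4 do not wrap around modulo \<open>p\<close> under a shear, so
    signs and sizes of integers can be used.\<close>
  have small: "c + d \<in> B" "c - d \<in> B" "d - c \<in> B" if "(c, d) \<in> X" for c d
    using that p by (auto simp: X_def abs_if split: if_splits)
  define RP where "RP = {(c, d) \<in> B \<times> B. c * d > 0}"
  define RN where "RN = {(c, d) \<in> B \<times> B. c * d < 0}"
  have R: "RP \<subseteq> B \<times> B" "RN \<subseteq> B \<times> B" "RP \<subseteq> Qp \<union> (O1 \<union> O2)" "RN \<subseteq> Qn \<union> (O1 \<union> O2)"
    by (auto simp: RP_def RN_def Qp_def Qn_def O1_def O2_def X_def)
  have MR: "M RP \<le> M Qp + \<delta>\<^sup>2" "M RN \<le> M Qn + \<delta>\<^sup>2"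
    using M_mono[OF R(3)] M_mono[OF R(4)] M_Un[OF sub(4), of "O1 \<union> O2"] M_Un[OF sub(5), of "O1 \<union> O2"]
      M_Un[OF sub(1,2)] tail sub by auto
  \<comment> \<open>The images are separated by |c| > |d| and |c| < |d|. Adding the two estimates
    gives 2 M <= (3/2) (M + d) + 6 d with d the square of \<open>\<delta>\<close>, hence the
    15.\<close>
  have Qp: "M Qp \<le> 15 * \<delta>\<^sup>2"
  proof -
    define f1 f2 where "f1 = (\<lambda>(c::int, d::int). (c + d, d))" and "f2 = (\<lambda>(c::int, d::int). (c, c + d))"
    have inj: "inj_on f1 Qp" "inj_on f2 Qp" by (auto simp: f1_def f2_def inj_on_def)
    have im: "f1 ` Qp \<subseteq> RP" "f2 ` Qp \<subseteq> RP" "f1 ` Qp \<inter> f2 ` Qp = {}"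
      using small by (auto simp: f1_def f2_def Qp_def X_def RP_def zero_less_mult_iff)
    have "M Qp \<le> (1 + 1/2) * M (f1 ` Qp) + (1 + 1 / (1/2)) * (norm (g v - v))\<^sup>2"
      unfolding M_def using im R(1) by (intro sum_\<mu>_transport sub inj) (auto simp: g f1_def)
    moreover have "M Qp \<le> (1 + 1/2) * M (f2 ` Qp) + (1 + 1 / (1/2)) * (norm (h v - v))\<^sup>2"
      unfolding M_def using im R(1) by (intro sum_\<mu>_transport sub inj) (auto simp: h f2_def)
    moreover have "M (f1 ` Qp) + M (f2 ` Qp) \<le> M RP" by (intro M_disj im R)
    ultimately show ?thesis using MR(1) sq by simp
  qed
  have Qn: "M Qn \<le> 15 * \<delta>\<^sup>2"
  proof -
    define f1 f2 where "f1 = (\<lambda>(c::int, d::int). (c - d, d))" and "f2 = (\<lambda>(c::int, d::int). (c, d - c))"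
    have inj: "inj_on f1 Qn" "inj_on f2 Qn" by (auto simp: f1_def f2_def inj_on_def)
    have im: "f1 ` Qn \<subseteq> RN" "f2 ` Qn \<subseteq> RN" "f1 ` Qn \<inter> f2 ` Qn = {}"
      using small by (auto simp: f1_def f2_def Qn_def X_def RN_def mult_less_0_iff)
    have "M Qn \<le> (1 + 1/2) * M (f1 ` Qn) + (1 + 1 / (1/2)) * (norm (g v - v))\<^sup>2"
      unfolding M_def using im R(2) by (intro sum_\<mu>_transport' sub inj) (auto simp: g f1_def)
    moreover have "M Qn \<le> (1 + 1/2) * M (f2 ` Qn) + (1 + 1 / (1/2)) * (norm (h v - v))\<^sup>2"
      unfolding M_def using im R(2) by (intro sum_\<mu>_transport' sub inj) (auto simp: h f2_def)
    moreover have "M (f1 ` Qn) + M (f2 ` Qn) \<le> M RN" by (intro M_disj im R)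
    ultimately show ?thesis using MR(2) sq by simp
  qed
  \<comment> \<open>One image is enough here, so the weight 1 will do: 2 (15 + 1) + 2 = 34.\<close>
  have A1: "M A1 \<le> 34 * \<delta>\<^sup>2"
  proof -
    define f where "f = (\<lambda>(c::int, d::int). (c, c + d))"
    have inj: "inj_on f A1" by (auto simp: f_def inj_on_def)
    have im: "f ` A1 \<subseteq> RP" by (auto simp: f_def A1_def X_def RP_def zero_less_mult_iff)
    have "M A1 \<le> (1 + 1) * M (f ` A1) + (1 + 1 / 1) * (norm (h v - v))\<^sup>2"
      unfolding M_def using im R(1) by (intro sum_\<mu>_transport sub inj) (auto simp: h f_def)
    then show ?thesis using M_mono[OF im R(1)] MR(1) Qp sq by simp
  qed
  have A2: "M A2 \<le> 34 * \<delta>\<^sup>2"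
  proof -
    define f where "f = (\<lambda>(c::int, d::int). (c + d, d))"
    have inj: "inj_on f A2" by (auto simp: f_def inj_on_def)
    have im: "f ` A2 \<subseteq> RP" by (auto simp: f_def A2_def X_def RP_def zero_less_mult_iff)
    have "M A2 \<le> (1 + 1) * M (f ` A2) + (1 + 1 / 1) * (norm (g v - v))\<^sup>2"
      unfolding M_def using im R(1) by (intro sum_\<mu>_transport sub inj) (auto simp: g f_def)
    then show ?thesis using M_mono[OF im R(1)] MR(1) Qp sq by simp
  qed
  have cover: "B \<times> B \<subseteq> (O1 \<union> O2) \<union> ((Qp \<union> Qn) \<union> ((A1 \<union> A2) \<union> {(0, 0)}))"
  proof (rule subrelI, rule ccontr)
    fix c d assume cd: "(c, d) \<in> B \<times> B"
      and n: "(c, d) \<notin> (O1 \<union> O2) \<union> ((Qp \<union> Qn) \<union> ((A1 \<union> A2) \<union> {(0, 0)}))"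
    then have X: "(c, d) \<in> X" by (simp add: O1_def O2_def X_def)
    have "c * d > 0 \<or> c * d < 0 \<or> (d = 0 \<and> c \<noteq> 0) \<or> (c = 0 \<and> d \<noteq> 0) \<or> (c = 0 \<and> d = 0)"
      by (metis mult_eq_0_iff linorder_neqE_linordered_idom)
    with X n show False unfolding Qp_def Qn_def A1_def A2_def by blast
  qed
  have z: "{(0, 0)} \<subseteq> B \<times> B" by auto
  have "M (B \<times> B) \<le> M ((O1 \<union> O2) \<union> ((Qp \<union> Qn) \<union> ((A1 \<union> A2) \<union> {(0, 0)})))"
    by (intro M_mono cover Un_least sub z)
  also have "\<dots> \<le> M (O1 \<union> O2) + M ((Qp \<union> Qn) \<union> ((A1 \<union> A2) \<union> {(0, 0)}))"
    by (intro M_Un Un_least sub z)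
  also have "\<dots> \<le> M (O1 \<union> O2) + (M (Qp \<union> Qn) + M ((A1 \<union> A2) \<union> {(0, 0)}))"
    by (intro add_left_mono M_Un Un_least sub z)
  also have "\<dots> \<le> M (O1 \<union> O2) + (M (Qp \<union> Qn) + (M (A1 \<union> A2) + M {(0, 0)}))"
    by (intro add_left_mono M_Un Un_least sub z)
  also have "\<dots> \<le> (M O1 + M O2) + ((M Qp + M Qn) + ((M A1 + M A2) + M {(0, 0)}))"
    by (intro add_mono M_Un sub order_refl)
  also have "M {(0, 0)} = 0" by (simp add: M_def zero)
  also have "M (B \<times> B) = (norm v)\<^sup>2" by (simp add: M_def sum.cartesian_product[symmetric] parseval)
  \<comment> \<open>The total is 1 + 2 * 15 + 2 * 34 = 99.\<close>
  finally show ?thesis using tail Qp Qn A1 A2 zero_le_power2[of \<delta>] by linarith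
qed

definition "P v = avg p (\<lambda>a. U a 0) (avg p (\<lambda>b. U 0 b) v)"

lemma cyc1: "cyc_rep p (\<lambda>a. U a 0)" and cyc2: "cyc_rep p (\<lambda>b. U 0 b)"
  using add[of _ _ 0 0] add[of 0 0] by (simp_all add: cyc_rep_def p_pos orth per1 per2)

lemma U_commute: "U a b (U a' b' v) = U a' b' (U a b v)"
  by (metis add add.commute)

lemma P_commute: "avg p (\<lambda>a. U a 0) (avg p (\<lambda>b. U 0 b) v) = avg p (\<lambda>b. U 0 b) (avg p (\<lambda>a. U a 0) v)"
  by (rule avg_avg_commute[OF cyc1 cyc2]) (rule U_commute)

lemma P_oproj: "oproj P"
  using oproj_compose[OF avg_oproj[OF cyc1] avg_oproj[OF cyc2] P_commute]
  unfolding P_def[abs_def] .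

lemma P_eq: "P v = C 0 0 v"
proof -
  have "U a 0 (U 0 b v) = U a b v" for a b using add[of a 0 0 b v] by simp
  then have "P v = (1 / of_int p) *\<^sub>R (\<Sum>a\<in>{0..<p}. (1 / of_int p) *\<^sub>R (\<Sum>b\<in>{0..<p}. U a b v))"
    by (simp add: P_def avg_def linear_scale[OF U_linear] linear_sum[OF U_linear])
  then show ?thesis
    by (simp add: C_def K_def ang_def power2_eq_square scaleR_sum_right)
qed

lemma P_U: "P (U a b v) = U a b (P v)" and U_P: "U a b (P v) = P v"
proof -
  have "U a' b' (P v) = P (U a' b' v)" for a' b' v
    unfolding P_def
    by (simp only: avg_commute[where f = "U a' b'", OF cyc1 U_linear U_commute] avg_commute[where f = "U a' b'", OF cyc2 U_linear U_commute])
  then show "P (U a b v) = U a b (P v)" by simp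
  have 1: "U a 0 (P v) = P v" unfolding P_def by (rule avg_invariant[OF cyc1])
  have "P v = avg p (\<lambda>b. U 0 b) (avg p (\<lambda>a. U a 0) v)"
    unfolding P_def by (rule P_commute)
  then have 2: "U 0 b (P v) = P v" by (simp only: avg_invariant[OF cyc2])
  show "U a b (P v) = P v" using add[of a 0 0 b "P v"] 1 2 by simp
qed

text \<open>Relative property (T) of the pair \<open>(SL\<^sub>2(\<F>\<^sub>p) \<ltimes> \<F>\<^sub>p\<^sup>2, \<F>\<^sub>p\<^sup>2)\<close>, uniformly in \<open>p\<close>.\<close>

theorem relative_T:
  assumes g: "linear g" "\<And>a b v. U a b (g v) = g (U a (a + b) v)" "\<And>v. norm (g v) = norm v"
    and h: "linear h" "\<And>a b v. U a b (h v) = h (U (a + b) b v)" "\<And>v. norm (h v) = norm v"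
    and \<delta>: "norm (U 1 0 v - v) \<le> \<delta>" "norm (U 0 1 v - v) \<le> \<delta>" "norm (g v - v) \<le> \<delta>" "norm (h v - v) \<le> \<delta>"
  shows "norm (U a b v - v) \<le> 20 * \<delta>"
proof -
  have \<delta>0: "\<delta> \<ge> 0" using \<delta>(1) norm_ge_zero order_trans by blast
  have Kg: "K \<phi> (g v) = g (K (\<lambda>a b. \<phi> a (b - a)) v)" if b: "biper \<phi>" for \<phi> v
  proof -
    have b': "biper (\<lambda>a b. \<phi> a (b - a))"
      by (rule biper_cong[OF b]) (simp_all add: mod_diff_left_eq mod_diff_right_eq)
    have "\<phi> a b *\<^sub>R U a b (g v) = g (\<phi> a (b + 1 * a - a) *\<^sub>R U a (b + 1 * a) v)" for a b
      by (simp add: g(2) linear_scale[OF g(1)] add.commute)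
    then have "(\<Sum>a\<in>{0..<p}. \<Sum>b\<in>{0..<p}. \<phi> a b *\<^sub>R U a b (g v))
       = g (\<Sum>a\<in>{0..<p}. \<Sum>b\<in>{0..<p}. \<phi> a (b + 1 * a - a) *\<^sub>R U a (b + 1 * a) v)"
      by (simp only: linear_sum[OF g(1)])
    also have "\<dots> = g (\<Sum>a\<in>{0..<p}. \<Sum>b\<in>{0..<p}. \<phi> a (b - a) *\<^sub>R U a b v)"
      by (simp only: sum_shear1[OF biper_U[OF b', of v], of 1])
    finally show ?thesis by (simp only: K_def linear_scale[OF g(1)])
  qed
  have Kh: "K \<phi> (h v) = h (K (\<lambda>a b. \<phi> (a - b) b) v)" if b: "biper \<phi>" for \<phi> v
  proof -
    have b': "biper (\<lambda>a b. \<phi> (a - b) b)"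
      by (rule biper_cong[OF b]) (simp_all add: mod_diff_left_eq mod_diff_right_eq)
    have "\<phi> a b *\<^sub>R U a b (h v) = h (\<phi> (a + 1 * b - b) b *\<^sub>R U (a + 1 * b) b v)" for a b
      by (simp add: h(2) linear_scale[OF h(1)])
    then have "(\<Sum>a\<in>{0..<p}. \<Sum>b\<in>{0..<p}. \<phi> a b *\<^sub>R U a b (h v))
       = h (\<Sum>a\<in>{0..<p}. \<Sum>b\<in>{0..<p}. \<phi> (a + 1 * b - b) b *\<^sub>R U (a + 1 * b) b v)"
      by (simp only: linear_sum[OF h(1)])
    also have "\<dots> = h (\<Sum>a\<in>{0..<p}. \<Sum>b\<in>{0..<p}. \<phi> (a - b) b *\<^sub>R U a b v)"
      by (simp only: sum_shear2[OF biper_U[OF b', of v], of 1])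
    finally show ?thesis by (simp only: K_def linear_scale[OF h(1)])
  qed
  have e: "c * a + d * (b - a) = (c - d) * a + d * b" "c * (a - b) + d * b = c * a + (d - c) * b" for a b c d :: int
    by (simp_all add: algebra_simps)
  \<comment> \<open>A shear of the plane acts on characters contragrediently.\<close>
  have Cg: "C c d (g v) = g (C (c - d) d v)" "S c d (g v) = g (S (c - d) d v)" for c d v
    unfolding C_def S_def by (simp_all only: Kg[OF biper_cos] Kg[OF biper_sin] e)
  have Ch: "C c d (h v) = h (C c (d - c) v)" "S c d (h v) = h (S c (d - c) v)" for c d v
    unfolding C_def S_def by (simp_all only: Kh[OF biper_cos] Kh[OF biper_sin] e)
  \<comment> \<open>Removing the invariant part empties the trivial character and does not increase
    any of the four displacements.\<close>
  define w where "w = v - P v"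
  have Pw: "P w = 0" by (simp add: w_def linear_diff[OF oproj_linear[OF P_oproj]] oproj_idem[OF P_oproj])
  have move: "norm (f w - w) \<le> \<delta>" if f: "linear f" "\<And>v. P (f v) = f (P v)" "norm (f v - v) \<le> \<delta>" for f
  proof -
    have "f w - w = (f v - v) - P (f v - v)"
      by (simp add: w_def linear_diff[OF f(1)] linear_diff[OF oproj_linear[OF P_oproj]] f(2))
    then show ?thesis using oproj_defect_le[OF P_oproj, of "f v - v"] f(3) by simp
  qed
  have "(norm w)\<^sup>2 \<le> 100 * \<delta>\<^sup>2"
  proof (rule no_mass_at_zero_bound)
    show "\<mu> (g w) c d = \<mu> w (c - d) d" "\<mu> (h w) c d = \<mu> w c (d - c)" for c d
      by (simp_all add: \<mu>_def Cg Ch g h)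
    show "norm (U 1 0 w - w) \<le> \<delta>" "norm (U 0 1 w - w) \<le> \<delta>"
      by (intro move U_linear P_U \<delta>)+
    show "norm (g w - w) \<le> \<delta>" "norm (h w - w) \<le> \<delta>"
      by (rule move; simp add: g h \<delta> P_eq Cg Ch)+
    have "S 0 0 w = 0" by (simp add: S_def K_def ang_def)
    then show "\<mu> w 0 0 = 0" using Pw by (simp add: \<mu>_def P_eq)
  qed
  then have "(norm w)\<^sup>2 \<le> (10 * \<delta>)\<^sup>2" by (simp add: power_mult_distrib)
  then have w: "norm w \<le> 10 * \<delta>" by (rule power2_le_imp_le) (use \<delta>0 in simp)
  \<comment> \<open>The invariant part is not displaced, the remainder by at most twice its norm;
    this turns 10 into 20.\<close>
  have "U a b v - v = U a b w - w"
    by (simp add: w_def linear_diff[OF U_linear] U_P)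
  also have "norm \<dots> \<le> norm (U a b w) + norm w" by (rule norm_triangle_ineq4)
  also have "\<dots> \<le> 20 * \<delta>" using w by (simp add: orthogonal_transformation_norm[OF orth])
  finally show ?thesis .
qed

end

section \<open>The regular representation\<close>

abbreviation "lookup \<equiv> Poly_Mapping.lookup"
abbreviation "keys \<equiv> Poly_Mapping.keys"

section \<open>Finitely supported functions as a real inner product space\<close>

instantiation poly_mapping :: (type, real_vector) real_vector
begin

lift_definition scaleR_poly_mapping :: "real \<Rightarrow> ('a \<Rightarrow>\<^sub>0 'b) \<Rightarrow> 'a \<Rightarrow>\<^sub>0 'b" is "\<lambda>r f x. r *\<^sub>R f x"
proof -
  fix r and f :: "'a \<Rightarrow> 'b" assume "finite {x. f x \<noteq> 0}"
  then show "finite {x. r *\<^sub>R f x \<noteq> 0}" by (rule rev_finite_subset) auto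
qed

instance
  by standard (transfer; simp add: fun_eq_iff scaleR_add_left scaleR_add_right)+

end

text \<open>The results on \<open>real_inner\<close> need one type for all groups, so the functions
  live on all self-maps with finite support and those on \<open>H\<close> are singled out by their
  keys. Complex values enter through their real inner product.\<close>

instantiation poly_mapping :: (type, real_inner) real_inner
begin

definition inner_poly_mapping :: "('a \<Rightarrow>\<^sub>0 'b) \<Rightarrow> ('a \<Rightarrow>\<^sub>0 'b) \<Rightarrow> real" where
  "inner_poly_mapping f g = (\<Sum>x\<in>keys f. inner (lookup f x) (lookup g x))"

definition norm_poly_mapping :: "('a \<Rightarrow>\<^sub>0 'b) \<Rightarrow> real" where
  "norm_poly_mapping f = sqrt (inner f f)"

definition sgn_poly_mapping :: "('a \<Rightarrow>\<^sub>0 'b) \<Rightarrow> 'a \<Rightarrow>\<^sub>0 'b" where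
  "sgn_poly_mapping f = inverse (norm f) *\<^sub>R f"

definition dist_poly_mapping :: "('a \<Rightarrow>\<^sub>0 'b) \<Rightarrow> ('a \<Rightarrow>\<^sub>0 'b) \<Rightarrow> real" where
  "dist_poly_mapping f g = norm (f - g)"

definition uniformity_poly_mapping :: "(('a \<Rightarrow>\<^sub>0 'b) \<times> ('a \<Rightarrow>\<^sub>0 'b)) filter" where
  "uniformity_poly_mapping = (INF e\<in>{0 <..}. principal {(x, y). dist x y < e})"

definition open_poly_mapping :: "('a \<Rightarrow>\<^sub>0 'b) set \<Rightarrow> bool" where
  "open_poly_mapping U \<longleftrightarrow> (\<forall>x\<in>U. \<forall>\<^sub>F (x', y) in uniformity. x' = x \<longrightarrow> y \<in> U)"

lemma inner_poly_mapping_superset: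
  fixes f g :: "'a \<Rightarrow>\<^sub>0 'b"
  assumes "finite A" "keys f \<subseteq> A"
  shows "inner f g = (\<Sum>x\<in>A. inner (lookup f x) (lookup g x))"
  unfolding inner_poly_mapping_def
  by (intro sum.mono_neutral_left assms) (auto simp: in_keys_iff)

instance
proof
  fix f g h :: "'a \<Rightarrow>\<^sub>0 'b" and r :: real
  let ?A = "keys f \<union> keys g"
  have A: "finite ?A" by simp
  have sup: "keys f \<subseteq> ?A" "keys g \<subseteq> ?A" "keys (f + g) \<subseteq> ?A"
    by (auto simp: in_keys_iff lookup_add)
  note ip = inner_poly_mapping_superset[OF A]
  show "inner f g = inner g f"
    by (simp add: ip sup inner_commute)
  show "inner (f + g) h = inner f h + inner g h"
    by (simp add: ip sup inner_add_left lookup_add sum.distrib)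
  have "keys (r *\<^sub>R f) \<subseteq> keys f"
    by (auto simp: in_keys_iff scaleR_poly_mapping.rep_eq)
  then show "inner (r *\<^sub>R f) g = r * inner f g"
    by (subst inner_poly_mapping_superset[of "keys f"])
      (simp_all add: inner_poly_mapping_def scaleR_poly_mapping.rep_eq sum_distrib_left)
  show "0 \<le> inner f f"
    unfolding inner_poly_mapping_def by (intro sum_nonneg) simp
  show "inner f f = 0 \<longleftrightarrow> f = 0"
  proof
    assume "inner f f = 0"
    then have "\<forall>x\<in>Poly_Mapping.keys f. inner (lookup f x) (lookup f x) = 0"
      unfolding inner_poly_mapping_def by (subst (asm) sum_nonneg_eq_0_iff) auto
    then have "lookup f x = 0" for x
      by (cases "x \<in> keys f") (auto simp: in_keys_iff)
    then show "f = 0" by (intro poly_mapping_eqI) simp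
  qed (simp add: inner_poly_mapping_def)
qed (simp_all add: norm_poly_mapping_def sgn_poly_mapping_def dist_poly_mapping_def
    uniformity_poly_mapping_def open_poly_mapping_def)

end

lemma norm_poly_mapping_superset:
  fixes f :: "'a \<Rightarrow>\<^sub>0 'b::real_inner"
  assumes "finite A" "keys f \<subseteq> A"
  shows "norm f = sqrt (\<Sum>x\<in>A. (norm (lookup f x))\<^sup>2)"
  unfolding norm_eq_sqrt_inner[of f] inner_poly_mapping_superset[OF assms] by (simp add: power2_norm_eq_inner)

lemma lookup_scaleR: "lookup (r *\<^sub>R f) x = r *\<^sub>R lookup f x"
  by (rule scaleR_poly_mapping.rep_eq[THEN fun_cong])

type_synonym 'a fun_space = "('a \<Rightarrow> 'a) \<Rightarrow>\<^sub>0 complex"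

text \<open>Only meaningful if \<^term>\<open>g\<close> is a bijection.\<close>

definition lreg :: "('a \<Rightarrow> 'a) \<Rightarrow> 'a fun_space \<Rightarrow> 'a fun_space" where
  "lreg g v = Abs_poly_mapping (\<lambda>h. lookup v (inv g \<circ> h))"

lemma lookup_lreg: assumes "bij g" shows "lookup (lreg g v) h = lookup v (inv g \<circ> h)"
proof -
  have "h = g \<circ> (inv g \<circ> h)" for h :: "'a \<Rightarrow> 'a"
    using assms by (metis bij_betw_def comp_assoc fun.map_id surj_iff)
  then have "{h. lookup v (inv g \<circ> h) \<noteq> 0} \<subseteq> (\<circ>) g ` keys v"
    by (intro subsetI) (metis (mono_tags) image_eqI in_keys_iff mem_Collect_eq)
  then have "finite {h. lookup v (inv g \<circ> h) \<noteq> 0}"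
    by (rule finite_subset) simp
  then show ?thesis by (simp add: lreg_def)
qed

lemma lreg_comp: "bij f \<Longrightarrow> bij g \<Longrightarrow> lreg (f \<circ> g) v = lreg f (lreg g v)"
  by (rule poly_mapping_eqI) (simp add: lookup_lreg bij_comp o_inv_distrib comp_assoc)

lemma lreg_id: "lreg id v = v"
  by (rule poly_mapping_eqI) (simp add: lookup_lreg)

lemma lreg_linear: "bij g \<Longrightarrow> linear (lreg g)"
  by (intro linearI; rule poly_mapping_eqI) (simp_all add: lookup_lreg lookup_add lookup_scaleR)

lemma lreg_orth: assumes "bij g" shows "orthogonal_transformation (lreg g)"
  unfolding orthogonal_transformation
proof (intro conjI allI)
  show "linear (lreg g)" by (rule lreg_linear[OF assms])
  fix v :: "'a fun_space"
  have c: "inv g \<circ> (g \<circ> k) = k" "g \<circ> (inv g \<circ> k) = k" for k :: "'a \<Rightarrow> 'a"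
    using assms by (simp_all add: fun_eq_iff bij_inv_eq_iff bij_is_surj surj_f_inv_f bij_is_inj)
  have keys: "keys (lreg g v) \<subseteq> (\<circ>) g ` keys v"
  proof
    fix h assume "h \<in> keys (lreg g v)"
    then have "inv g \<circ> h \<in> keys v" by (simp add: in_keys_iff lookup_lreg[OF assms])
    then show "h \<in> (\<circ>) g ` keys v" using c(2)[of h] by (metis imageI)
  qed
  have inj: "inj_on ((\<circ>) g) (keys v)" by (metis c(1) inj_onI)
  show "norm (lreg g v) = norm v"
    by (subst norm_poly_mapping_superset[OF _ keys])
      (simp_all add: sum.reindex[OF inj] lookup_lreg[OF assms] c norm_poly_mapping_superset[OF _ order_refl])
qed

lemma lreg_norm: "bij g \<Longrightarrow> norm (lreg g v) = norm v"
  using lreg_orth orthogonal_transformation by blast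

definition mean_zero :: "('a \<Rightarrow> 'a) set \<Rightarrow> 'a fun_space set" where
  "mean_zero H = {v. keys v \<subseteq> H \<and> (\<Sum>h\<in>H. lookup v h) = 0}"

lemma subspace_mean_zero: "subspace (mean_zero H)"
proof (rule subspaceI)
  fix v w assume "v \<in> mean_zero H" "w \<in> mean_zero H"
  then show "v + w \<in> mean_zero H"
    by (auto simp: mean_zero_def lookup_add sum.distrib dest: subsetD[OF keys_add])
next
  fix r v assume "v \<in> mean_zero H"
  then show "r *\<^sub>R v \<in> mean_zero H"
    by (auto simp: mean_zero_def in_keys_iff lookup_scaleR scaleR_sum_right[symmetric])
qed (simp add: mean_zero_def)

section \<open>Permutation groups and mean-zero vectors\<close>

definition perm_group :: "'a set \<Rightarrow> ('a \<Rightarrow> 'a) set \<Rightarrow> bool" where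
  "perm_group X H \<longleftrightarrow> finite X \<and> (\<forall>f\<in>H. f permutes X \<and> inv f \<in> H) \<and> id \<in> H \<and> (\<forall>f\<in>H. \<forall>g\<in>H. f \<circ> g \<in> H)"

context
  fixes X :: "'a set" and H :: "('a \<Rightarrow> 'a) set"
  assumes H: "perm_group X H"
begin

lemma perm_group_permutes: "f \<in> H \<Longrightarrow> f permutes X"
  and perm_group_bij: "f \<in> H \<Longrightarrow> bij f"
  and perm_group_inv: "f \<in> H \<Longrightarrow> inv f \<in> H"
  and perm_group_id: "id \<in> H"
  and perm_group_comp: "f \<in> H \<Longrightarrow> g \<in> H \<Longrightarrow> f \<circ> g \<in> H"
  using H by (auto simp: perm_group_def permutes_bij)

lemma perm_group_finite: "finite H"
  by (rule finite_subset[of _ "{f. f permutes X}"]) (use H in \<open>auto simp: perm_group_def finite_permutations\<close>)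

lemma perm_group_cancel: "f \<in> H \<Longrightarrow> inv f \<circ> (f \<circ> k) = k" "f \<in> H \<Longrightarrow> f \<circ> (inv f \<circ> k) = k"
  using perm_group_bij[of f] by (simp_all add: fun_eq_iff bij_is_surj surj_f_inv_f bij_is_inj)

lemma perm_group_comp_iff: "f \<in> H \<Longrightarrow> inv f \<circ> k \<in> H \<longleftrightarrow> k \<in> H"
  by (metis perm_group_cancel(2) perm_group_comp perm_group_inv)

lemma lreg_mean_zero:
  assumes g: "g \<in> H" and v: "v \<in> mean_zero H"
  shows "lreg g v \<in> mean_zero H"
proof -
  have "keys (lreg g v) \<subseteq> H"
    using v perm_group_comp_iff[OF g]
    by (auto simp: mean_zero_def in_keys_iff lookup_lreg[OF perm_group_bij[OF g]] subset_iff)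
  moreover have "(\<Sum>h\<in>H. lookup v (inv g \<circ> h)) = (\<Sum>h\<in>H. lookup v h)"
    by (rule sum.reindex_bij_witness[where i = "\<lambda>h. g \<circ> h" and j = "\<lambda>h. inv g \<circ> h"])
      (use g in \<open>auto simp: perm_group_cancel perm_group_comp perm_group_inv\<close>)
  ultimately show ?thesis
    using v by (simp add: mean_zero_def lookup_lreg[OF perm_group_bij[OF g]])
qed

text \<open>The translates of a mean-zero vector sum to 0, so \<open>v\<close> is the average of the
  differences \<open>v - lreg g v\<close>.\<close>

lemma mean_zero_norm_le:
  assumes v: "v \<in> mean_zero H" and c: "\<And>g. g \<in> H \<Longrightarrow> norm (lreg g v - v) \<le> c"
  shows "norm v \<le> c"
proof -
  have "(\<Sum>g\<in>H. lreg g v) = 0"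
  proof (rule poly_mapping_eqI)
    fix h
    have "lookup (\<Sum>g\<in>H. lreg g v) h = (\<Sum>g\<in>H. lookup v (inv g \<circ> h))"
      by (simp add: lookup_sum lookup_lreg perm_group_bij)
    also have "\<dots> = 0"
    proof (cases "h \<in> H")
      case True
      have i: "inv (h \<circ> inv k) = k \<circ> inv h" if "k \<in> H" for k
        using that True by (simp add: o_inv_distrib perm_group_bij bij_imp_bij_inv inv_inv_eq)
      have j: "inv (inv g \<circ> h) = inv h \<circ> g" if "g \<in> H" for g
        using that True by (simp add: o_inv_distrib perm_group_bij bij_imp_bij_inv inv_inv_eq)
      have k: "k \<circ> inv h \<circ> h = k" "h \<circ> (inv h \<circ> k) = k" for k :: "'a \<Rightarrow> 'a"
        using perm_group_cancel(2)[OF True] perm_group_bij[OF True] by (simp_all add: comp_assoc bij_is_inj)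
      have "(\<Sum>g\<in>H. lookup v (inv g \<circ> h)) = (\<Sum>k\<in>H. lookup v k)"
        by (rule sum.reindex_bij_witness[where i = "\<lambda>k. h \<circ> inv k" and j = "\<lambda>g. inv g \<circ> h"])
          (use True in \<open>auto simp: i j k perm_group_comp perm_group_inv\<close>)
      then show ?thesis using v by (simp add: mean_zero_def)
    next
      case False
      have "lookup v (inv g \<circ> h) = 0" if "g \<in> H" for g
        using v False perm_group_comp_iff[OF that, of h] unfolding mean_zero_def
        by (metis (no_types, lifting) in_keys_iff mem_Collect_eq subset_iff)
      then show ?thesis by simp
    qed
    finally show "lookup (\<Sum>g\<in>H. lreg g v) h = lookup 0 h" by simp
  qed
  then have "of_nat (card H) *\<^sub>R v = (\<Sum>g\<in>H. v - lreg g v)"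
    by (simp add: sum_subtractf sum_constant_scaleR)
  then have "card H * norm v \<le> (\<Sum>g\<in>H. norm (v - lreg g v))"
    by (metis norm_scaleR abs_of_nat norm_sum)
  also have "\<dots> \<le> card H * c"
    using c by (intro sum_bounded_above) (simp add: norm_minus_commute)
  finally have "card H * norm v \<le> card H * c" .
  moreover have "card H > 0"
    using perm_group_finite perm_group_id by (auto simp: card_gt_0_iff)
  ultimately show ?thesis by simp
qed

text \<open>\<open>gap\<close> speaks of any common bound \<open>\<delta>\<close> of the
  displacements, the form in which word estimates compose. It is applied to their maximum over
  \<open>Q\<close>, which some generator attains.\<close>

lemma expander_epsI:
  assumes eps: "eps > 0" and Q: "finite Q" "Q \<noteq> {}" "Q \<subseteq> H"
    and gap: "\<And>v \<delta>. v \<in> mean_zero H \<Longrightarrow> (\<And>g. g \<in> Q \<Longrightarrow> norm (lreg g v - v) \<le> \<delta>) \<Longrightarrow> eps * norm v \<le> \<delta>"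
  shows "expander_eps H Q eps"
  unfolding expander_eps_def
proof (intro allI impI, elim conjE)
  fix v :: "('a \<Rightarrow> 'a) \<Rightarrow> complex"
  assume v0: "(\<Sum>h\<in>H. v h) = 0" and v1: "sqrt (\<Sum>h\<in>H. (cmod (v h))\<^sup>2) = 1"
  define w :: "'a fun_space" where "w = Abs_poly_mapping (\<lambda>h. if h \<in> H then v h else 0)"
  have "finite {h. (if h \<in> H then v h else 0) \<noteq> 0}"
    by (rule finite_subset[OF _ perm_group_finite]) auto
  then have lw: "lookup w h = (if h \<in> H then v h else 0)" for h by (simp add: w_def)
  have kw: "keys w \<subseteq> H" by (auto simp: in_keys_iff lw split: if_splits)
  have w: "w \<in> mean_zero H" using kw v0 by (simp add: mean_zero_def lw)
  have nw: "norm w = 1"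
    using v1 by (simp add: norm_poly_mapping_superset[OF perm_group_finite kw] lw)
  have ng: "norm (lreg g w - w) = sqrt (\<Sum>h\<in>H. (cmod (v (inv g \<circ> h) - v h))\<^sup>2)" if g: "g \<in> H" for g
  proof -
    have "lreg g w - w \<in> mean_zero H"
      by (intro subspace_diff[OF subspace_mean_zero] lreg_mean_zero g w)
    then have "keys (lreg g w - w) \<subseteq> H" by (simp add: mean_zero_def)
    then show ?thesis
      by (simp add: norm_poly_mapping_superset[OF perm_group_finite] lookup_minus
          lookup_lreg[OF perm_group_bij[OF g]] lw perm_group_comp_iff[OF g])
  qed
  have "eps * norm w \<le> Max ((\<lambda>g. norm (lreg g w - w)) ` Q)"
    by (rule gap[OF w]) (use Q in auto)
  then have "eps \<le> Max ((\<lambda>g. norm (lreg g w - w)) ` Q)" by (simp add: nw)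
  then obtain g where "g \<in> Q" "eps \<le> norm (lreg g w - w)"
    using Q by (subst (asm) Max_ge_iff) auto
  then show "\<exists>g\<in>Q. eps \<le> sqrt (\<Sum>h\<in>H. (cmod (v (inv g \<circ> h) - v h))\<^sup>2)"
    using ng[of g] Q(3) by (metis subsetD)
qed

end

text \<open>\<open>L\<close> is the length of a word for \<open>g\<close>, so it is chosen before
  \<open>v\<close> and \<open>\<delta>\<close>. Bijectivity is carried along because
  \<open>lreg\<close> is meaningful only for bijections.\<close>

lemma gen_perm_displacement:
  assumes "g \<in> gen_perm S" and S: "\<And>s. s \<in> S \<Longrightarrow> bij s"
  shows "bij g \<and> (\<exists>L::nat. \<forall>v \<delta>. (\<forall>s\<in>S. norm (lreg s v - v) \<le> \<delta>) \<longrightarrow> norm (lreg g v - v) \<le> real L * \<delta>)"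
  using assms(1)
proof induction
  case gen_id
  show ?case
    by (intro conjI bij_id exI[of _ 0] allI impI)
      (simp only: lreg_id diff_self norm_zero mult_zero_left of_nat_0 order_refl)
next
  case (gen_mul f h)
  then obtain L :: nat where h: "bij h" and L: "\<And>v \<delta>. (\<forall>s\<in>S. norm (lreg s v - v) \<le> \<delta>) \<Longrightarrow> norm (lreg h v - v) \<le> real L * \<delta>"
    by blast
  have f: "bij f" by (rule S[OF gen_mul(1)])
  have "norm (lreg (f \<circ> h) v - v) \<le> real (Suc L) * \<delta>" if "\<forall>s\<in>S. norm (lreg s v - v) \<le> \<delta>" for v \<delta>
  proof -
    have "lreg (f \<circ> h) v - v = lreg f (lreg h v - v) + (lreg f v - v)"
      by (simp add: lreg_comp[OF f h] linear_diff[OF lreg_linear[OF f]])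
    then have "norm (lreg (f \<circ> h) v - v) \<le> norm (lreg h v - v) + norm (lreg f v - v)"
      by (metis lreg_norm[OF f] norm_triangle_ineq)
    then show ?thesis using L[OF that] bspec[OF that gen_mul(1)] by (simp add: algebra_simps)
  qed
  then show ?case using bij_comp[OF h f] by blast
next
  case (gen_inv f h)
  then obtain L :: nat where h: "bij h" and L: "\<And>v \<delta>. (\<forall>s\<in>S. norm (lreg s v - v) \<le> \<delta>) \<Longrightarrow> norm (lreg h v - v) \<le> real L * \<delta>"
    by blast
  have f: "bij f" by (rule S[OF gen_inv(1)])
  have f': "bij (inv f)" using f by (rule bij_imp_bij_inv)
  have "norm (lreg (inv f \<circ> h) v - v) \<le> real (Suc L) * \<delta>" if "\<forall>s\<in>S. norm (lreg s v - v) \<le> \<delta>" for v \<delta>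
  proof -
    have "lreg (inv f) (lreg f v) = v"
      using lreg_comp[OF f' f, of v] f by (simp add: bij_is_inj lreg_id)
    then have "lreg (inv f \<circ> h) v - v = lreg (inv f) ((lreg h v - v) - (lreg f v - v))"
      by (simp add: lreg_comp[OF f' h] linear_diff[OF lreg_linear[OF f']])
    then have "norm (lreg (inv f \<circ> h) v - v) \<le> norm (lreg h v - v) + norm (lreg f v - v)"
      by (metis lreg_norm[OF f'] norm_triangle_ineq4)
    then show ?thesis using L[OF that] bspec[OF that gen_inv(1)] by (simp add: algebra_simps)
  qed
  then show ?case using bij_comp[OF h f'] by blast
qed

text \<open>Word lengths in a finite group are bounded, which gives a gap whose constant depends on
  the group. It settles single small primes and supplies \<open>\<kappa>\<close> for
  \<open>oproj_family_gap\<close>.\<close>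

lemma gen_perm_uniform_gap:
  assumes H: "perm_group X H" and sub: "H \<subseteq> gen_perm S" and S: "\<And>s. s \<in> S \<Longrightarrow> bij s"
  shows "\<exists>L::nat. \<forall>v\<in>mean_zero H. \<forall>\<delta>. (\<forall>s\<in>S. norm (lreg s v - v) \<le> \<delta>) \<longrightarrow> norm v \<le> real L * \<delta>"
proof (cases "S = {}")
  \<comment> \<open>Without generators \<open>\<delta>\<close> is unconstrained and may be negative,
    so here \<open>L\<close> has to be 0.\<close>
  case True
  have "g = id" if "g \<in> gen_perm S" for g using that by induction (auto simp: True)
  then have "H \<subseteq> {id}" using sub by auto
  then have "norm v \<le> 0" if "v \<in> mean_zero H" for v
    by (intro mean_zero_norm_le[OF H that]) (auto simp: lreg_id)
  then show ?thesis by (intro exI[of _ 0]) auto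
next
  case False
  have "\<forall>g\<in>H. \<exists>L::nat. \<forall>v \<delta>. (\<forall>s\<in>S. norm (lreg s v - v) \<le> \<delta>) \<longrightarrow> norm (lreg g v - v) \<le> real L * \<delta>"
    using gen_perm_displacement[OF _ S] sub by blast
  then obtain L where L: "\<And>g v \<delta>. g \<in> H \<Longrightarrow> (\<forall>s\<in>S. norm (lreg s v - v) \<le> \<delta>) \<Longrightarrow> norm (lreg g v - v) \<le> real (L g) * \<delta>"
    by (metis bchoice)
  show ?thesis
  proof (intro exI[of _ "\<Sum>g\<in>H. L g"] ballI allI impI)
    fix v \<delta> assume v: "v \<in> mean_zero H" and \<delta>: "\<forall>s\<in>S. norm (lreg s v - v) \<le> \<delta>"
    then have \<delta>0: "\<delta> \<ge> 0" using False norm_ge_zero order_trans by blast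
    show "norm v \<le> (\<Sum>g\<in>H. L g) * \<delta>"
    proof (rule mean_zero_norm_le[OF H v])
      fix g assume g: "g \<in> H"
      have "L g \<le> (\<Sum>g\<in>H. L g)" using perm_group_finite[OF H] g by (intro member_le_sum) auto
      then have "real (L g) * \<delta> \<le> (\<Sum>g\<in>H. L g) * \<delta>" by (intro mult_right_mono \<delta>0) (simp only: of_nat_le_iff)
      then show "norm (lreg g v - v) \<le> (\<Sum>g\<in>H. L g) * \<delta>" using L[OF g \<delta>] by simp
    qed
  qed
qed

section \<open>Elementary permutations of punctured coordinate space\<close>

definition nonzero_vectors :: "int \<Rightarrow> nat \<Rightarrow> (nat \<Rightarrow> int) set" where
  "nonzero_vectors p n = {f. (\<forall>i<n. 0 \<le> f i \<and> f i < p) \<and> (\<forall>i\<ge>n. f i = 0) \<and> f \<noteq> (\<lambda>_. 0)}"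

lemma finite_nonzero_vectors: "finite (nonzero_vectors p n)"
proof (rule finite_subset)
  show "nonzero_vectors p n \<subseteq> {f. \<forall>i. (i \<in> {..<n} \<longrightarrow> f i \<in> {0..<p}) \<and> (i \<notin> {..<n} \<longrightarrow> f i = 0)}"
    by (auto simp: nonzero_vectors_def)
qed (intro finite_set_of_finite_funs; simp)

text \<open>Two instances matter: the displacement of a fixed vector, and the function that is 0 on
  a subgroup and 1 off it. A word estimate for all such functions is at once a norm estimate and a
  membership statement.\<close>

definition length_fun :: "(('a \<Rightarrow> 'a) \<Rightarrow> real) \<Rightarrow> bool" where
  "length_fun l \<longleftrightarrow> (\<forall>f g. bij f \<longrightarrow> bij g \<longrightarrow> l (f \<circ> g) \<le> l f + l g) \<and> (\<forall>f. bij f \<longrightarrow> l (inv f) = l f)"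

lemma exists_not_in: "finite T \<Longrightarrow> card T < card S \<Longrightarrow> \<exists>x\<in>S. x \<notin> T"
  by (metis card_mono linorder_not_le subsetI)

text \<open>A common frame for triples and lists. The bound on \<open>n\<close> guarantees a third
  index besides any two, as commutators require.\<close>

locale coords =
  fixes p :: int and n :: nat and X :: "'a set" and c :: "'a \<Rightarrow> nat \<Rightarrow> int"
  assumes p: "prime p" "odd p" and n: "n \<ge> 3"
    and c: "bij_betw c X (nonzero_vectors p n)"
begin

abbreviation "Y \<equiv> nonzero_vectors p n"

definition lift :: "((nat \<Rightarrow> int) \<Rightarrow> nat \<Rightarrow> int) \<Rightarrow> 'a \<Rightarrow> 'a" where
  "lift F x = (if x \<in> X then inv_into X c (F (c x)) else x)"

definition ef :: "nat \<Rightarrow> ((nat \<Rightarrow> int) \<Rightarrow> int) \<Rightarrow> (nat \<Rightarrow> int) \<Rightarrow> nat \<Rightarrow> int" where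
  "ef i h f = f(i := (f i + h f) mod p)"

definition el :: "nat \<Rightarrow> ((nat \<Rightarrow> int) \<Rightarrow> int) \<Rightarrow> 'a \<Rightarrow> 'a" where
  "el i h = lift (ef i h)"

text \<open>What makes the shear x_i += h(x) a permutation of the punctured space: it is inverted by
  the shear with -h because \<open>h\<close> does not see x_i, and it fixes 0 because h(0) vanishes
  modulo \<open>p\<close>.\<close>

definition adm :: "nat \<Rightarrow> ((nat \<Rightarrow> int) \<Rightarrow> int) \<Rightarrow> bool" where
  "adm i h \<longleftrightarrow> i < n \<and> (\<forall>f a. h (f(i := a)) = h f) \<and> p dvd h (\<lambda>_. 0)"

lemma p_gt1: "p > 1" using p prime_gt_1_int by blast

lemma third_index: obtains k where "k < n" "k \<noteq> i" "k \<noteq> j"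
proof -
  have "\<exists>k\<in>{..<n}. k \<notin> {i, j}"
    by (rule exists_not_in) (use n in \<open>auto simp: card_insert_if\<close>)
  then show ?thesis using that by auto
qed

lemma p_ge3: "p \<ge> 3" using p p_gt1 by presburger

lemma c_Y: "x \<in> X \<Longrightarrow> c x \<in> Y" using c by (auto simp: bij_betw_def)

lemma c_inv: "f \<in> Y \<Longrightarrow> c (inv_into X c f) = f" "f \<in> Y \<Longrightarrow> inv_into X c f \<in> X"
  using c by (auto simp: bij_betw_def f_inv_into_f inv_into_into)

lemma inv_c: "x \<in> X \<Longrightarrow> inv_into X c (c x) = x"
  using c by (auto simp: bij_betw_def)

lemma finite_X: "finite X"
  using c finite_nonzero_vectors bij_betw_finite by blast

lemma Y_I: "(\<And>i. i < n \<Longrightarrow> 0 \<le> f i \<and> f i < p) \<Longrightarrow> (\<And>i. i \<ge> n \<Longrightarrow> f i = 0) \<Longrightarrow> f \<noteq> (\<lambda>_. 0) \<Longrightarrow> f \<in> Y"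
  by (auto simp: nonzero_vectors_def)

lemma Y_mod: "f \<in> Y \<Longrightarrow> f i mod p = f i"
  using p_gt1 by (cases "i < n") (auto simp: nonzero_vectors_def)

lemma lift_outside: "x \<notin> X \<Longrightarrow> lift F x = x"
  by (simp add: lift_def)

lemma lift_comp: "(\<And>f. f \<in> Y \<Longrightarrow> G f \<in> Y) \<Longrightarrow> lift F \<circ> lift G = lift (F \<circ> G)"
  by (auto simp: fun_eq_iff lift_def c_inv c_Y)

lemma lift_cong: "(\<And>f. f \<in> Y \<Longrightarrow> F f = G f) \<Longrightarrow> lift F = lift G"
  by (rule ext) (simp add: lift_def c_Y)

lemma lift_id: "(\<And>f. f \<in> Y \<Longrightarrow> F f = f) \<Longrightarrow> lift F = id"
  by (rule ext) (simp add: lift_def c_Y inv_c)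

lemma lift_permutes:
  assumes "\<And>f. f \<in> Y \<Longrightarrow> F f \<in> Y" "\<And>f. f \<in> Y \<Longrightarrow> G f \<in> Y" "\<And>f. f \<in> Y \<Longrightarrow> F (G f) = f" "\<And>f. f \<in> Y \<Longrightarrow> G (F f) = f"
  shows "lift F permutes X" "inv (lift F) = lift G"
proof -
  have 1: "lift F \<circ> lift G = id" "lift G \<circ> lift F = id"
    by (simp_all add: lift_comp assms lift_id)
  then have b: "bij (lift F)" using o_bij by blast
  then show "lift F permutes X" by (simp add: permutes_def bij_iff lift_outside)
  show "inv (lift F) = lift G" using 1 by (simp add: inv_unique_comp)
qed

lemma adm_lt: "adm i h \<Longrightarrow> i < n" and adm_upd: "adm i h \<Longrightarrow> h (f(i := a)) = h f"
  and adm_0: "adm i h \<Longrightarrow> p dvd h (\<lambda>_. 0)"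
  by (auto simp: adm_def)

lemma adm_add: "adm i h \<Longrightarrow> adm i h' \<Longrightarrow> adm i (\<lambda>f. h f + h' f)"
  and adm_neg: "adm i h \<Longrightarrow> adm i (\<lambda>f. - h f)"
  and adm_diff: "adm i h \<Longrightarrow> adm i h' \<Longrightarrow> adm i (\<lambda>f. h f - h' f)"
  and adm_scale: "adm i h \<Longrightarrow> adm i (\<lambda>f. t * h f)"
  by (auto simp: adm_def)

lemma adm_coord: "i < n \<Longrightarrow> j \<noteq> i \<Longrightarrow> adm i (\<lambda>f. f j)"
  and adm_mult: "adm i h \<Longrightarrow> adm i h' \<Longrightarrow> adm i (\<lambda>f. h f * h' f)"
  and adm_power: "adm i h \<Longrightarrow> k > 0 \<Longrightarrow> adm i (\<lambda>f. h f ^ k)"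
  by (auto simp: adm_def intro: dvd_trans[OF _ dvd_power])

lemma ef_Y: assumes h: "adm i h" and f: "f \<in> Y" shows "ef i h f \<in> Y"
proof (rule Y_I)
  fix j assume "j < n"
  then show "0 \<le> ef i h f j \<and> ef i h f j < p"
    using f p_gt1 by (auto simp: ef_def nonzero_vectors_def)
next
  fix j assume "j \<ge> n"
  then show "ef i h f j = 0"
    using f adm_lt[OF h] by (auto simp: ef_def nonzero_vectors_def)
next
  show "ef i h f \<noteq> (\<lambda>_. 0)"
  proof
    assume 0: "ef i h f = (\<lambda>_. 0)"
    then have e: "f = (\<lambda>_. 0)(i := f i)"
      unfolding ef_def by (metis fun_upd_triv fun_upd_upd)
    then have "h f = h (\<lambda>_. 0)" by (metis adm_upd[OF h])
    moreover have "(f i + h f) mod p = 0" using fun_cong[OF 0, of i] by (simp add: ef_def)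
    ultimately have "f i mod p = 0" using adm_0[OF h]
      by (metis dvd_add_left_iff mod_0_imp_dvd dvd_imp_mod_0)
    then have "f i = 0" using Y_mod[OF f] by simp
    with e have "f = (\<lambda>_. 0)" by auto
    then show False using f by (simp add: nonzero_vectors_def)
  qed
qed

lemma el_cong: "(\<And>f. f \<in> Y \<Longrightarrow> h f mod p = h' f mod p) \<Longrightarrow> el i h = el i h'"
  unfolding el_def ef_def by (intro lift_cong) (metis mod_add_right_eq)

lemma el_add: assumes "adm i h" "adm i h'" shows "el i h \<circ> el i h' = el i (\<lambda>f. h f + h' f)"
proof -
  have "ef i h \<circ> ef i h' = ef i (\<lambda>f. h f + h' f)"
    using adm_upd[OF assms(1)] by (intro ext) (simp add: ef_def mod_add_left_eq mod_add_right_eq ac_simps)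
  then show ?thesis
    unfolding el_def by (simp only: lift_comp[OF ef_Y[OF assms(2)]])
qed

lemma el_zero: "(\<And>f. f \<in> Y \<Longrightarrow> p dvd h f) \<Longrightarrow> el i h = id"
  unfolding el_def ef_def
  by (rule lift_id) (metis Y_mod add.right_neutral dvd_imp_mod_0 fun_upd_triv mod_add_right_eq)

lemma ef_neg: assumes "adm i h" "f \<in> Y" shows "ef i h (ef i (\<lambda>f. - h f) f) = f" "ef i (\<lambda>f. - h f) (ef i h f) = f"
  using adm_upd[OF assms(1)] Y_mod[OF assms(2)] by (simp_all add: ef_def mod_simps)

lemma assumes "adm i h" shows el_permutes: "el i h permutes X" and el_inv: "inv (el i h) = el i (\<lambda>f. - h f)"
  unfolding el_def
  using lift_permutes[of "ef i h" "ef i (\<lambda>f. - h f)"] ef_Y assms adm_neg ef_neg by auto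

lemma el_bij: "adm i h \<Longrightarrow> bij (el i h)"
  using el_permutes permutes_bij by blast

lemma adm_subst:
  assumes "adm i h" "adm j k" "i \<noteq> j" "\<And>f a. k (f(i := a)) = k f"
  shows "adm i (\<lambda>f. h (ef j k f))"
proof -
  have "h (ef j k (f(i := a))) = h (ef j k f)" for f a
  proof -
    have "ef j k (f(i := a)) = (ef j k f)(i := a)"
      using assms by (simp add: ef_def fun_upd_twist)
    then show ?thesis by (simp add: adm_upd[OF assms(1)])
  qed
  moreover have "ef j k (\<lambda>_. 0) = (\<lambda>_. 0)" using adm_0[OF assms(2)] by (auto simp: ef_def)
  ultimately show ?thesis using assms(1) by (simp add: adm_def)
qed

text \<open>Conjugation amounts to substitution in the function of the shear. If \<open>k\<close>
  involved x_i, the last factor would not restore x_j.\<close>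

lemma el_conj:
  assumes h: "adm i h" and k: "adm j k" and ij: "i \<noteq> j" and ki: "\<And>f a. k (f(i := a)) = k f"
  shows "inv (el j k) \<circ> el i h \<circ> el j k = el i (\<lambda>f. h (ef j k f))"
proof -
  have k': "adm j (\<lambda>f. - k f)" by (rule adm_neg[OF k])
  have "(ef j (\<lambda>f. - k f) \<circ> (ef i h \<circ> ef j k)) f = ef i (\<lambda>f. h (ef j k f)) f" if "f \<in> Y" for f
    using ij ki adm_upd[OF k] Y_mod[OF that]
    by (auto simp: ef_def fun_eq_iff mod_simps)
  then show ?thesis
    unfolding el_inv[OF k] comp_assoc unfolding el_def
    by (simp add: lift_comp ef_Y h k) (rule lift_cong, simp)
qed

lemma el_commute:
  assumes h: "adm i h" and k: "adm j k" and ij: "i \<noteq> j"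
    and ki: "\<And>f a. k (f(i := a)) = k f" and hj: "\<And>f a. h (f(j := a)) = h f"
  shows "el i h \<circ> el j k = el j k \<circ> el i h"
proof -
  have "ef i h \<circ> ef j k = ef j k \<circ> ef i h"
    using ij ki hj by (auto simp: ef_def fun_eq_iff)
  then show ?thesis
    unfolding el_def by (simp only: lift_comp[OF ef_Y[OF h]] lift_comp[OF ef_Y[OF k]])
qed

section \<open>Length estimates for words in shears\<close>

context
  fixes l :: "('a \<Rightarrow> 'a) \<Rightarrow> real"
  assumes l: "length_fun l"
begin

lemma l_inv: "bij f \<Longrightarrow> l (inv f) = l f" and l_comp: "bij f \<Longrightarrow> bij g \<Longrightarrow> l (f \<circ> g) \<le> l f + l g"
  using l by (auto simp: length_fun_def)

lemma l_el_add: "adm i h \<Longrightarrow> adm i h' \<Longrightarrow> l (el i (\<lambda>f. h f + h' f)) \<le> l (el i h) + l (el i h')"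
  by (metis el_add el_bij l_comp)

lemma l_el_neg: "adm i h \<Longrightarrow> l (el i (\<lambda>f. - h f)) = l (el i h)"
  by (metis el_inv el_bij l_inv)

lemma l_el_diff: "adm i h \<Longrightarrow> adm i h' \<Longrightarrow> l (el i (\<lambda>f. h f - h' f)) \<le> l (el i h) + l (el i h')"
  using l_el_add[of i h "\<lambda>f. - h' f"] by (simp add: adm_neg l_el_neg)

lemma l_el_conj:
  assumes h: "adm i h" and k: "adm j k" and ij: "i \<noteq> j" and ki: "\<And>f a. k (f(i := a)) = k f"
  shows "l (el i (\<lambda>f. h (ef j k f))) \<le> l (el i h) + 2 * l (el j k)"
proof -
  have "l (inv (el j k) \<circ> el i h \<circ> el j k) \<le> l (inv (el j k) \<circ> el i h) + l (el j k)"
    by (intro l_comp bij_comp el_bij bij_imp_bij_inv h k)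
  also have "l (inv (el j k) \<circ> el i h) \<le> l (inv (el j k)) + l (el i h)"
    by (intro l_comp el_bij bij_imp_bij_inv h k)
  finally show ?thesis by (simp add: el_conj[OF assms] l_inv el_bij[OF k])
qed

lemma l_el_commutator:
  assumes h: "adm i h" and k: "adm j k" and ij: "i \<noteq> j" and ki: "\<And>f a. k (f(i := a)) = k f"
  shows "l (el i (\<lambda>f. h (ef j k f) - h f)) \<le> 2 * l (el i h) + 2 * l (el j k)"
  using l_el_diff[OF adm_subst[OF h k ij ki] h] l_el_conj[OF assms] by linarith

text \<open>The commutator relation [E_ij, E_jk] = E_ik of elementary matrices.\<close>

lemma l_transvection_comp:
  assumes "i < n" "j < n" "k < n" "i \<noteq> j" "j \<noteq> k" "i \<noteq> k"
  shows "l (el i (\<lambda>f. f k)) \<le> 2 * l (el i (\<lambda>f. f j)) + 2 * l (el j (\<lambda>f. f k))"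
proof -
  have "l (el i (\<lambda>f. ef j (\<lambda>f. f k) f j - f j)) \<le> 2 * l (el i (\<lambda>f. f j)) + 2 * l (el j (\<lambda>f. f k))"
    using assms by (intro l_el_commutator adm_coord) auto
  moreover have "el i (\<lambda>f. ef j (\<lambda>f. f k) f j - f j) = el i (\<lambda>f. f k)"
    by (rule el_cong) (simp add: ef_def mod_simps)
  ultimately show ?thesis by simp
qed

text \<open>Commutators along the chain i, i + s, i + 2 s, ... modulo n reach every index, as s is
  coprime to n. The constant grows by 2 * 4^a + 2 <= 4^(a+1).\<close>

lemma l_transvections:
  assumes L: "\<And>i. i < n \<Longrightarrow> l (el i (\<lambda>f. f ((i + s) mod n))) \<le> L" and s: "coprime s n" and ij: "i < n" "j < n" "i \<noteq> j"
  shows "l (el i (\<lambda>f. f j)) \<le> 4 ^ n * L"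
proof -
  have bij: "(i + a * s) mod n = (i + b * s) mod n \<Longrightarrow> a mod n = b mod n" for i a b
  proof -
    assume "(i + a * s) mod n = (i + b * s) mod n"
    then have "[i + a * s = i + b * s] (mod n)" by (simp add: cong_def)
    then have "[a * s = b * s] (mod n)" by (simp add: cong_add_lcancel_nat)
    then have "[a = b] (mod n)" using s by (simp add: cong_mult_rcancel_nat)
    then show ?thesis by (simp add: cong_def)
  qed
  have n0: "n > 0" using n by simp
  have s0: "s mod n \<noteq> 0"
  proof
    assume "s mod n = 0"
    then have "n dvd s" by auto
    then have "n dvd 1" using s by (metis coprime_common_divisor dvd_refl)
    then show False using n by simp
  qed
  have "l (el 0 (\<lambda>f. f ((0 + s) mod n))) \<le> L" using L n0 by blast
  \<comment> \<open>The identity is the product of an element with its inverse, which forces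
    \<open>L\<close> to be nonnegative.\<close>
  have inv0: "l (inv (el 0 (\<lambda>f. f ((0 + s) mod n))) \<circ> el 0 (\<lambda>f. f ((0 + s) mod n))) \<le> 2 * L"
    using l_comp[of "inv (el 0 (\<lambda>f. f ((0 + s) mod n)))" "el 0 (\<lambda>f. f ((0 + s) mod n))"] L[OF n0] s0 n0
      el_bij[OF adm_coord, of 0 "(0 + s) mod n"] by (simp add: l_inv bij_imp_bij_inv)
  have "0 \<le> l id" using l_comp[of id id] by (simp add: bij_id)
  then have L0: "L \<ge> 0"
    using inv0 el_bij[OF adm_coord, of 0 "(0 + s) mod n"] s0 n0 by (simp add: bij_is_inj)
  have *: "a < n \<Longrightarrow> 0 < a \<Longrightarrow> i < n \<Longrightarrow> l (el i (\<lambda>f. f ((i + a * s) mod n))) \<le> 4 ^ a * L" for a i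
  proof (induction a)
    case (Suc a)
    show ?case
    proof (cases "a = 0")
      case True
      then show ?thesis using L[OF \<open>i < n\<close>] L0 by simp
    next
      case False
      let ?j = "(i + a * s) mod n" and ?k = "(i + Suc a * s) mod n"
      have ne: "i \<noteq> ?j" "?j \<noteq> ?k" "i \<noteq> ?k"
        using bij[of i 0 a] bij[of i a "Suc a"] bij[of i 0 "Suc a"] Suc.prems False by auto
      have k: "(?j + s) mod n = ?k" by (simp add: mod_simps ac_simps)
      have "l (el i (\<lambda>f. f ?k)) \<le> 2 * l (el i (\<lambda>f. f ?j)) + 2 * l (el ?j (\<lambda>f. f ?k))"
        using n0 Suc.prems ne by (intro l_transvection_comp) auto
      also have "\<dots> \<le> 2 * (4 ^ a * L) + 2 * L"
        using Suc.IH Suc.prems False L[of ?j, unfolded k] n0 by (intro add_mono mult_left_mono) auto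
      also have "2 * L \<le> 2 * (4 ^ a * L)" using L0 by (simp add: mult_le_cancel_right1)
      finally show ?thesis by (simp add: mult_ac)
    qed
  qed simp
  obtain a where a: "a < n" "(i + a * s) mod n = j"
  proof -
    have "inj_on (\<lambda>a. (i + a * s) mod n) {..<n}"
    proof (rule inj_onI)
      fix a b assume ab: "a \<in> {..<n}" "b \<in> {..<n}" "(i + a * s) mod n = (i + b * s) mod n"
      from bij[OF ab(3)] ab(1,2) show "a = b" by simp
    qed
    then have "(\<lambda>a. (i + a * s) mod n) ` {..<n} = {..<n}"
      using n0 by (intro card_subset_eq) (auto simp: card_image)
    moreover have "j \<in> {..<n}" using ij(2) by simp
    ultimately obtain a where "a \<in> {..<n}" "j = (i + a * s) mod n" by blast
    then show ?thesis using that[of a] by simp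
  qed
  have "a > 0" using a ij by (cases a) auto
  then have "l (el i (\<lambda>f. f j)) \<le> 4 ^ a * L" using *[OF a(1) _ ij(1)] a by simp
  also have "\<dots> \<le> 4 ^ n * L" using a(1) L0 by (intro mult_right_mono power_increasing) auto
  finally show ?thesis .
qed

text \<open>Polarization \<open>(y + s z)\<^sup>2 - (y - s z)\<^sup>2 = 4 s y z\<close> trades the parameter \<open>s\<close> of a transvection
  for the parameter of a quadratic root subgroup.\<close>

lemma l_quadratic:
  assumes L: "\<And>i j t. i < n \<Longrightarrow> j < n \<Longrightarrow> i \<noteq> j \<Longrightarrow> l (el i (\<lambda>f. t * f j)) \<le> L"
    and sq: "i < n" "j < n" "i \<noteq> j" "l (el i (\<lambda>f. (f j)\<^sup>2)) \<le> L"
    and k: "k < n" "k \<noteq> i"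
  shows "l (el i (\<lambda>f. t * (f k)\<^sup>2)) \<le> 14 * L"
proof -
  have pol: "l (el i (\<lambda>f. t * (f j * f k))) \<le> 6 * L" if k: "k < n" "k \<noteq> i" "k \<noteq> j" for k t
  proof -
    have "coprime 4 p"
    proof -
      have "coprime (2 ^ 2) p" by (subst coprime_power_left_iff) (use p(2) in simp)
      then show ?thesis by simp
    qed
    then obtain e where "[4 * e = 1] (mod p)" using cong_solve_coprime_int by blast
    then have e: "4 * e mod p = 1 mod p" by (simp add: cong_def)
    \<comment> \<open>This is t/4 modulo \<open>p\<close>. The squares of y + s z and y - s z cost
      \<open>3 * L\<close> each as conjugates, their difference \<open>6 * L\<close>.\<close>
    define s where "s = e * t"
    have aj: "adm i (\<lambda>f. (f j)\<^sup>2)" using sq by (intro adm_power adm_coord) auto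
    have ak: "adm j (\<lambda>f. s * f k)" for s using sq k by (intro adm_scale adm_coord) auto
    have conj: "l (el i (\<lambda>f. (ef j (\<lambda>f. s * f k) f j)\<^sup>2)) \<le> 3 * L" for s
      using l_el_conj[OF aj ak[of s] sq(3)] k L[of j k s] sq by simp
    have "l (el i (\<lambda>f. (ef j (\<lambda>f. s * f k) f j)\<^sup>2 - (ef j (\<lambda>f. - s * f k) f j)\<^sup>2)) \<le> 6 * L"
      using l_el_diff[OF adm_subst[OF aj ak[of s] sq(3)] adm_subst[OF aj ak[of "- s"] sq(3)]] conj[of s] conj[of "- s"] k
      by simp
    moreover have "el i (\<lambda>f. (ef j (\<lambda>f. s * f k) f j)\<^sup>2 - (ef j (\<lambda>f. - s * f k) f j)\<^sup>2) = el i (\<lambda>f. t * (f j * f k))"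
    proof (rule el_cong)
      fix f
      have "((ef j (\<lambda>f. s * f k) f j)\<^sup>2 - (ef j (\<lambda>f. - s * f k) f j)\<^sup>2) mod p = ((f j + s * f k)\<^sup>2 - (f j + - s * f k)\<^sup>2) mod p"
        unfolding power2_eq_square by (intro mod_diff_cong mod_mult_cong) (simp_all add: ef_def)
      also have "(f j + s * f k)\<^sup>2 - (f j + - s * f k)\<^sup>2 = (4 * e) * (t * (f j * f k))"
        by (simp add: s_def power2_eq_square algebra_simps)
      also have "\<dots> mod p = (1 * (t * (f j * f k))) mod p" using e by (intro mod_mult_cong) auto
      finally show "((ef j (\<lambda>f. s * f k) f j)\<^sup>2 - (ef j (\<lambda>f. - s * f k) f j)\<^sup>2) mod p = t * (f j * f k) mod p" by simp
    qed
    ultimately show ?thesis by simp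
  qed
  \<comment> \<open>Back from products to squares: substituting x_b + x_a for x_b in t x_a x_b adds
    t x_a^2, at cost (6 + 2) + 6 = 14.\<close>
  have last: "l (el i (\<lambda>f. t * (f a)\<^sup>2)) \<le> 14 * L"
    if ab: "a < n" "b < n" "a \<noteq> i" "b \<noteq> i" "a \<noteq> b" and P: "\<And>t. l (el i (\<lambda>f. t * (f a * f b))) \<le> 6 * L" for a b t
  proof -
    have A: "adm i (\<lambda>f. t * (f a * f b))" using ab sq by (intro adm_scale adm_mult adm_coord) auto
    have B: "adm b (\<lambda>f. 1 * f a)" using ab by (intro adm_scale adm_coord) auto
    have ib: "i \<noteq> b" using ab by simp
    have ki: "1 * (f(i := x)) a = 1 * f a" for f :: "nat \<Rightarrow> int" and x using ab by simp
    have "l (el i (\<lambda>f. t * (ef b (\<lambda>f. 1 * f a) f a * ef b (\<lambda>f. 1 * f a) f b) - t * (f a * f b))) \<le> 14 * L"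
      using l_el_diff[OF adm_subst[OF A B ib ki] A] l_el_conj[OF A B ib ki] P[of t] L[of b a 1] ab by simp
    moreover have "el i (\<lambda>f. t * (ef b (\<lambda>f. 1 * f a) f a * ef b (\<lambda>f. 1 * f a) f b) - t * (f a * f b)) = el i (\<lambda>f. t * (f a)\<^sup>2)"
    proof (rule el_cong)
      fix f
      have ea: "ef b (\<lambda>f. 1 * f a) f a = f a" using ab by (simp add: ef_def)
      have "(t * (ef b (\<lambda>f. 1 * f a) f a * ef b (\<lambda>f. 1 * f a) f b) - t * (f a * f b)) mod p
          = (t * (f a * (f b + f a)) - t * (f a * f b)) mod p"
        unfolding ea by (intro mod_diff_cong mod_mult_cong refl) (simp add: ef_def)
      then show "(t * (ef b (\<lambda>f. 1 * f a) f a * ef b (\<lambda>f. 1 * f a) f b) - t * (f a * f b)) mod p = t * (f a)\<^sup>2 mod p"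
        by (simp add: power2_eq_square algebra_simps)
    qed
    ultimately show ?thesis by simp
  qed
  show ?thesis
  proof (cases "k = j")
    case True
    obtain b where "b < n" "b \<noteq> i" "b \<noteq> j" by (rule third_index)
    then show ?thesis using last[of j b t] pol[of b] sq True by auto
  next
    case False
    have "l (el i (\<lambda>f. t * (f k * f j))) \<le> 6 * L" for t
      using pol[of k t] False k by (simp add: mult.commute)
    then show ?thesis using last[of k j t] sq k False by auto
  qed
qed

end

end

section \<open>A spectral gap for large primes\<close>

lemma evenperm_funpow:
  assumes "permutation f"
  shows "permutation (f ^^ k) \<and> (evenperm (f ^^ k) \<longleftrightarrow> evenperm f \<or> even k)"
proof (induction k)
  case (Suc k)
  then show ?case
    by (metis assms even_Suc evenperm_comp funpow.simps(2) permutation_compose)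
qed (simp add: permutation_id evenperm_id[unfolded id_def] id_def)

lemma evenperm_of_odd_order:
  assumes "finite X" "f permutes X" "f ^^ k = id" "odd k"
  shows "evenperm f"
  using evenperm_funpow[of f k] assms permutation_permutes by (metis evenperm_id)

lemma perm_group_Alt: assumes "finite X" shows "perm_group X (Alt X)"
proof -
  have perm: "permutation f" if "f permutes X" for f
    using that assms permutation_permutes by blast
  show ?thesis
    using assms perm unfolding perm_group_def Alt_def
    by (auto simp: permutes_inv permutes_id evenperm_inv evenperm_comp permutes_compose)
qed

lemma length_fun_displacement: "length_fun (\<lambda>g. norm (lreg g v - v))"
  unfolding length_fun_def
proof (intro conjI allI impI)
  fix f g :: "'a \<Rightarrow> 'a" assume f: "bij f" and g: "bij g"
  have "lreg (f \<circ> g) v - v = lreg f (lreg g v - v) + (lreg f v - v)"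
    by (simp add: lreg_comp[OF f g] linear_diff[OF lreg_linear[OF f]])
  then show "norm (lreg (f \<circ> g) v - v) \<le> norm (lreg f v - v) + norm (lreg g v - v)"
    by (metis add.commute lreg_norm[OF f] norm_triangle_ineq)
next
  fix f :: "'a \<Rightarrow> 'a" assume f: "bij f"
  have "lreg f (lreg (inv f) v - v) = v - lreg f v"
    using lreg_comp[OF f bij_imp_bij_inv[OF f], of v] f
    by (simp add: linear_diff[OF lreg_linear[OF f]] bij_is_surj surj_iff[THEN iffD1] lreg_id)
  then show "norm (lreg (inv f) v - v) = norm (lreg f v - v)"
    by (metis lreg_norm[OF f] norm_minus_commute)
qed

section \<open>Shears and root subgroups in the regular representation\<close>

context coords
begin

lemma el_funpow: assumes "adm i h" shows "el i h ^^ k = el i (\<lambda>f. int k * h f)"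
proof (induction k)
  case (Suc k)
  then show ?case
    using el_add[OF assms adm_scale[OF assms, of "int k"]] by (simp add: algebra_simps)
qed (simp add: el_zero)

text \<open>The \<open>p\<close>-th power of a shear is trivial and \<open>p\<close> is odd.\<close>

lemma el_Alt: assumes "adm i h" shows "el i h \<in> Alt X"
proof -
  have "el i h ^^ nat p = id"
    using p_gt1 by (simp add: el_funpow[OF assms] el_zero)
  moreover have "odd (nat p)" using p p_gt1 by (simp add: even_nat_iff)
  ultimately show ?thesis
    using evenperm_of_odd_order[OF finite_X el_permutes[OF assms]] el_permutes[OF assms]
    by (simp add: Alt_def)
qed

lemma el_cyc_rep: assumes "adm i h" shows "cyc_rep p (\<lambda>t. lreg (el i (\<lambda>f. t * h f)))"
  unfolding cyc_rep_def
proof (intro conjI allI)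
  show "p > 0" using p_gt1 by simp
  have a: "adm i (\<lambda>f. t * h f)" for t by (rule adm_scale[OF assms])
  show "orthogonal_transformation (lreg (el i (\<lambda>f. t * h f)))" for t
    by (intro lreg_orth el_bij a)
  show "lreg (el i (\<lambda>f. (s + t) * h f)) v = lreg (el i (\<lambda>f. s * h f)) (lreg (el i (\<lambda>f. t * h f)) v)" for s t v
    by (simp add: lreg_comp[symmetric] el_bij a el_add distrib_right)
  have "el i (\<lambda>f. t mod p * h f) = el i (\<lambda>f. t * h f)" for t
    by (rule el_cong) (simp add: mod_mult_left_eq)
  then show "lreg (el i (\<lambda>f. t mod p * h f)) = lreg (el i (\<lambda>f. t * h f))" for t by simp
qed

lemma el_conj':
  assumes "adm i h" "adm j k" "i \<noteq> j" "\<And>f a. k (f(i := a)) = k f"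
  shows "el i h \<circ> el j k = el j k \<circ> el i (\<lambda>f. h (ef j k f))"
  unfolding el_conj[OF assms, symmetric]
  using el_bij[OF assms(2)] by (simp add: fun_eq_iff bij_is_surj surj_f_inv_f)

text \<open>The plane consists of the shears of x_i by a x_j + b x_k; the two transvections between
  x_j and x_k act on it as the generators of SL_2.\<close>

lemma transvection_relative_T:
  assumes ijk: "i < n" "j < n" "k < n" "i \<noteq> j" "j \<noteq> k" "i \<noteq> k"
    and \<delta>: "\<And>i j. i < n \<Longrightarrow> j < n \<Longrightarrow> i \<noteq> j \<Longrightarrow> norm (lreg (el i (\<lambda>f. f j)) v - v) \<le> \<delta>"
  shows "norm (lreg (el i (\<lambda>f. t * f j)) v - v) \<le> 20 * \<delta>"
proof -
  define U where "U a b = lreg (el i (\<lambda>f. a * f j + b * f k))" for a b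
  have a: "adm i (\<lambda>f. a * f j + b * f k)" for a b
    using ijk by (intro adm_add adm_scale adm_coord) auto
  have aj: "adm j (\<lambda>f. f k)" and ak: "adm k (\<lambda>f. f j)" using ijk by (auto intro: adm_coord)
  obtain m where m: "p = 2 * int m + 1"
  proof -
    obtain m where "p = 2 * m + 1" using p(2) by (elim oddE)
    then show ?thesis using that[of "nat m"] p_gt1 by simp
  qed
  interpret plane_rep p m U
  proof
    show "p = 2 * int m + 1" by (rule m)
    show "m > 0" using m p_ge3 by simp
    show "orthogonal_transformation (U a b)" for a b unfolding U_def by (intro lreg_orth el_bij a)
    show "U (x + x') (y + y') w = U x y (U x' y' w)" for x y x' y' w
    proof -
      have "(\<lambda>f. (x + x') * f j + (y + y') * f k) = (\<lambda>f. x * f j + y * f k + (x' * f j + y' * f k))"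
        by (auto simp: algebra_simps)
      then show ?thesis by (simp add: U_def lreg_comp[symmetric] el_bij a el_add)
    qed
    show "U (x mod p) (y mod p) = U x y" for x y
      unfolding U_def by (rule arg_cong[of _ _ lreg], rule el_cong) (intro mod_add_cong mod_mult_cong; simp)
  qed
  have "norm (U t 0 v - v) \<le> 20 * \<delta>"
  proof (rule relative_T[of "lreg (el j (\<lambda>f. f k))" "lreg (el k (\<lambda>f. f j))"])
    show "U x y (lreg (el j (\<lambda>f. f k)) w) = lreg (el j (\<lambda>f. f k)) (U x (x + y) w)" for x y w
    proof -
      have e: "el i (\<lambda>f. x * ef j (\<lambda>f. f k) f j + y * ef j (\<lambda>f. f k) f k) = el i (\<lambda>f. x * f j + (x + y) * f k)"
      proof (rule el_cong)
        fix f
        have "(x * ef j (\<lambda>f. f k) f j + y * ef j (\<lambda>f. f k) f k) mod p = (x * (f j + f k) + y * f k) mod p"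
          by (intro mod_add_cong mod_mult_cong) (use ijk in \<open>simp_all add: ef_def\<close>)
        then show "(x * ef j (\<lambda>f. f k) f j + y * ef j (\<lambda>f. f k) f k) mod p = (x * f j + (x + y) * f k) mod p"
          by (simp add: algebra_simps)
      qed
      have "el i (\<lambda>f. x * f j + y * f k) \<circ> el j (\<lambda>f. f k) = el j (\<lambda>f. f k) \<circ> el i (\<lambda>f. x * f j + (x + y) * f k)"
        using ijk by (subst el_conj'[OF a aj]) (simp_all add: e)
      then show ?thesis by (simp add: U_def lreg_comp[symmetric] el_bij a aj)
    qed
    show "U x y (lreg (el k (\<lambda>f. f j)) w) = lreg (el k (\<lambda>f. f j)) (U (x + y) y w)" for x y w
    proof -
      have e: "el i (\<lambda>f. x * ef k (\<lambda>f. f j) f j + y * ef k (\<lambda>f. f j) f k) = el i (\<lambda>f. (x + y) * f j + y * f k)"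
      proof (rule el_cong)
        fix f
        have "(x * ef k (\<lambda>f. f j) f j + y * ef k (\<lambda>f. f j) f k) mod p = (x * f j + y * (f k + f j)) mod p"
          by (intro mod_add_cong mod_mult_cong) (use ijk in \<open>simp_all add: ef_def\<close>)
        then show "(x * ef k (\<lambda>f. f j) f j + y * ef k (\<lambda>f. f j) f k) mod p = ((x + y) * f j + y * f k) mod p"
          by (simp add: algebra_simps)
      qed
      have "el i (\<lambda>f. x * f j + y * f k) \<circ> el k (\<lambda>f. f j) = el k (\<lambda>f. f j) \<circ> el i (\<lambda>f. (x + y) * f j + y * f k)"
        using ijk by (subst el_conj'[OF a ak]) (simp_all add: e)
      then show ?thesis by (simp add: U_def lreg_comp[symmetric] el_bij a ak)
    qed
    show "norm (U 1 0 v - v) \<le> \<delta>" "norm (U 0 1 v - v) \<le> \<delta>"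
      using \<delta>[of i j] \<delta>[of i k] ijk by (simp_all add: U_def)
    show "norm (lreg (el j (\<lambda>f. f k)) v - v) \<le> \<delta>" "norm (lreg (el k (\<lambda>f. f j)) v - v) \<le> \<delta>"
      using \<delta> ijk by simp_all
  qed (use aj ak in \<open>simp_all add: lreg_linear lreg_norm el_bij\<close>)
  then show ?thesis by (simp add: U_def)
qed

definition "succ i = (i + 1) mod n"

lemma succ: "i < n \<Longrightarrow> succ i < n" "i < n \<Longrightarrow> succ i \<noteq> i" "i < n \<Longrightarrow> succ (succ i) \<noteq> i"
  using n by (auto simp: succ_def mod_Suc split: if_splits)

text \<open>Only the next coordinate in cyclic order is read. As n >= 3, at most one of two root
  groups changes a coordinate that the other reads, which keeps every pair nilpotent.\<close>

definition root_perm :: "nat \<Rightarrow> nat \<Rightarrow> int \<Rightarrow> 'a \<Rightarrow> 'a" where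
  "root_perm i e t = el i (\<lambda>f. t * f (succ i) ^ e)"

definition "PR i e = avg p (\<lambda>t. lreg (root_perm i e t))"

lemma root_adm: "i < n \<Longrightarrow> e > 0 \<Longrightarrow> adm i (\<lambda>f. f (succ i) ^ e)"
  by (intro adm_power adm_coord succ)

lemma root_rep: "i < n \<Longrightarrow> e > 0 \<Longrightarrow> cyc_rep p (\<lambda>t. lreg (root_perm i e t))"
  unfolding root_perm_def by (intro el_cyc_rep root_adm)

lemma root_bij: "i < n \<Longrightarrow> e > 0 \<Longrightarrow> bij (root_perm i e t)"
  unfolding root_perm_def by (intro el_bij adm_scale root_adm)

lemma quadratic_pair_el:
  assumes h: "\<And>a b c. adm i (h a b c)"
    and add: "\<And>a b c a' b' c' f. h (a + a') (b + b') (c + c') f = h a b c f + h a' b' c' f"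
    and per: "\<And>a b c f. h (a mod p) (b mod p) (c mod p) f mod p = h a b c f mod p"
    and k: "adm j k"
    and conj: "\<And>a b c s. el i (h a b c) \<circ> el j (\<lambda>f. s * k f) = el j (\<lambda>f. s * k f) \<circ> el i (h a (b + a * s) (c + 2 * b * s + a * s\<^sup>2))"
  shows "quadratic_pair p (\<lambda>a b c. lreg (el i (h a b c))) (\<lambda>s. lreg (el j (\<lambda>f. s * k f)))"
proof
  show "prime p" by (rule p)
  show "orthogonal_transformation (lreg (el i (h a b c)))" for a b c by (intro lreg_orth el_bij h)
  show "lreg (el i (h (a + a') (b + b') (c + c'))) v = lreg (el i (h a b c)) (lreg (el i (h a' b' c')) v)" for a b c a' b' c' v
    by (simp add: lreg_comp[symmetric] el_bij h el_add add[abs_def])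
  show "lreg (el i (h (a mod p) (b mod p) (c mod p))) = lreg (el i (h a b c))" for a b c
    by (rule arg_cong[of _ _ lreg], rule el_cong, rule per)
  show B: "cyc_rep p (\<lambda>s. lreg (el j (\<lambda>f. s * k f)))" by (rule el_cyc_rep[OF k])
  fix s a b c v
  have "lreg (el i (h a b c)) (lreg (el j (\<lambda>f. s * k f)) v) = lreg (el j (\<lambda>f. s * k f)) (lreg (el i (h a (b + a * s) (c + 2 * b * s + a * s\<^sup>2))) v)"
    using conj[of a b c s] by (simp add: lreg_comp[symmetric] el_bij h k adm_scale)
  then show "lreg (el j (\<lambda>f. - s * k f)) (lreg (el i (h a b c)) (lreg (el j (\<lambda>f. s * k f)) v)) = lreg (el i (h a (b + a * s) (c + 2 * b * s + a * s\<^sup>2))) v"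
    by (simp only: cyc_rep_neg[OF B])
qed

text \<open>The degenerate instance in which \<open>B\<close> acts trivially on the family. It
  includes i = j, where both shears change the same coordinate.\<close>

lemma root_pair_commuting:
  assumes i: "i < n" "e > 0" and j: "j < n" "e' > 0" and ne: "succ i \<noteq> j" "succ j \<noteq> i"
  shows "quadratic_pair p (\<lambda>a b c. lreg (el i (\<lambda>f. a * f (succ i) ^ e))) (\<lambda>s. lreg (el j (\<lambda>f. s * f (succ j) ^ e')))"
proof (rule quadratic_pair_el)
  show a: "adm i (\<lambda>f. a * f (succ i) ^ e)" for a using i by (intro adm_scale root_adm)
  show k: "adm j (\<lambda>f. f (succ j) ^ e')" using j by (intro root_adm)
  show "el i (\<lambda>f. a * f (succ i) ^ e) \<circ> el j (\<lambda>f. s * f (succ j) ^ e') = el j (\<lambda>f. s * f (succ j) ^ e') \<circ> el i (\<lambda>f. a * f (succ i) ^ e)" for a s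
  proof (cases "i = j")
    case True
    then show ?thesis
      using el_add[of i "\<lambda>f. a * f (succ i) ^ e" "\<lambda>f. s * f (succ j) ^ e'"] el_add[of i "\<lambda>f. s * f (succ j) ^ e'" "\<lambda>f. a * f (succ i) ^ e"] a adm_scale[OF k, of s]
      by (simp add: add.commute)
  next
    case False
    then show ?thesis
      using a adm_scale[OF k, of s] ne by (intro el_commute) auto
  qed
qed (simp_all add: distrib_right mod_mult_left_eq)

text \<open>With y and z the next two coordinates, substituting y + s z^e' for y in a y + b z^e'
  changes only b, to b + a s: a group of Heisenberg type.\<close>

lemma root_pair_1:
  assumes i: "i < n" and e': "e' > 0"
  shows "quadratic_pair p (\<lambda>a b c. lreg (el i (\<lambda>f. a * f (succ i) + b * f (succ (succ i)) ^ e')))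
    (\<lambda>s. lreg (el (succ i) (\<lambda>f. s * f (succ (succ i)) ^ e')))"
proof (rule quadratic_pair_el)
  show a: "adm i (\<lambda>f. a * f (succ i) + b * f (succ (succ i)) ^ e')" for a b
    using i e' succ(2,3)[OF i] by (intro adm_scale adm_add adm_power adm_coord) 
  show k: "adm (succ i) (\<lambda>f. f (succ (succ i)) ^ e')" using i e' by (intro root_adm succ)
  show "(a mod p * f (succ i) + b mod p * f (succ (succ i)) ^ e') mod p = (a * f (succ i) + b * f (succ (succ i)) ^ e') mod p" for a b f
    by (intro mod_add_cong mod_mult_cong) simp_all
  fix a b s
  let ?k = "\<lambda>f. s * f (succ (succ i)) ^ e' :: int"
  have "el i (\<lambda>f. a * ef (succ i) ?k f (succ i) + b * ef (succ i) ?k f (succ (succ i)) ^ e') = el i (\<lambda>f. a * f (succ i) + (b + a * s) * f (succ (succ i)) ^ e')"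
  proof (rule el_cong)
    fix f
    have "(a * ef (succ i) ?k f (succ i) + b * ef (succ i) ?k f (succ (succ i)) ^ e') mod p = (a * (f (succ i) + ?k f) + b * f (succ (succ i)) ^ e') mod p"
      by (intro mod_add_cong mod_mult_cong) (use succ(2)[OF succ(1)[OF i]] in \<open>simp_all add: ef_def\<close>)
    then show "(a * ef (succ i) ?k f (succ i) + b * ef (succ i) ?k f (succ (succ i)) ^ e') mod p = (a * f (succ i) + (b + a * s) * f (succ (succ i)) ^ e') mod p"
      by (simp add: algebra_simps)
  qed
  then show "el i (\<lambda>f. a * f (succ i) + b * f (succ (succ i)) ^ e') \<circ> el (succ i) ?k = el (succ i) ?k \<circ> el i (\<lambda>f. a * f (succ i) + (b + a * s) * f (succ (succ i)) ^ e')"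
    using succ(2,3)[OF i] by (subst el_conj'[OF a adm_scale[OF k]]) auto
qed (simp_all add: algebra_simps)

text \<open>Quadratic forms in y and z^e', for y and z the next two coordinates. The factor 2 at b
  makes the substitution exactly the one in \<open>quadratic_pair\<close>.\<close>

lemma root_pair_2:
  assumes i: "i < n" and e': "e' > 0"
  shows "quadratic_pair p
    (\<lambda>a b c. lreg (el i (\<lambda>f. a * f (succ i) ^ 2 + b * (2 * (f (succ i) * f (succ (succ i)) ^ e')) + c * (f (succ (succ i)) ^ e') ^ 2)))
    (\<lambda>s. lreg (el (succ i) (\<lambda>f. s * f (succ (succ i)) ^ e')))"
proof (rule quadratic_pair_el)
  let ?h = "\<lambda>a b c (f :: nat \<Rightarrow> int). a * f (succ i) ^ 2 + b * (2 * (f (succ i) * f (succ (succ i)) ^ e')) + c * (f (succ (succ i)) ^ e') ^ 2 :: int"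
  show a: "adm i (?h a b c)" for a b c
    using i e' succ(2,3)[OF i] by (intro adm_scale adm_add adm_mult adm_power adm_coord) auto
  show k: "adm (succ i) (\<lambda>f. f (succ (succ i)) ^ e')" using i e' by (intro root_adm succ)
  show "?h (a mod p) (b mod p) (c mod p) f mod p = ?h a b c f mod p" for a b c f
    by (intro mod_add_cong mod_mult_cong) simp_all
  fix a b c s
  let ?k = "\<lambda>f. s * f (succ (succ i)) ^ e' :: int"
  have "el i (\<lambda>f. ?h a b c (ef (succ i) ?k f)) = el i (?h a (b + a * s) (c + 2 * b * s + a * s\<^sup>2))"
  proof (rule el_cong)
    fix f :: "nat \<Rightarrow> int"
    let ?y = "f (succ i)" and ?z = "f (succ (succ i)) ^ e'"
    have z: "ef (succ i) ?k f (succ (succ i)) = f (succ (succ i))"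
      using succ(2)[OF succ(1)[OF i]] by (simp add: ef_def)
    have "?h a b c (ef (succ i) ?k f) mod p = (a * ((?y + s * ?z) * (?y + s * ?z)) + b * (2 * ((?y + s * ?z) * ?z)) + c * ?z ^ 2) mod p"
      unfolding z power2_eq_square[of "ef (succ i) ?k f (succ i)"]
      by (intro mod_add_cong mod_mult_cong refl) (simp_all add: ef_def)
    then show "?h a b c (ef (succ i) ?k f) mod p = ?h a (b + a * s) (c + 2 * b * s + a * s\<^sup>2) f mod p"
      by (simp add: power2_eq_square algebra_simps)
  qed
  then show "el i (?h a b c) \<circ> el (succ i) ?k = el (succ i) ?k \<circ> el i (?h a (b + a * s) (c + 2 * b * s + a * s\<^sup>2))"
    using succ(2,3)[OF i] by (subst el_conj'[OF a adm_scale[OF k]]) auto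
qed (simp_all add: algebra_simps)

lemma root_pair_angle:
  fixes r :: real
  assumes ie: "i < n" "e \<in> {1, 2}" and je: "j < n" "e' \<in> {1, 2}"
    and r: "0 \<le> r" "r \<le> 1/4" "2 \<le> r\<^sup>2 * p"
  shows "inner (v - PR i e v) (v - PR j e' v) \<ge> - r * ((norm (v - PR i e v))\<^sup>2 + (norm (v - PR j e' v))\<^sup>2)"
proof -
  have adjacent: "inner (v - PR i e v) (v - PR (succ i) e' v) \<ge> - r * ((norm (v - PR i e v))\<^sup>2 + (norm (v - PR (succ i) e' v))\<^sup>2)"
    if i: "i < n" and e: "e \<in> {1, 2}" and e': "e' \<in> {1, 2}" for i e e'
  proof (cases "e = 1")
    case True
    have "e' > 0" using e' by auto
    interpret quadratic_pair p "\<lambda>a b c. lreg (el i (\<lambda>f. a * f (succ i) + b * f (succ (succ i)) ^ e'))"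
        "\<lambda>s. lreg (el (succ i) (\<lambda>f. s * f (succ (succ i)) ^ e'))"
      by (rule root_pair_1[OF i \<open>e' > 0\<close>])
    have "PA = PR i e" "PB = PR (succ i) e'"
      by (simp_all add: PA_def PB_def PR_def root_perm_def True)
    then show ?thesis using pair_angle[OF r, of v] by simp
  next
    case False
    then have "e = 2" using e by simp
    have "e' > 0" using e' by auto
    interpret quadratic_pair p "\<lambda>a b c. lreg (el i (\<lambda>f. a * f (succ i) ^ 2 + b * (2 * (f (succ i) * f (succ (succ i)) ^ e')) + c * (f (succ (succ i)) ^ e') ^ 2))"
        "\<lambda>s. lreg (el (succ i) (\<lambda>f. s * f (succ (succ i)) ^ e'))"
      by (rule root_pair_2[OF i \<open>e' > 0\<close>])
    have "PA = PR i e" "PB = PR (succ i) e'"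
      by (simp_all add: PA_def PB_def PR_def root_perm_def \<open>e = 2\<close>)
    then show ?thesis using pair_angle[OF r, of v] by simp
  qed
  consider "j = succ i" | "i = succ j" | "succ i \<noteq> j" "succ j \<noteq> i" by blast
  then show ?thesis
  proof cases
    case 1
    then show ?thesis using adjacent ie je by simp
  next
    case 2
    then show ?thesis using adjacent[OF je ie(2)] by (simp add: inner_commute add.commute)
  next
    case 3
    have pos: "e > 0" "e' > 0" using ie je by auto
    interpret quadratic_pair p "\<lambda>a b c. lreg (el i (\<lambda>f. a * f (succ i) ^ e))" "\<lambda>s. lreg (el j (\<lambda>f. s * f (succ j) ^ e'))"
      by (rule root_pair_commuting[OF ie(1) pos(1) je(1) pos(2) 3])
    have "PA = PR i e" "PB = PR j e'"
      by (simp_all add: PA_def PB_def PR_def root_perm_def)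
    then show ?thesis using pair_angle[OF r, of v] by simp
  qed
qed

lemma root_gap:
  assumes gen: "Alt X \<subseteq> gen_perm {root_perm i e t | i e t. i < n \<and> e \<in> {1, 2}}"
    and large: "p \<ge> 128 * int n ^ 2"
    and v: "v \<in> mean_zero (Alt X)"
    and D: "\<And>i e t. i < n \<Longrightarrow> e \<in> {1, 2} \<Longrightarrow> norm (lreg (root_perm i e t) v - v) \<le> D"
  shows "norm v \<le> 16 * real n ^ 2 * D"
proof -
  let ?I = "{..<n} \<times> {1, 2 :: nat}"
  let ?P = "\<lambda>(i, e). PR i e"
  \<comment> \<open>The largest cosine that \<open>oproj_family_gap\<close> admits for 2n
    projections; 2 <= r^2 p then reads p >= 128 n^2.\<close>
  define r where "r = 1 / (8 * real n)"
  have n0: "real n > 0" using n by simp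
  have r: "0 \<le> r" "r \<le> 1/4" "2 \<le> r\<^sup>2 * p" "4 * r * real (2 * n) \<le> 1"
  proof -
    show "0 \<le> r" "r \<le> 1/4" "4 * r * real (2 * n) \<le> 1" using n n0 by (auto simp: r_def field_simps)
    have "real_of_int (128 * int n ^ 2) \<le> of_int p" using large by (simp only: of_int_le_iff)
    then have "r\<^sup>2 * (128 * real n ^ 2) \<le> r\<^sup>2 * p" by (intro mult_left_mono) auto
    then show "2 \<le> r\<^sup>2 * p" using n0 by (simp add: r_def power_divide power_mult_distrib)
  qed
  have G: "perm_group X (Alt X)" by (rule perm_group_Alt[OF finite_X])
  have root_Alt: "root_perm i e t \<in> Alt X" if "i < n" "e \<in> {1, 2}" for i e t
    unfolding root_perm_def using that by (intro el_Alt adm_scale root_adm) auto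
  have D0: "D \<ge> 0" using D[of 0 1 0] n norm_ge_zero order_trans by (metis insertI1 less_le_trans zero_less_numeral)
  have card: "card ?I = 2 * n" by (simp add: card_cartesian_product)
  \<comment> \<open>This \<open>L\<close> depends on \<open>p\<close>, but it is used only through
    \<open>\<kappa>\<close>.\<close>
  obtain L :: nat where L: "\<And>v \<delta>. v \<in> mean_zero (Alt X) \<Longrightarrow>
      (\<forall>s\<in>{root_perm i e t | i e t. i < n \<and> e \<in> {1, 2}}. norm (lreg s v - v) \<le> \<delta>) \<Longrightarrow> norm v \<le> real L * \<delta>"
  proof -
    have bj: "bij s" if "s \<in> {root_perm i e t | i e t. i < n \<and> e \<in> {1, 2}}" for s
      using that root_bij by force
    show ?thesis using gen_perm_uniform_gap[OF G gen bj] that by blast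
  qed
  have rep: "cyc_rep p (\<lambda>t. lreg (root_perm i e t))" if "i < n" "e \<in> {1, 2}" for i e
    using that by (intro root_rep) auto
  let ?E = "\<lambda>v. \<Sum>i\<in>?I. (norm (v - ?P i v))\<^sup>2"
  have "norm v \<le> 4 * real (2 * n) * sqrt (?E v)"
  proof (rule oproj_family_gap[OF _ card _ _ _ r(4,1) subspace_mean_zero _ _ v, where \<kappa> = "4 * real L ^ 2"])
    show "oproj (?P i)" if "i \<in> ?I" for i
      using that rep by (auto simp: PR_def intro: avg_oproj)
    show "inner (v - ?P i v) (v - ?P j v) \<ge> - r * ((norm (v - ?P i v))\<^sup>2 + (norm (v - ?P j v))\<^sup>2)"
      if "i \<in> ?I" "j \<in> ?I" for i j v
      using that root_pair_angle[OF _ _ _ _ r(1-3)] by (cases i; cases j) auto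
    show "?P i v \<in> mean_zero (Alt X)" if "i \<in> ?I" "v \<in> mean_zero (Alt X)" for i v
      using that root_Alt unfolding PR_def avg_def
      by (auto intro!: subspace_scale subspace_sum subspace_mean_zero lreg_mean_zero[OF G])
    fix v assume v: "v \<in> mean_zero (Alt X)"
    have E0: "?E v \<ge> 0" by (intro sum_nonneg) auto
    have "norm (lreg (root_perm i e t) v - v) \<le> 2 * sqrt (?E v)" if ie: "i < n" "e \<in> {1, 2}" for i e t
    proof -
      let ?w = "v - PR i e v"
      have b: "bij (root_perm i e t)" using ie by (intro root_bij) auto
      have "lreg (root_perm i e t) (PR i e v) = PR i e v"
        unfolding PR_def by (rule avg_invariant[OF rep[OF ie]])
      then have eq: "lreg (root_perm i e t) v - v = lreg (root_perm i e t) ?w - ?w"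
        by (simp add: linear_diff[OF lreg_linear[OF b]])
      have "norm (lreg (root_perm i e t) v - v) \<le> norm (lreg (root_perm i e t) ?w) + norm ?w"
        unfolding eq by (rule norm_triangle_ineq4)
      then have "norm (lreg (root_perm i e t) v - v) \<le> 2 * norm ?w" by (simp only: lreg_norm[OF b] mult_2)
      moreover have "(norm ?w)\<^sup>2 \<le> ?E v"
        using member_le_sum[of "(i, e)" ?I "\<lambda>i. (norm (v - ?P i v))\<^sup>2"] ie by simp
      then have "norm ?w \<le> sqrt (?E v)" by (rule real_le_rsqrt)
      ultimately show ?thesis by linarith
    qed
    then have "norm v \<le> real L * (2 * sqrt (?E v))" using L[OF v] by blast
    then have "(norm v)\<^sup>2 \<le> (real L * (2 * sqrt (?E v)))\<^sup>2" by (intro power_mono) auto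
    then show "(norm v)\<^sup>2 \<le> 4 * real L ^ 2 * ?E v"
      using E0 by (simp add: power_mult_distrib)
  qed (use n in auto)
  also have "\<dots> \<le> 4 * real (2 * n) * (real (2 * n) * D)"
  proof (intro mult_left_mono, goal_cases)
    case 1
    show "sqrt (?E v) \<le> real (2 * n) * D"
  proof (rule real_le_lsqrt)
    have "?E v \<le> (\<Sum>i\<in>?I. D\<^sup>2)"
    proof (intro sum_mono power_mono)
      fix i assume "i \<in> ?I"
      then show "norm (v - ?P i v) \<le> D"
        using D rep by (auto simp: PR_def intro!: avg_defect_le)
    qed simp
    also have "\<dots> = real (2 * n) * D\<^sup>2" by (simp add: card)
    also have "\<dots> \<le> real (2 * n) * (real (2 * n) * D\<^sup>2)"
      using n by (intro mult_left_mono) (auto simp: mult_le_cancel_right1)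
    finally show "?E v \<le> (real (2 * n) * D)\<^sup>2" by (simp add: power2_eq_square mult_ac)
  qed (use D0 in \<open>auto intro!: sum_nonneg\<close>)
  qed simp
  finally show ?thesis by (simp add: power2_eq_square mult_ac)
qed

text \<open>The constant collects 16 n^2 from the energy argument, 14 from polarization, 20 from
  relative property (T), and 4^n from the chain of transvections.\<close>

theorem uniform_gap:
  assumes gen: "Alt X \<subseteq> gen_perm {root_perm i e t | i e t. i < n \<and> e \<in> {1, 2}}"
    and large: "p \<ge> 128 * int n ^ 2"
    and v: "v \<in> mean_zero (Alt X)"
    and s: "coprime s n" "\<And>i. i < n \<Longrightarrow> norm (lreg (el i (\<lambda>f. f ((i + s) mod n))) v - v) \<le> \<delta>"
    and sq: "\<And>i. i < n \<Longrightarrow> \<exists>j<n. j \<noteq> i \<and> norm (lreg (el i (\<lambda>f. (f j)\<^sup>2)) v - v) \<le> \<delta>"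
  shows "norm v \<le> 4480 * real n ^ 2 * 4 ^ n * \<delta>"
proof -
  define L where "L = 20 * (4 ^ n * \<delta>)"
  note lf = length_fun_displacement[of v]
  have tv: "norm (lreg (el i (\<lambda>f. f j)) v - v) \<le> 4 ^ n * \<delta>" if "i < n" "j < n" "i \<noteq> j" for i j
    using l_transvections[OF lf s(2) s(1) that] .
  have lin: "norm (lreg (el i (\<lambda>f. t * f j)) v - v) \<le> L" if ij: "i < n" "j < n" "i \<noteq> j" for i j t
  proof -
    obtain k where "k < n" "k \<noteq> i" "k \<noteq> j" by (rule third_index)
    then show ?thesis unfolding L_def using ij by (intro transvection_relative_T[of i j k] tv) auto
  qed
  have \<delta>0: "\<delta> \<ge> 0" using s(2)[of 0] n norm_ge_zero order_trans by (metis less_le_trans zero_less_numeral)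
  have "1 \<le> 20 * (4::real) ^ n" using one_le_power[of "4::real" n] by linarith
  from mult_right_mono[OF this \<delta>0] have "\<delta> \<le> L" by (simp add: L_def mult.assoc)
  have "norm (lreg (root_perm i e t) v - v) \<le> 14 * L" if ie: "i < n" "e \<in> {1, 2}" for i e t
  proof (cases "e = 1")
    case True
    have "L \<ge> 0" using \<delta>0 by (simp add: L_def)
    moreover have "norm (lreg (root_perm i e t) v - v) \<le> L"
      using lin[OF ie(1) succ(1)[OF ie(1)] succ(2)[OF ie(1), symmetric], of t] by (simp add: root_perm_def True)
    ultimately show ?thesis by linarith
  next
    case False
    then have "e = 2" using ie by simp
    obtain j where j: "j < n" "j \<noteq> i" "norm (lreg (el i (\<lambda>f. (f j)\<^sup>2)) v - v) \<le> \<delta>"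
      using sq[OF ie(1)] by blast
    have "norm (lreg (el i (\<lambda>f. t * (f (succ i))\<^sup>2)) v - v) \<le> 14 * L"
      using ie j succ(1,2)[OF ie(1)] \<open>\<delta> \<le> L\<close>
      by (intro l_quadratic[OF lf lin, of i j "succ i"]) auto
    then show ?thesis by (simp add: root_perm_def \<open>e = 2\<close>)
  qed
  from root_gap[OF gen large v this] show ?thesis by (simp add: L_def)
qed

end

section \<open>Three-cycles and the alternating group\<close>

lemma transpose_conj: assumes "bij g"
  shows "g \<circ> (transpose a b \<circ> transpose c d) \<circ> inv g = transpose (g a) (g b) \<circ> transpose (g c) (g d)"
proof -
  have t: "g \<circ> transpose a b = transpose (g a) (g b) \<circ> g" for a b
    using bij_is_inj[OF assms] by (auto simp: fun_eq_iff transpose_def inj_eq)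
  have "g \<circ> inv g = id" using assms by (simp add: bij_is_surj surj_iff[symmetric])
  then show ?thesis
    by (metis t comp_assoc comp_id)
qed

lemma transpose_triangle:
  assumes "a \<noteq> b" "a \<noteq> c" "b \<noteq> c"
  shows "transpose a b \<circ> transpose b c = transpose b c \<circ> transpose a c"
  using assms by (auto simp: fun_eq_iff transpose_def)

text \<open>A point other than \<open>x\<close> moved by one of the permutations is fixed by the
  other, so the commutator can move only \<open>x\<close>, \<open>a x\<close> and
  \<open>b x\<close>.\<close>

lemma commutator_three_cycle:
  assumes a: "bij a" and b: "bij b" and x: "a x \<noteq> x" "b x \<noteq> x"
    and one: "\<And>y. a y \<noteq> y \<Longrightarrow> b y \<noteq> y \<Longrightarrow> y = x"
  shows "a \<circ> b \<circ> inv a \<circ> inv b = transpose x (a x) \<circ> transpose (a x) (b x)"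
proof
  fix y
  have ia: "inv a (a z) = z" "a (inv a z) = z" and ib: "inv b (b z) = z" "b (inv b z) = z" for z
    using a b by (simp_all add: bij_is_inj bij_is_surj surj_f_inv_f)
  have fa: "inv a z = z" if "a z = z" for z using that ia by metis
  have fb: "inv b z = z" if "b z = z" for z using that ib by metis
  have ax: "b (a x) = a x" using one[of "a x"] x ia(1) by metis
  have bx: "a (b x) = b x" using one[of "b x"] x ib(1) by metis
  have ne: "a x \<noteq> b x" using ax x(2) ib(1) x(1) bx by metis
  consider "y = x" | "y = a x" | "y = b x" | "y \<noteq> x" "y \<noteq> a x" "y \<noteq> b x" by blast
  then show "(a \<circ> b \<circ> inv a \<circ> inv b) y = (transpose x (a x) \<circ> transpose (a x) (b x)) y"
  proof cases
    case 1
    have "a (inv b x) = inv b x" using one[of "inv b x"] x ib by metis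
    then show ?thesis using 1 x ne fa ib by (simp add: transpose_def)
  next
    case 2
    then show ?thesis using x ne fb[OF ax] ia bx by (simp add: transpose_def)
  next
    case 3
    have "b (inv a x) = inv a x" using one[of "inv a x"] x ia by metis
    then show ?thesis using 3 x ne ia ib by (simp add: transpose_def)
  next
    case 4
    have "a (b (inv a (inv b y))) = y"
    proof (cases "b y = y")
      case True
      then have e: "inv b y = y" by (rule fb)
      show ?thesis
      proof (cases "a y = y")
        case True
        then show ?thesis using e fa \<open>b y = y\<close> by simp
      next
        case False
        have "b (inv a y) = inv a y" using one[of "inv a y"] 4 False ia by metis
        then show ?thesis using e ia by simp
      qed
    next
      case False
      have 1: "a (inv b y) = inv b y" using one[of "inv b y"] 4 False ib by metis
      have "a y = y" using one[of y] 4 False by blast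
      then show ?thesis using fa[OF 1] ib by simp
    qed
    then show ?thesis using 4 by (simp add: transpose_def)
  qed
qed

text \<open>The product of the two transpositions is a 3-cycle on a, b, c, so edges join points
  lying on a common 3-cycle of \<open>G\<close>.\<close>

definition three_cycle_edge :: "'a set \<Rightarrow> ('a \<Rightarrow> 'a) set \<Rightarrow> ('a \<times> 'a) set" where
  "three_cycle_edge X G = {(a, b). a \<in> X \<and> b \<in> X \<and> a \<noteq> b \<and>
     (\<exists>c\<in>X. c \<noteq> a \<and> c \<noteq> b \<and> transpose a b \<circ> transpose b c \<in> G)}"

context
  fixes X :: "'a set" and G :: "('a \<Rightarrow> 'a) set"
  assumes G: "perm_group X G"
begin

text \<open>The transpositions (a b) and (c d) represent the same coset of \<open>G\<close>. The aim
  is that all transpositions fall into one class.\<close>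

definition sim :: "'a \<Rightarrow> 'a \<Rightarrow> 'a \<Rightarrow> 'a \<Rightarrow> bool" where
  "sim a b c d \<longleftrightarrow> transpose a b \<circ> transpose c d \<in> G"

lemma sim_refl: "sim a b a b"
  using perm_group_id[OF G] by (simp add: sim_def)

lemma sim_trans: "sim a b c d \<Longrightarrow> sim c d e f \<Longrightarrow> sim a b e f"
proof -
  assume "sim a b c d" "sim c d e f"
  then have "(transpose a b \<circ> transpose c d) \<circ> (transpose c d \<circ> transpose e f) \<in> G"
    unfolding sim_def by (rule perm_group_comp[OF G])
  moreover have "(transpose a b \<circ> transpose c d) \<circ> (transpose c d \<circ> transpose e f) = transpose a b \<circ> transpose e f"
    by (simp add: fun_eq_iff)
  ultimately show ?thesis by (simp add: sim_def)
qed

lemma sim_sym: "sim a b c d \<Longrightarrow> sim c d a b"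
proof -
  assume "sim a b c d"
  then have "inv (transpose a b \<circ> transpose c d) \<in> G"
    unfolding sim_def by (rule perm_group_inv[OF G])
  then show ?thesis by (simp add: sim_def o_inv_distrib)
qed

lemma sim_swap: "sim a b c d \<longleftrightarrow> sim b a c d" "sim a b c d \<longleftrightarrow> sim a b d c"
  by (simp_all add: sim_def transpose_commute)

lemma sim_conj: "g \<in> G \<Longrightarrow> sim a b c d \<Longrightarrow> sim (g a) (g b) (g c) (g d)"
  unfolding sim_def
  by (subst transpose_conj[symmetric])
    (auto intro: perm_group_comp[OF G] perm_group_inv[OF G] perm_group_bij[OF G])

lemma sim_triangle:
  assumes "a \<noteq> b" "a \<noteq> c" "b \<noteq> c" "sim a b b c"
  shows "sim b c a c" "sim a b a c"
proof -
  show "sim b c a c" using assms transpose_triangle[of a b c] by (simp add: sim_def)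
  with assms(4) show "sim a b a c" by (rule sim_trans)
qed

abbreviation "E \<equiv> three_cycle_edge X G"

lemma E_iff: "(a, b) \<in> E \<longleftrightarrow> a \<in> X \<and> b \<in> X \<and> a \<noteq> b \<and> (\<exists>c\<in>X. c \<noteq> a \<and> c \<noteq> b \<and> sim a b b c)"
  by (auto simp: three_cycle_edge_def sim_def)

lemma E_sym: "(a, b) \<in> E \<Longrightarrow> (b, a) \<in> E"
  unfolding E_iff by (metis sim_swap sim_triangle)

lemma E_sim:
  assumes "(a, b) \<in> E" "(a, d) \<in> E" shows "sim a b a d"
proof (cases "b = d")
  case False
  from assms(1) obtain c where c: "a \<noteq> b" "c \<noteq> a" "c \<noteq> b" "sim a b b c" unfolding E_iff by blast
  from assms(2) obtain e where e: "a \<noteq> d" "e \<noteq> a" "e \<noteq> d" "sim a d d e" unfolding E_iff by blast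
  have c': "sim b c a c" "sim a b a c" using sim_triangle c by metis+
  have e': "sim d e a e" "sim a d a e" using sim_triangle e by metis+
  consider "c = d" | "e = b" | "c = e" | "c \<noteq> d" "e \<noteq> b" "c \<noteq> e" by blast
  then show ?thesis
  proof cases
    case 1
    then show ?thesis using c' by simp
  next
    case 2
    then show ?thesis using e' sim_sym by simp
  next
    case 3
    then show ?thesis using c' e' by (metis sim_sym sim_trans)
  next
    case 4
    \<comment> \<open>The two 3-cycles share only \<open>a\<close>. Conjugating the relation of each
      by the other moves \<open>a\<close> to \<open>d\<close> or to \<open>b\<close>, which links
      both classes with that of (b d).\<close>
    have "transpose a d \<circ> transpose d e \<in> G" "transpose a b \<circ> transpose b c \<in> G"
      using c e by (simp_all add: sim_def)
    from sim_conj[OF this(1) c(4)] sim_conj[OF this(2) e(4)]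
    have "sim d b b c" "sim b d d e"
      using c e 4 False by (simp_all add: transpose_def split: if_splits)
    then have "sim a b d b" "sim d b d e" using c(4) by (metis sim_sym sim_trans, metis sim_swap)
    then show ?thesis using e(4) by (metis sim_sym sim_trans)
  qed
qed (simp add: sim_refl)

lemma E_trans: assumes "(a, b) \<in> E" "(b, d) \<in> E" "a \<noteq> d" shows "(a, d) \<in> E"
proof -
  have "sim b a b d" by (rule E_sim[OF E_sym[OF assms(1)] assms(2)])
  then have s: "sim a b b d" using sim_swap by metis
  have ne: "a \<noteq> b" "b \<noteq> d" "a \<in> X" "b \<in> X" "d \<in> X" using assms unfolding E_iff by auto
  have "sim a d d b" using sim_triangle(1)[OF ne(1) assms(3) ne(2) s] by (metis sim_sym sim_swap(2))
  then show ?thesis unfolding E_iff using ne assms(3) by metis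
qed

lemma E_rtrancl: "(a, b) \<in> E\<^sup>* \<Longrightarrow> a = b \<or> (a, b) \<in> E"
  by (induction rule: rtrancl_induct) (use E_trans in blast)+

text \<open>By \<open>E_trans\<close> a connected graph is complete, so any product of two
  transpositions lies in \<open>G\<close>. The induction over factorizations carries one spare
  transposition for odd permutations.\<close>

lemma Alt_subset_of_connected:
  assumes conn: "\<And>a. a \<in> X \<Longrightarrow> (a, x0) \<in> E\<^sup>*"
  shows "Alt X \<subseteq> G"
proof -
  have E: "(a, b) \<in> E" if "a \<in> X" "b \<in> X" "a \<noteq> b" for a b
  proof -
    have "(x0, b) \<in> E\<^sup>*"
      using conn[OF that(2)] by (metis E_sym converse_iff rtrancl_converseI symD sym_conv_converse_eq sym_def)
    then have "(a, b) \<in> E\<^sup>*" using conn[OF that(1)] by (rule rtrancl_trans[rotated])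
    then show ?thesis using E_rtrancl that by blast
  qed
  have S1: "sim a b a d" if "a \<in> X" "b \<in> X" "d \<in> X" "a \<noteq> b" "a \<noteq> d" for a b d
    using E_sim E that by blast
  have S: "sim a b c d" if "a \<in> X" "b \<in> X" "a \<noteq> b" "c \<in> X" "d \<in> X" "c \<noteq> d" for a b c d
  proof (cases "a = c")
    case True
    then show ?thesis using S1 that by simp
  next
    case False
    have "sim a b a c" using S1 that False by blast
    moreover have "sim c a c d" using S1 that False by blast
    ultimately show ?thesis by (metis sim_swap(1) sim_swap(2) sim_trans)
  qed
  have finX: "finite X" using G by (simp add: perm_group_def)
  have perm: "permutation f" if "f permutes X" for f
    using that finX permutation_permutes by blast
  have "(evenperm f \<longrightarrow> f \<in> G) \<and> (\<not> evenperm f \<longrightarrow> (\<forall>c\<in>X. \<forall>d\<in>X. c \<noteq> d \<longrightarrow> transpose c d \<circ> f \<in> G))"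
    if "f permutes X" for f
    using that finX
  proof (induction rule: permutes_induct)
    case id
    then show ?case using perm_group_id[OF G] by (simp add: id_def)
  next
    case (swap a b q)
    show ?case
    proof (cases "a = b")
      case True
      then show ?thesis using swap by simp
    next
      case False
      have ev: "evenperm (transpose a b \<circ> q) \<longleftrightarrow> \<not> evenperm q"
        using evenperm_comp[of "transpose a b" q] perm[OF swap(4)] False
        by (simp add: permutation_swap_id evenperm_swap)
      have "transpose c d \<circ> (transpose a b \<circ> q) \<in> G" if "evenperm q" "c \<in> X" "d \<in> X" "c \<noteq> d" for c d
        using perm_group_comp[OF G, of "transpose c d \<circ> transpose a b" q] S[of c d a b] swap False that
        by (simp add: sim_def comp_assoc)
      then show ?thesis using ev swap False by blast
    qed
  qed
  then show ?thesis by (auto simp: Alt_def)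
qed

end

section \<open>Generating the alternating group\<close>

definition restr :: "nat set \<Rightarrow> (nat \<Rightarrow> int) \<Rightarrow> nat \<Rightarrow> int" where
  "restr S f = (\<lambda>i. if i \<in> S then f i else 0)"

text \<open>The coordinates outside \<open>S\<close> are spectators. A permutation of the nonzero
  vectors on \<open>S\<close> fixes 0, so vectors vanishing on \<open>S\<close> stay put.\<close>

definition extend :: "nat set \<Rightarrow> ((nat \<Rightarrow> int) \<Rightarrow> nat \<Rightarrow> int) \<Rightarrow> (nat \<Rightarrow> int) \<Rightarrow> nat \<Rightarrow> int" where
  "extend S g f = (\<lambda>i. if i \<in> S then g (restr S f) i else f i)"

lemma (in coords) scale_in_perm_group:
  assumes G: "perm_group X G" and h: "adm i h" "el i h \<in> G"
  shows "el i (\<lambda>f. t * h f) \<in> G"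
proof -
  have "el i h ^^ k \<in> G" for k
  proof (induction k)
    case 0
    show ?case unfolding funpow_0 funpow.simps(1) by (rule perm_group_id[OF G])
  next
    case (Suc k)
    show ?case unfolding funpow.simps(2) by (rule perm_group_comp[OF G h(2) Suc])
  qed
  then have "el i (\<lambda>f. int k * h f) \<in> G" for k by (simp add: el_funpow[OF h(1)])
  from this[of "nat (t mod p)"] have "el i (\<lambda>f. (t mod p) * h f) \<in> G" using p_gt1 by simp
  moreover have "el i (\<lambda>f. (t mod p) * h f) = el i (\<lambda>f. t * h f)"
    by (rule el_cong) (simp add: mod_mult_left_eq)
  ultimately show ?thesis by simp
qed

locale coords_group = coords +
  fixes G :: "('a \<Rightarrow> 'a) set"
  assumes G: "perm_group X G"
    and transvection_in_G: "\<And>i j. i < n \<Longrightarrow> j < n \<Longrightarrow> i \<noteq> j \<Longrightarrow> el i (\<lambda>f. f j) \<in> G"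
    and square_in_G: "\<And>i j. i < n \<Longrightarrow> j < n \<Longrightarrow> i \<noteq> j \<Longrightarrow> el i (\<lambda>f. (f j)\<^sup>2) \<in> G"
begin

section \<open>Shears by polynomials and by indicators\<close>

lemma add_in_G: "adm i h \<Longrightarrow> adm i h' \<Longrightarrow> el i h \<in> G \<Longrightarrow> el i h' \<in> G \<Longrightarrow> el i (\<lambda>f. h f + h' f) \<in> G"
  by (metis el_add perm_group_comp[OF G])

lemma diff_in_G: "adm i h \<Longrightarrow> adm i h' \<Longrightarrow> el i h \<in> G \<Longrightarrow> el i h' \<in> G \<Longrightarrow> el i (\<lambda>f. h f - h' f) \<in> G"
  using add_in_G[of i h "\<lambda>f. - h' f"] el_inv[of i h'] perm_group_inv[OF G, of "el i h'"] adm_neg[of i h'] by simp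

lemma scale_in_G: "adm i h \<Longrightarrow> el i h \<in> G \<Longrightarrow> el i (\<lambda>f. t * h f) \<in> G"
  by (rule scale_in_perm_group[OF G])

lemma subst_in_G:
  assumes "adm i h" "adm j k" "i \<noteq> j" "\<And>f a. k (f(i := a)) = k f" "el i h \<in> G" "el j k \<in> G"
  shows "el i (\<lambda>f. h (ef j k f)) \<in> G"
  using el_conj[OF assms(1-4)] assms(5,6) perm_group_comp[OF G] perm_group_inv[OF G] by metis

text \<open>Polarization of the square, followed by division by 2 modulo \<open>p\<close>.\<close>

lemma product_in_G:
  assumes "i < n" "j < n" "k < n" "i \<noteq> j" "i \<noteq> k" "j \<noteq> k"
  shows "el i (\<lambda>f. f j * f k) \<in> G"
proof -
  have "\<not> p dvd 2" using p_ge3 zdvd_not_zless by fastforce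
  then obtain e where e: "(2 * e) mod p = 1" using mod_inverse_exists[OF p(1)] by blast
  have a: "adm i (\<lambda>f. (f j)\<^sup>2)" "adm i (\<lambda>f. (f k)\<^sup>2)" using assms by (auto intro!: adm_power adm_coord)
  have aj: "adm j (\<lambda>f. f k)" using assms by (intro adm_coord) auto
  have s: "el i (\<lambda>f. (ef j (\<lambda>f. f k) f j)\<^sup>2) \<in> G"
    by (rule subst_in_G[OF a(1) aj]) (use assms square_in_G transvection_in_G in auto)
  have s': "adm i (\<lambda>f. (ef j (\<lambda>f. f k) f j)\<^sup>2)"
    by (rule adm_subst[OF a(1) aj]) (use assms in auto)
  have d: "el i (\<lambda>f. (ef j (\<lambda>f. f k) f j)\<^sup>2 - (f j)\<^sup>2 - (f k)\<^sup>2) \<in> G"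
    "adm i (\<lambda>f. (ef j (\<lambda>f. f k) f j)\<^sup>2 - (f j)\<^sup>2 - (f k)\<^sup>2)"
    using assms square_in_G by (intro diff_in_G adm_diff a s s'; simp)+
  have "el i (\<lambda>f. e * ((ef j (\<lambda>f. f k) f j)\<^sup>2 - (f j)\<^sup>2 - (f k)\<^sup>2)) = el i (\<lambda>f. f j * f k)"
  proof (rule el_cong)
    fix f
    have "(e * ((ef j (\<lambda>f. f k) f j)\<^sup>2 - (f j)\<^sup>2 - (f k)\<^sup>2)) mod p = (e * ((f j + f k) * (f j + f k) - (f j)\<^sup>2 - (f k)\<^sup>2)) mod p"
      unfolding power2_eq_square[of "ef _ _ _ _"]
      by (intro mod_mult_cong mod_diff_cong refl) (simp_all add: ef_def)
    also have "e * ((f j + f k) * (f j + f k) - (f j)\<^sup>2 - (f k)\<^sup>2) = (2 * e) * (f j * f k)"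
      by (simp add: power2_eq_square algebra_simps)
    also have "\<dots> mod p = (1 * (f j * f k)) mod p" using e p_gt1 by (intro mod_mult_cong) auto
    finally show "(e * ((ef j (\<lambda>f. f k) f j)\<^sup>2 - (f j)\<^sup>2 - (f k)\<^sup>2)) mod p = (f j * f k) mod p" by simp
  qed
  then show ?thesis using scale_in_G[OF d(2,1), of e] by simp
qed

text \<open>Substituting x_j + x_k^m for x_j in the product x_j x_k adds x_k^(m+1); the auxiliary
  index j is a third one.\<close>

lemma monomial_in_G: "i < n \<Longrightarrow> k < n \<Longrightarrow> i \<noteq> k \<Longrightarrow> el i (\<lambda>f. f k ^ Suc m) \<in> G"
proof (induction m arbitrary: i)
  case 0
  then show ?case using transvection_in_G by simp
next
  case (Suc m)
  obtain j where j: "j < n" "j \<noteq> i" "j \<noteq> k" by (rule third_index)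
  have a1: "adm i (\<lambda>f. f j * f k)" by (intro adm_mult adm_coord) (use Suc.prems j in auto)
  have a2: "adm j (\<lambda>f. f k ^ Suc m)" by (rule adm_power, rule adm_coord) (use Suc.prems j in auto)
  note a = a1 a2
  have m: "el i (\<lambda>f. f j * f k) \<in> G" using Suc.prems j by (intro product_in_G) auto
  have ki: "(f(i := x)) k ^ Suc m = f k ^ Suc m" for f :: "nat \<Rightarrow> int" and x using Suc.prems by simp
  have ij: "i \<noteq> j" using j by simp
  have "el i (\<lambda>f. ef j (\<lambda>f. f k ^ Suc m) f j * ef j (\<lambda>f. f k ^ Suc m) f k - f j * f k) \<in> G"
    by (rule diff_in_G[OF adm_subst[OF a ij ki] a(1) subst_in_G[OF a ij ki m] m]) (use Suc j in auto)
  moreover have "el i (\<lambda>f. ef j (\<lambda>f. f k ^ Suc m) f j * ef j (\<lambda>f. f k ^ Suc m) f k - f j * f k) = el i (\<lambda>f. f k ^ Suc (Suc m))"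
  proof (rule el_cong)
    fix f
    have ek: "ef j (\<lambda>f. f k ^ Suc m) f k = f k" using j by (simp add: ef_def)
    have "(ef j (\<lambda>f. f k ^ Suc m) f j * ef j (\<lambda>f. f k ^ Suc m) f k - f j * f k) mod p = ((f j + f k ^ Suc m) * f k - f j * f k) mod p"
      unfolding ek by (intro mod_mult_cong mod_diff_cong refl) (simp add: ef_def)
    then show "(ef j (\<lambda>f. f k ^ Suc m) f j * ef j (\<lambda>f. f k ^ Suc m) f k - f j * f k) mod p = f k ^ Suc (Suc m) mod p"
      by (simp add: algebra_simps)
  qed
  ultimately show ?case by simp
qed

lemma polynomial_in_G:
  assumes "i < n" "k < n" "i \<noteq> k"
  shows "el i (\<lambda>f. f k ^ Suc m * poly q (f k)) \<in> G"
proof (induction q arbitrary: m)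
  case 0
  have "el i (\<lambda>f. f k ^ Suc m * poly 0 (f k)) = id" by (rule el_zero) simp
  then show ?case using perm_group_id[OF G] by (simp only:)
next
  case (pCons a q)
  have adm: "adm i (\<lambda>f. f k ^ Suc m)" for m using assms by (intro adm_power adm_coord) auto
  have adm': "adm i (\<lambda>f. f k ^ Suc (Suc m) * poly q (f k))"
    using assms adm[of "Suc m"] by (auto simp: adm_def)
  have "el i (\<lambda>f. a * f k ^ Suc m + f k ^ Suc (Suc m) * poly q (f k)) \<in> G"
    by (intro add_in_G adm_scale adm adm' scale_in_G monomial_in_G assms pCons)
  moreover have "(\<lambda>f. a * f k ^ Suc m + f k ^ Suc (Suc m) * poly q (f k)) = (\<lambda>f. f k ^ Suc m * poly (pCons a q) (f k))"
    by (auto simp: algebra_simps)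
  ultimately show ?case by simp
qed

definition \<delta> :: "nat \<Rightarrow> int \<Rightarrow> (nat \<Rightarrow> int) \<Rightarrow> int" where
  "\<delta> k a f = (if f k = a then 1 else 0)"

lemma \<delta>_adm: "i < n \<Longrightarrow> i \<noteq> k \<Longrightarrow> a \<noteq> 0 \<Longrightarrow> adm i (\<delta> k a)"
  by (auto simp: adm_def \<delta>_def)

text \<open>Lagrange interpolation. Since a is not 0, the interpolating polynomial vanishes at 0,
  has no constant term, and is covered by \<open>polynomial_in_G\<close>.\<close>

lemma \<delta>_in_G:
  assumes ik: "i < n" "k < n" "i \<noteq> k" and a: "0 < a" "a < p"
  shows "el i (\<delta> k a) \<in> G"
proof -
  define q where "q = (\<Prod>b\<in>{1..<p} - {a}. [:- b, 1:])"
  have q: "poly q x = (\<Prod>b\<in>{1..<p} - {a}. x - b)" for x by (simp add: q_def poly_prod)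
  have nd: "\<not> p dvd a * poly q a"
  proof
    assume "p dvd a * poly q a"
    then have "p dvd a \<or> (\<exists>b\<in>{1..<p} - {a}. p dvd a - b)"
      unfolding q using p(1) by (simp add: prime_dvd_mult_iff prime_dvd_prod_iff)
    then consider "p dvd a" | b where "b \<in> {1..<p} - {a}" "p dvd a - b" by blast
    then show False
    proof cases
      case 1
      then show False using a zdvd_not_zless by blast
    next
      case 2
      from 2(2) have "a mod p = b mod p" by (simp only: mod_eq_dvd_iff)
      moreover have "b mod p = b" "a mod p = a" using 2(1) a by simp_all
      ultimately have "a = b" by metis
      then show False using 2(1) by simp
    qed
  qed
  obtain e where e: "(a * poly q a * e) mod p = 1" using mod_inverse_exists[OF p(1) nd] by blast
  have adm: "adm i (\<lambda>f. f k ^ Suc 0 * poly q (f k))" using ik by (auto simp: adm_def)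
  have "el i (\<lambda>f. e * (f k ^ Suc 0 * poly q (f k))) = el i (\<delta> k a)"
  proof (rule el_cong)
    fix f assume f: "f \<in> Y"
    show "(e * (f k ^ Suc 0 * poly q (f k))) mod p = \<delta> k a f mod p"
    proof (cases "f k = a")
      case True
      then show ?thesis using e p_gt1 by (simp add: \<delta>_def mult.commute)
    next
      case False
      have "0 \<le> f k" "f k < p" using f ik by (auto simp: nonzero_vectors_def)
      then have "f k ^ Suc 0 * poly q (f k) = 0" using False
        by (cases "f k = 0") (auto simp: q intro!: prod_zero)
      then show ?thesis unfolding \<open>f k ^ Suc 0 * poly q (f k) = 0\<close> using False by (simp add: \<delta>_def)
    qed
  qed
  then show ?thesis using scale_in_G[OF adm polynomial_in_G[OF ik], of e] by simp
qed

section \<open>Induction on the set of active coordinates\<close>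

definition YS :: "nat set \<Rightarrow> (nat \<Rightarrow> int) set" where
  "YS S = {f \<in> Y. \<forall>i. i \<notin> S \<longrightarrow> f i = 0}"

text \<open>Permutations of the punctured space over \<open>S\<close> that \<open>G\<close> realises
  simultaneously for all values of the other coordinates. This uniformity makes them usable inside
  larger sets of coordinates.\<close>

definition KS :: "nat set \<Rightarrow> ((nat \<Rightarrow> int) \<Rightarrow> nat \<Rightarrow> int) set" where
  "KS S = {g. g permutes YS S \<and> lift (extend S g) \<in> G}"

lemma YS_I:
  assumes "S \<subseteq> {..<n}" "\<And>i. i \<in> S \<Longrightarrow> 0 \<le> f i \<and> f i < p" "\<And>i. i \<notin> S \<Longrightarrow> f i = 0" "\<exists>i\<in>S. f i \<noteq> 0"
  shows "f \<in> YS S"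
proof -
  have "f \<in> Y"
  proof (rule Y_I)
    show "0 \<le> f i \<and> f i < p" for i using assms(2,3)[of i] p_gt1 by (cases "i \<in> S") auto
    show "f i = 0" if "i \<ge> n" for i using that assms(1) by (intro assms(3)) auto
  qed (use assms(4) in auto)
  then show ?thesis using assms(3) by (simp add: YS_def)
qed

lemma YS_D:
  assumes "f \<in> YS S"
  shows "0 \<le> f i" "f i < p" "i \<notin> S \<Longrightarrow> f i = 0" "\<exists>i\<in>S. f i \<noteq> 0" "f \<in> Y"
proof -
  show f: "f \<in> Y" and z: "i \<notin> S \<Longrightarrow> f i = 0" for i using assms by (auto simp: YS_def)
  show "0 \<le> f i" "f i < p" using f p_gt1 by (cases "i < n"; auto simp: nonzero_vectors_def)+
  show "\<exists>i\<in>S. f i \<noteq> 0" using f z by (auto simp: nonzero_vectors_def fun_eq_iff)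
qed

lemma restr_YS: assumes "S \<subseteq> {..<n}" "f \<in> Y" shows "restr S f = (\<lambda>_. 0) \<or> restr S f \<in> YS S"
proof (cases "\<exists>i\<in>S. f i \<noteq> 0")
  case True
  then have "restr S f \<in> YS S"
    using assms by (intro YS_I) (auto simp: restr_def nonzero_vectors_def)
  then show ?thesis by simp
qed (auto simp: restr_def)

context
  fixes S assumes S: "S \<subseteq> {..<n}"
begin

lemma perm_zero: "g permutes YS S \<Longrightarrow> g (\<lambda>_. 0) = (\<lambda>_. 0)"
  by (rule permutes_not_in) (auto simp: YS_def nonzero_vectors_def)

lemma perm_outside: "g permutes YS S \<Longrightarrow> f \<in> Y \<Longrightarrow> i \<notin> S \<Longrightarrow> g (restr S f) i = 0"
  using restr_YS[OF S, of f] perm_zero[of g] YS_D(3)[of "g (restr S f)"] permutes_in_image[of g "YS S"] by metis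

lemma restr_ext: "g permutes YS S \<Longrightarrow> f \<in> Y \<Longrightarrow> restr S (extend S g f) = g (restr S f)"
  unfolding restr_def[of S "extend S g f"] using perm_outside by (auto simp: extend_def fun_eq_iff)

lemma ext_Y: assumes g: "g permutes YS S" and f: "f \<in> Y" shows "extend S g f \<in> Y"
proof (cases "restr S f = (\<lambda>_. 0)")
  case True
  then have "extend S g f = f"
    unfolding extend_def using perm_zero[OF g] by (auto simp: fun_eq_iff restr_def split: if_splits)
  then show ?thesis using f by simp
next
  case False
  then have "restr S f \<in> YS S" using restr_YS[OF S f] by blast
  then have w: "g (restr S f) \<in> YS S" using permutes_in_image[OF g] by blast
  show ?thesis
  proof (rule Y_I)
    show "0 \<le> extend S g f i \<and> extend S g f i < p" if "i < n" for i
      using YS_D(1,2)[OF w] f that by (auto simp: extend_def nonzero_vectors_def)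
    show "extend S g f i = 0" if "i \<ge> n" for i using S f that by (auto simp: extend_def nonzero_vectors_def)
    show "extend S g f \<noteq> (\<lambda>_. 0)" using YS_D(4)[OF w] by (auto simp: extend_def fun_eq_iff split: if_splits)
  qed
qed

lemma ext_comp:
  assumes "g permutes YS S" "g' permutes YS S" "f \<in> Y"
  shows "extend S g (extend S g' f) = extend S (g \<circ> g') f"
  unfolding extend_def[of S g "extend S g' f"] extend_def[of S "g \<circ> g'"] restr_ext[OF assms(2,3)]
  by (auto simp: extend_def fun_eq_iff)

lemma ext_id: assumes "f \<in> Y" shows "extend S id f = f"
  by (auto simp: extend_def restr_def)

lemma lift_ext_comp:
  assumes "g permutes YS S" "g' permutes YS S"
  shows "lift (extend S g) \<circ> lift (extend S g') = lift (extend S (g \<circ> g'))"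
proof -
  have "lift (extend S g) \<circ> lift (extend S g') = lift (extend S g \<circ> extend S g')"
    by (rule lift_comp) (rule ext_Y[OF assms(2)])
  also have "\<dots> = lift (extend S (g \<circ> g'))"
    by (rule lift_cong) (simp add: ext_comp assms)
  finally show ?thesis .
qed

lemma lift_ext_inv:
  assumes g: "g permutes YS S"
  shows "lift (extend S g) permutes X" "inv (lift (extend S g)) = lift (extend S (inv g))"
proof -
  have i: "inv g permutes YS S" "g \<circ> inv g = id" "inv g \<circ> g = id"
    using g permutes_inv permutes_inv_o by auto
  show "lift (extend S g) permutes X" "inv (lift (extend S g)) = lift (extend S (inv g))"
    by (rule lift_permutes[of "extend S g" "extend S (inv g)"]; simp add: ext_Y ext_comp g i ext_id)+
qed

lemma KS_group: "perm_group (YS S) (KS S)"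
  unfolding perm_group_def
proof (intro conjI ballI)
  show "finite (YS S)" by (rule finite_subset[OF _ finite_nonzero_vectors]) (auto simp: YS_def)
  have "lift (extend S id) = id" by (rule lift_id) (rule ext_id)
  then show "id \<in> KS S" using perm_group_id[OF G] permutes_id by (simp add: KS_def)
next
  fix g assume "g \<in> KS S"
  then show "g permutes YS S" "inv g \<in> KS S"
    using lift_ext_inv(2)[of g] perm_group_inv[OF G] permutes_inv by (auto simp: KS_def) metis
next
  fix g g' assume "g \<in> KS S" "g' \<in> KS S"
  then show "g \<circ> g' \<in> KS S"
    using lift_ext_comp[of g g'] perm_group_comp[OF G] permutes_compose[of g' "YS S" g] by (auto simp: KS_def) metis
qed

text \<open>An element touching only \<open>S\<close>-coordinates commutes with changes of x_i, so
  conjugating a shear by it just composes the function of the shear with it.\<close>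

lemma ext_conj:
  assumes g: "g \<in> KS S" and i: "i < n" "i \<notin> S" and h: "adm i h" "el i h \<in> G"
  shows "adm i (\<lambda>f. h (extend S g f))" "el i (\<lambda>f. h (extend S g f)) \<in> G"
proof -
  have gp: "g permutes YS S" and gG: "lift (extend S g) \<in> G" using g by (auto simp: KS_def)
  have upd: "extend S g (f(i := a)) = (extend S g f)(i := a)" for f a
  proof -
    have "restr S (f(i := a)) = restr S f" using i by (auto simp: restr_def)
    then show ?thesis using i by (auto simp: extend_def)
  qed
  have "extend S g (\<lambda>_. 0) = (\<lambda>_. 0)"
    using perm_zero[OF gp] by (auto simp: extend_def restr_def)
  then show a: "adm i (\<lambda>f. h (extend S g f))"
    using h(1) i by (simp add: adm_def upd)
  have e: "ef i h \<circ> extend S g = extend S g \<circ> ef i (\<lambda>f. h (extend S g f))"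
  proof
    fix f
    have "extend S g f i = f i" using i by (simp add: extend_def)
    then show "(ef i h \<circ> extend S g) f = (extend S g \<circ> ef i (\<lambda>f. h (extend S g f))) f"
      by (simp add: ef_def upd)
  qed
  have comm: "el i h \<circ> lift (extend S g) = lift (extend S g) \<circ> el i (\<lambda>f. h (extend S g f))"
  proof -
    have "lift (ef i h) \<circ> lift (extend S g) = lift (ef i h \<circ> extend S g)"
      by (rule lift_comp) (rule ext_Y[OF gp])
    moreover have "lift (extend S g) \<circ> lift (ef i (\<lambda>f. h (extend S g f))) = lift (extend S g \<circ> ef i (\<lambda>f. h (extend S g f)))"
      by (rule lift_comp) (rule ef_Y[OF a])
    ultimately show ?thesis unfolding el_def by (simp only: e)
  qed
  have "el i (\<lambda>f. h (extend S g f)) = inv (lift (extend S g)) \<circ> (el i h \<circ> lift (extend S g))"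
    by (simp only: comm perm_group_cancel(1)[OF G gG])
  then show "el i (\<lambda>f. h (extend S g f)) \<in> G"
    using h(2) gG perm_group_comp[OF G] perm_group_inv[OF G] by simp
qed

definition ind :: "(nat \<Rightarrow> int) \<Rightarrow> (nat \<Rightarrow> int) \<Rightarrow> int" where
  "ind P f = (if restr S f = P then 1 else 0)"

text \<open>Conjugate x_i += x_k by a 3-cycle P -> Q -> R -> P on the \<open>S\<close>-coordinates
  and divide by the original: what is added is the change of coordinate k. If R agrees with P at k,
  this change is d at P, -d at Q and 0 at R.\<close>

lemma difference_in_G:
  assumes K: "Alt (YS S) \<subseteq> KS S" and card: "card S \<ge> 2"
    and i: "i < n" "i \<notin> S" and PQ: "P \<in> YS S" "Q \<in> YS S" "P \<noteq> Q"
  shows "adm i (\<lambda>f. t * (ind P f - ind Q f))" "el i (\<lambda>f. t * (ind P f - ind Q f)) \<in> G"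
proof -
  obtain k where k: "k \<in> S" "P k \<noteq> Q k"
    using PQ by (metis YS_D(3) ext)
  obtain l where l: "l \<in> S" "l \<noteq> k"
    using exists_not_in[of "{k}" S] card by auto
  \<comment> \<open>A nonzero residue other than \<open>P l\<close>, available since p >= 3; being
    nonzero it keeps \<open>R\<close> away from the origin.\<close>
  define v :: int where "v = (if P l = 1 then 2 else 1)"
  define R where "R = P(l := v)"
  have R: "R \<in> YS S" "R \<noteq> P" "R \<noteq> Q" "R k = P k"
  proof -
    show "R \<in> YS S"
      using YS_D(1-3)[OF PQ(1)] p_ge3 l by (intro YS_I[OF S]) (auto simp: R_def v_def)
    have "R l \<noteq> P l" by (simp add: R_def v_def)
    then show "R \<noteq> P" by auto
    show "R k = P k" using l by (simp add: R_def)
    then show "R \<noteq> Q" using k by auto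
  qed
  define g where "g = transpose P Q \<circ> transpose Q R"
  have "g \<in> Alt (YS S)"
    unfolding g_def Alt_def using PQ R
    by (auto simp: evenperm_comp permutation_swap_id evenperm_swap intro!: permutes_compose permutes_swap_id)
  then have g: "g \<in> KS S" using K by blast
  have kn: "k < n" "i \<noteq> k" using k S i by auto
  have a: "adm i (\<lambda>f. f k)" using kn i by (intro adm_coord) auto
  have aa: "adm i (\<lambda>f. extend S g f k - f k)" and aG: "el i (\<lambda>f. extend S g f k - f k) \<in> G"
    using ext_conj[OF g i a transvection_in_G[OF i(1) kn]] a transvection_in_G[OF i(1) kn]
    by (auto intro: adm_diff diff_in_G)
  define d where "d = Q k - P k"
  have val: "extend S g f k - f k = d * (ind P f - ind Q f)" for f
  proof -
    have "f k = restr S f k" "extend S g f k = g (restr S f) k" using k by (auto simp: restr_def extend_def)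
    then show ?thesis
      using PQ(3) R(2-4) by (auto simp: ind_def g_def d_def transpose_def)
  qed
  have nd: "\<not> p dvd d"
  proof
    assume "p dvd d"
    then have "Q k mod p = P k mod p" by (simp add: d_def mod_eq_dvd_iff)
    then show False using k YS_D(5)[OF PQ(1)] YS_D(5)[OF PQ(2)] Y_mod by metis
  qed
  obtain e where e: "(d * e) mod p = 1" using mod_inverse_exists[OF p(1) nd] by blast
  show "adm i (\<lambda>f. t * (ind P f - ind Q f))"
  proof -
    have "ind P (f(i := a)) = ind P f" for P f a
    proof -
      have "restr S (f(i := a)) = restr S f" using i by (auto simp: restr_def)
      then show ?thesis by (simp add: ind_def)
    qed
    moreover have "restr S (\<lambda>_. 0) = (\<lambda>_. 0)" by (simp add: restr_def)
    then have "ind P (\<lambda>_. 0) = 0" "ind Q (\<lambda>_. 0) = 0"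
      using YS_D(4)[OF PQ(1)] YS_D(4)[OF PQ(2)] by (auto simp: ind_def)
    ultimately show ?thesis using i by (simp add: adm_def)
  qed
  have "el i (\<lambda>f. (t * e) * (extend S g f k - f k)) = el i (\<lambda>f. t * (ind P f - ind Q f))"
  proof (rule el_cong)
    fix f
    have "(t * e) * (extend S g f k - f k) = (d * e) * (t * (ind P f - ind Q f))"
      unfolding val by (simp add: mult_ac)
    also have "\<dots> mod p = (1 * (t * (ind P f - ind Q f))) mod p" using e p_gt1 by (intro mod_mult_cong) auto
    finally show "(t * e) * (extend S g f k - f k) mod p = t * (ind P f - ind Q f) mod p" by simp
  qed
  then show "el i (\<lambda>f. t * (ind P f - ind Q f)) \<in> G"
    using scale_in_G[OF aa aG, of "t * e"] by simp
qed

definition eS :: "nat \<Rightarrow> ((nat \<Rightarrow> int) \<Rightarrow> int) \<Rightarrow> (nat \<Rightarrow> int) \<Rightarrow> nat \<Rightarrow> int" where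
  "eS i h f = (if f \<in> YS S then ef i h f else f)"

text \<open>As \<open>h\<close> reads only \<open>S\<close>-coordinates, the shear of the whole
  space is the extension of its restriction; vectors vanishing on \<open>S\<close> are fixed because
  \<open>h\<close> vanishes there modulo \<open>p\<close>.\<close>

lemma eS_KS:
  assumes i: "i \<in> S" and h: "adm i h" "el i h \<in> G" "\<And>f. h (restr S f) = h f"
  shows "eS i h \<in> KS S"
proof -
  have maps: "ef i h' f \<in> YS S" if "adm i h'" "f \<in> YS S" for h' f
    using ef_Y[OF that(1) YS_D(5)[OF that(2)]] YS_D(3)[OF that(2)] i
    by (auto simp: YS_def ef_def)
  have inv: "eS i (\<lambda>f. - h f) \<circ> eS i h = id" "eS i h \<circ> eS i (\<lambda>f. - h f) = id"
    using maps h(1) adm_neg[OF h(1)] ef_neg[OF h(1)] YS_D(5) by (auto simp: eS_def fun_eq_iff)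
  then have "bij (eS i h)" using o_bij by blast
  then have perm: "eS i h permutes YS S" by (simp add: permutes_def bij_iff eS_def)
  have "extend S (eS i h) f = ef i h f" if f: "f \<in> Y" for f
  proof (cases "restr S f \<in> YS S")
    case True
    then show ?thesis using i h(3) by (auto simp: extend_def eS_def ef_def restr_def)
  next
    case False
    then have z: "restr S f = (\<lambda>_. 0)" using restr_YS[OF S f] by blast
    then have "h f = h (\<lambda>_. 0)" by (metis h(3))
    then have "p dvd h f" using adm_0[OF h(1)] by simp
    then have "ef i h f = f"
      unfolding ef_def by (metis Y_mod[OF f] add.right_neutral dvd_imp_mod_0 fun_upd_triv mod_add_right_eq)
    moreover have "extend S (eS i h) f = f"
      using perm_zero[OF perm] z by (auto simp: extend_def fun_eq_iff restr_def split: if_splits)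
    ultimately show ?thesis by simp
  qed
  then have "lift (extend S (eS i h)) = el i h" unfolding el_def by (rule lift_cong)
  then show ?thesis using perm h(2) by (simp add: KS_def)
qed

text \<open>Both shears move \<open>x\<close>, and no other point of \<open>YS S\<close> is moved by
  both, so their commutator is a 3-cycle. The two images of \<open>x\<close> differ because
  different coordinates change.\<close>

lemma corner_edge:
  assumes x: "x \<in> YS S" and ij: "i \<in> S" "j \<in> S" "i \<noteq> j"
    and a: "adm i a" "el i a \<in> G" "\<And>f. a (restr S f) = a f"
    and b: "adm j b" "el j b \<in> G" "\<And>f. b (restr S f) = b f"
    and nz: "\<not> p dvd a x" "\<not> p dvd b x"
    and one: "\<And>y. y \<in> YS S \<Longrightarrow> a y \<noteq> 0 \<Longrightarrow> b y \<noteq> 0 \<Longrightarrow> y = x"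
  shows "(x, ef i a x) \<in> three_cycle_edge (YS S) (KS S)"
proof -
  let ?a = "eS i a" and ?b = "eS j b"
  have K: "?a \<in> KS S" "?b \<in> KS S" using eS_KS ij a b by blast+
  have moved: "eS i h y \<noteq> y \<Longrightarrow> y \<in> YS S \<and> h y \<noteq> 0" for i h y
    using YS_D(5)[of y] Y_mod[of y i] by (auto simp: eS_def ef_def split: if_splits)
  have moves: "eS i h x i \<noteq> x i" if "\<not> p dvd h x" for i h
  proof
    assume "eS i h x i = x i"
    then have "(x i + h x) mod p = x i mod p"
      using x Y_mod[OF YS_D(5)[OF x]] by (simp add: eS_def ef_def)
    then have "p dvd h x" by (simp add: mod_eq_dvd_iff)
    then show False using that by simp
  qed
  have ax: "?a x \<noteq> x" "?a x i \<noteq> x i" and bx: "?b x \<noteq> x" 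
    using moves[where h = a and i = i, OF nz(1)] moves[where h = b and i = j, OF nz(2)] by metis+
  have bxi: "?b x i = x i" using x ij by (simp add: eS_def ef_def)
  have "?a \<circ> ?b \<circ> inv ?a \<circ> inv ?b = transpose x (?a x) \<circ> transpose (?a x) (?b x)"
    by (rule commutator_three_cycle)
      (use K perm_group_bij[OF KS_group] ax bx moved one in blast)+
  moreover have "?a \<circ> ?b \<circ> inv ?a \<circ> inv ?b \<in> KS S"
    using K by (intro perm_group_comp[OF KS_group] perm_group_inv[OF KS_group])
  ultimately have "transpose x (?a x) \<circ> transpose (?a x) (?b x) \<in> KS S" by simp
  moreover have "?a x \<in> YS S" "?b x \<in> YS S"
    using x K perm_group_permutes[OF KS_group] permutes_in_image by metis+
  ultimately have "(x, ?a x) \<in> three_cycle_edge (YS S) (KS S)"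
    unfolding three_cycle_edge_def using x ax bx bxi by (auto intro!: bexI[of _ "?b x"])
  then show ?thesis using x by (simp add: eS_def)
qed

end

text \<open>Shears of small support come from indicators of single coordinates when S = {i, j}, and
  otherwise from the induction hypothesis on the two faces S - {i} and S - {j}.\<close>

lemma coordinate_edge:
  assumes S: "S \<subseteq> {..<n}" "card S \<ge> 2"
    and IH: "\<And>i. i \<in> S \<Longrightarrow> card S \<ge> 3 \<Longrightarrow> Alt (YS (S - {i})) \<subseteq> KS (S - {i})"
    and x: "x \<in> YS S" and ij: "i \<in> S" "j \<in> S" "i \<noteq> j"
    and nz: "\<exists>k\<in>S - {i}. x k \<noteq> 0" "\<exists>k\<in>S - {j}. x k \<noteq> 0"
    and v: "0 \<le> v" "v < p" "v \<noteq> x i"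
  shows "(x, x(i := v)) \<in> three_cycle_edge (YS S) (KS S)"
proof -
  have lt: "i < n" "j < n" using S ij by auto
  have nd: "\<not> p dvd v - x i"
  proof
    assume "p dvd v - x i"
    then have "v mod p = x i mod p" by (simp add: mod_eq_dvd_iff)
    then show False using v YS_D(1,2)[OF x, of i] by simp
  qed
  have ax: "ef i a x = x(i := v)" if "a x = v - x i" for a
    using that v by (simp add: ef_def)
  show ?thesis
  proof (cases "card S = 2")
    case True
    have "finite S" using True by (metis card.infinite zero_neq_numeral)
    then have Sij: "S = {i, j}"
      using True ij by (metis card_2_iff card_seteq insert_subset subset_refl empty_subsetI card_2_iff order_refl)
    have xij: "x i \<noteq> 0" "x j \<noteq> 0" using nz ij by (auto simp: Sij)
    have pos: "0 < x i" "0 < x j" "x i < p" "x j < p" using xij YS_D(1,2)[OF x] by (auto simp: order_less_le)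
    have "(x, ef i (\<lambda>f. (v - x i) * \<delta> j (x j) f) x) \<in> three_cycle_edge (YS S) (KS S)"
    proof (rule corner_edge[OF S(1) x ij, where b = "\<delta> i (x i)"])
      show "adm i (\<lambda>f. (v - x i) * \<delta> j (x j) f)" using lt ij xij by (intro adm_scale \<delta>_adm) auto
      show "el i (\<lambda>f. (v - x i) * \<delta> j (x j) f) \<in> G"
        using lt ij xij pos by (intro scale_in_G \<delta>_adm \<delta>_in_G) auto
      show "adm j (\<delta> i (x i))" "el j (\<delta> i (x i)) \<in> G" using lt ij xij pos by (auto intro: \<delta>_adm \<delta>_in_G)
      show "(v - x i) * \<delta> j (x j) (restr S f) = (v - x i) * \<delta> j (x j) f" "\<delta> i (x i) (restr S f) = \<delta> i (x i) f" for f
        using ij by (simp_all add: \<delta>_def restr_def)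
      show "\<not> p dvd (v - x i) * \<delta> j (x j) x" "\<not> p dvd \<delta> i (x i) x"
        using nd p_gt1 by (auto simp: \<delta>_def zdvd1_eq)
      fix y assume "y \<in> YS S" "(v - x i) * \<delta> j (x j) y \<noteq> 0" "\<delta> i (x i) y \<noteq> 0"
      then have "y i = x i" "y j = x j" by (auto simp: \<delta>_def split: if_splits)
      then show "y = x" using YS_D(3)[OF x] YS_D(3)[OF \<open>y \<in> YS S\<close>] by (intro ext) (metis Sij insertE singletonD)
    qed
    then show ?thesis by (subst (asm) ax) (simp_all add: \<delta>_def)
  next
    case False
    then have c3: "card S \<ge> 3" using S(2) by simp
    have fin: "finite S" using S(2) by (metis card.infinite not_numeral_le_zero)
    obtain k where k: "k \<in> S" "k \<noteq> i" "k \<noteq> j"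
      using exists_not_in[of "{i, j}" S] c3 ij(3) by auto
    let ?A = "S - {i}" and ?B = "S - {j}"
    have sub: "?A \<subseteq> {..<n}" "?B \<subseteq> {..<n}" using S(1) by auto
    have cd: "card ?A \<ge> 2" "card ?B \<ge> 2" using c3 ij fin by simp_all
    \<comment> \<open>Three distinct values x k, r1, r2 exist because p >= 3. The shears act only
      over {P, Q} and over {P', Q'}, and comparing entries at \<open>k\<close> leaves only P with
      P', which determine \<open>x\<close>.\<close>
    define r1 r2 where "r1 = (x k + 1) mod p" and "r2 = (x k + 2) mod p"
    have r: "r1 \<noteq> x k" "r2 \<noteq> x k" "r1 \<noteq> r2" "0 \<le> r1" "r1 < p" "0 \<le> r2" "r2 < p"
    proof -
      have "\<not> p dvd 1" "\<not> p dvd 2" using p_ge3 zdvd_not_zless by fastforce+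
      moreover have "x k mod p = x k" using Y_mod YS_D(5)[OF x] by blast
      ultimately show "r1 \<noteq> x k" "r2 \<noteq> x k"
        unfolding r1_def r2_def by (metis add_diff_cancel_left' mod_eq_dvd_iff)+
      have "(x k + 2) - (x k + 1) = 1" by simp
      with \<open>\<not> p dvd 1\<close> show "r1 \<noteq> r2" unfolding r1_def r2_def by (metis mod_eq_dvd_iff)
      show "0 \<le> r1" "r1 < p" "0 \<le> r2" "r2 < p" using p_gt1 by (simp_all add: r1_def r2_def)
    qed
    define P where "P = restr ?A x"
    \<comment> \<open>The entry 1 at \<open>j\<close> keeps \<open>Q\<close> nonzero even if r1 = 0;
      likewise for \<open>Q'\<close> at \<open>i\<close>.\<close>
    define Q where "Q = P(k := r1, j := 1)"
    define P' where "P' = restr ?B x"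
    define Q' where "Q' = P'(k := r2, i := 1)"
    have P: "P \<in> YS ?A" "P' \<in> YS ?B"
    proof -
      have "restr ?A x \<noteq> (\<lambda>_. 0)" "restr ?B x \<noteq> (\<lambda>_. 0)" using nz by (auto simp: restr_def fun_eq_iff)
      then show "P \<in> YS ?A" "P' \<in> YS ?B"
        unfolding P_def P'_def using restr_YS[OF sub(1) YS_D(5)[OF x]] restr_YS[OF sub(2) YS_D(5)[OF x]] by blast+
    qed
    have Q: "Q \<in> YS ?A" "Q' \<in> YS ?B"
    proof -
      show "Q \<in> YS ?A"
      proof (rule YS_I[OF sub(1)])
        show "0 \<le> Q l \<and> Q l < p" for l using YS_D(1,2)[OF P(1), of l] r p_gt1 by (auto simp: Q_def)
        show "Q l = 0" if "l \<notin> ?A" for l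
        proof -
          have "l \<noteq> j" "l \<noteq> k" using that ij k by blast+
          then show ?thesis using YS_D(3)[OF P(1) that] by (simp add: Q_def)
        qed
        show "\<exists>l\<in>?A. Q l \<noteq> 0" using ij by (intro bexI[of _ j]) (auto simp: Q_def)
      qed
      show "Q' \<in> YS ?B"
      proof (rule YS_I[OF sub(2)])
        show "0 \<le> Q' l \<and> Q' l < p" for l using YS_D(1,2)[OF P(2), of l] r p_gt1 by (auto simp: Q'_def)
        show "Q' l = 0" if "l \<notin> ?B" for l
        proof -
          have "l \<noteq> i" "l \<noteq> k" using that ij k by blast+
          then show ?thesis using YS_D(3)[OF P(2) that] by (simp add: Q'_def)
        qed
        show "\<exists>l\<in>?B. Q' l \<noteq> 0" using ij by (intro bexI[of _ i]) (auto simp: Q'_def)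
      qed
    qed
    have PQk: "P k = x k" "Q k = r1" "P' k = x k" "Q' k = r2"
      using k by (auto simp: P_def Q_def P'_def Q'_def restr_def)
    have ne: "P \<noteq> Q" "P' \<noteq> Q'" using PQk r by auto
    let ?a = "\<lambda>f. (v - x i) * (ind ?A P f - ind ?A Q f)" and ?b = "\<lambda>f. 1 * (ind ?B P' f - ind ?B Q' f)"
    have rr: "restr ?A (restr S f) = restr ?A f" "restr ?B (restr S f) = restr ?B f" for f
      by (auto simp: restr_def)
    have xv: "?a x = v - x i" "?b x = 1"
      using ne by (simp_all add: ind_def[OF sub(1)] ind_def[OF sub(2)] P_def[symmetric] P'_def[symmetric])
    have "(x, ef i ?a x) \<in> three_cycle_edge (YS S) (KS S)"
    proof (rule corner_edge[OF S(1) x ij, where b = ?b])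
      show "adm i ?a" "el i ?a \<in> G"
        using difference_in_G[OF sub(1) IH[OF ij(1) c3] cd(1) lt(1) _ P(1) Q(1) ne(1)] by auto
      show "adm j ?b" "el j ?b \<in> G"
        using difference_in_G[OF sub(2) IH[OF ij(2) c3] cd(2) lt(2) _ P(2) Q(2) ne(2), of 1] by auto
      show "?a (restr S f) = ?a f" "?b (restr S f) = ?b f" for f
        by (simp_all only: ind_def[OF sub(1)] ind_def[OF sub(2)] rr)
      show "\<not> p dvd ?a x" "\<not> p dvd ?b x" unfolding xv using nd p_gt1 by (auto simp: zdvd1_eq)
      fix y assume y: "y \<in> YS S" and "?a y \<noteq> 0" "?b y \<noteq> 0"
      then have "restr ?A y = P \<or> restr ?A y = Q" "restr ?B y = P' \<or> restr ?B y = Q'"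
        by (auto simp: ind_def[OF sub(1)] ind_def[OF sub(2)] split: if_splits)
      moreover have "restr ?A y k = y k" "restr ?B y k = y k" using k by (auto simp: restr_def)
      ultimately have "restr ?A y = P" "restr ?B y = P'" using PQk r by metis+
      then have "y l = x l" if "l \<in> S" for l
        using that ij(3) unfolding P_def P'_def restr_def fun_eq_iff by (metis DiffI singletonD)
      then show "y = x" using YS_D(3)[OF x] YS_D(3)[OF y] by (intro ext) metis
    qed
    then show ?thesis using ax[of ?a] xv(1) by simp
  qed
qed

lemma connected_to_ones:
  assumes S: "S \<subseteq> {..<n}" "card S \<ge> 2"
    and IH: "\<And>i. i \<in> S \<Longrightarrow> card S \<ge> 3 \<Longrightarrow> Alt (YS (S - {i})) \<subseteq> KS (S - {i})"
    and x: "x \<in> YS S"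
  shows "(x, (\<lambda>i. if i \<in> S then 1 else 0)) \<in> (three_cycle_edge (YS S) (KS S))\<^sup>*"
proof -
  let ?E = "three_cycle_edge (YS S) (KS S)" and ?o = "\<lambda>i. if i \<in> S then 1 else 0 :: int"
  have fin: "finite S" using S(2) by (metis card.infinite not_numeral_le_zero)
  have edge: "(x, x(i := v)) \<in> ?E"
    if x: "x \<in> YS S" and ab: "a \<in> S" "b \<in> S" "a \<noteq> b" "x a \<noteq> 0" "x b \<noteq> 0" and i: "i \<in> S" and v: "0 \<le> v" "v < p" "v \<noteq> x i" for x a b i v
  proof -
    obtain j where j: "j \<in> S" "j \<noteq> i" using ab by metis
    show ?thesis
      by (rule coordinate_edge[OF S IH x i j(1) j(2)[symmetric] _ _ v]) (use ab in blast)+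
  qed
  \<comment> \<open>Overwriting entries by 1 keeps nonzero entries nonzero, so the hypothesis
    survives the induction on the number of entries different from 1.\<close>
  have two: "(x, ?o) \<in> ?E\<^sup>*"
    if "x \<in> YS S" "a \<in> S" "b \<in> S" "a \<noteq> b" "x a \<noteq> 0" "x b \<noteq> 0" for x a b
    using that
  proof (induction "card {i\<in>S. x i \<noteq> 1}" arbitrary: x rule: less_induct)
    case less
    show ?case
    proof (cases "\<exists>i\<in>S. x i \<noteq> 1")
      case False
      then have "x = ?o" using YS_D(3)[OF less.prems(1)] by auto
      then show ?thesis by simp
    next
      case True
      then obtain i where i: "i \<in> S" "x i \<noteq> 1" by blast
      have e: "(x, x(i := 1)) \<in> ?E" using less.prems i p_gt1 by (intro edge[of x a b i 1]) auto
      have "{k\<in>S. (x(i := 1)) k \<noteq> 1} \<subset> {k\<in>S. x k \<noteq> 1}" using i by auto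
      then have "card {k\<in>S. (x(i := 1)) k \<noteq> 1} < card {k\<in>S. x k \<noteq> 1}" by (intro psubset_card_mono) (use fin in auto)
      then have "(x(i := 1), ?o) \<in> ?E\<^sup>*"
        using e less.prems by (intro less.hyps) (auto simp: three_cycle_edge_def)
      with e show ?thesis by (rule converse_rtrancl_into_rtrancl)
    qed
  qed
  obtain a where a: "a \<in> S" "x a \<noteq> 0" using YS_D(4)[OF x] by blast
  obtain b where b: "b \<in> S" "b \<noteq> a"
    using exists_not_in[of "{a}" S] S(2) by auto
  show ?thesis
  proof (cases "x b = 0")
    case False
    then show ?thesis using two[OF x a(1) b(1)] a b by auto
  next
    case True
    \<comment> \<open>A vector with one nonzero coordinate need not satisfy both conditions of
      \<open>coordinate_edge\<close>, so the edge is drawn from \<open>y\<close> and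
      reversed.\<close>
    define y where "y = x(b := 1)"
    have y: "y \<in> YS S"
      unfolding y_def using a b YS_D(1-3)[OF x] p_gt1 by (intro YS_I[OF S(1)]) auto
    have ya: "y a \<noteq> 0" "y b \<noteq> 0" using a b by (auto simp: y_def)
    have "(y, y(b := 0)) \<in> ?E" using y a b ya p_gt1 by (intro edge[of y a b b 0]) auto
    moreover have "y(b := 0) = x" using True by (auto simp: y_def)
    ultimately have "(x, y) \<in> ?E" using E_sym[OF KS_group[OF S(1)]] by simp
    moreover have "(y, ?o) \<in> ?E\<^sup>*" using two[OF y a(1) b(1)] b ya by auto
    ultimately show ?thesis by (rule converse_rtrancl_into_rtrancl)
  qed
qed

text \<open>Strong induction; the hypothesis is called only from cardinality 3 on, so cardinality 2
  is the base.\<close>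

lemma Alt_YS: "S \<subseteq> {..<n} \<Longrightarrow> card S \<ge> 2 \<Longrightarrow> Alt (YS S) \<subseteq> KS S"
proof (induction "card S" arbitrary: S rule: less_induct)
  case less
  have fin: "finite S" using less.prems(2) by (metis card.infinite not_numeral_le_zero)
  have IH: "Alt (YS (S - {i})) \<subseteq> KS (S - {i})" if "i \<in> S" "card S \<ge> 3" for i
    using that less.prems fin by (intro less.hyps) auto
  show ?case
  proof (rule Alt_subset_of_connected[OF KS_group[OF less.prems(1)]])
    fix a assume a: "a \<in> YS S"
    show "(a, \<lambda>i. if i \<in> S then 1 else 0) \<in> (three_cycle_edge (YS S) (KS S))\<^sup>*"
      by (rule connected_to_ones[OF less.prems _ a]) (rule IH)
  qed
qed

text \<open>With all coordinates active, \<open>c\<close> carries edges of the graph on vectors back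
  to edges of the graph on \<open>X\<close>.\<close>

theorem Alt_subset_G: "Alt X \<subseteq> G"
proof -
  let ?S = "{..<n}" and ?o = "\<lambda>i. if i \<in> {..<n} then 1 else 0 :: int"
  have YS: "YS ?S = Y" by (auto simp: YS_def nonzero_vectors_def)
  have o: "?o \<in> Y" using n p_gt1 by (intro Y_I) (auto dest!: fun_cong[of _ _ 0])
  have inj: "c a = c b \<longleftrightarrow> a = b" if "a \<in> X" "b \<in> X" for a b using that inv_c by metis
  have t: "lift (transpose (c a) (c b)) = transpose a b" if "a \<in> X" "b \<in> X" for a b
  proof
    fix x
    show "lift (transpose (c a) (c b)) x = transpose a b x"
      using that inj inv_c by (auto simp: lift_def transpose_def)
  qed
  have tY: "transpose a b f \<in> Y" if "a \<in> Y" "b \<in> Y" "f \<in> Y" for a b f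
    using that by (auto simp: transpose_def)
  let ?x0 = "inv_into X c ?o"
  have x0: "c ?x0 = ?o" "?x0 \<in> X" using c_inv[OF o] by auto
  show ?thesis
  proof (rule Alt_subset_of_connected[OF G])
    fix a assume a: "a \<in> X"
    show "(a, ?x0) \<in> (three_cycle_edge X G)\<^sup>*"
    proof (cases "a = ?x0")
      case False
      have "(c a, ?o) \<in> (three_cycle_edge (YS ?S) (KS ?S))\<^sup>*"
        using n c_Y[OF a] Alt_YS by (intro connected_to_ones) (auto simp: YS[symmetric])
      moreover have "c a \<noteq> ?o" using False inv_c[OF a] by metis
      ultimately have "(c a, ?o) \<in> three_cycle_edge (YS ?S) (KS ?S)"
        using E_rtrancl[OF KS_group[OF order_refl]] by blast
      then obtain w where w: "w \<in> Y" "w \<noteq> c a" "w \<noteq> ?o" "transpose (c a) ?o \<circ> transpose ?o w \<in> KS ?S"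
        unfolding three_cycle_edge_def YS by blast
      let ?z = "inv_into X c w"
      have z: "?z \<in> X" "c ?z = w" using c_inv[OF w(1)] by auto
      have "lift (extend ?S (transpose (c a) ?o \<circ> transpose ?o w)) = lift (transpose (c a) ?o \<circ> transpose ?o w)"
      proof (rule lift_cong)
        fix f assume f: "f \<in> Y"
        let ?g = "transpose (c a) ?o \<circ> transpose ?o w"
        have gY: "?g f \<in> Y" using f tY o w c_Y[OF a] by simp
        have rf: "restr ?S f = f" using f by (auto simp: restr_def nonzero_vectors_def)
        have "extend ?S ?g f i = ?g f i" for i
        proof (cases "i < n")
          case True
          then show ?thesis by (simp only: extend_def rf lessThan_iff if_True)
        next
          case False
          then have i: "i \<ge> n" by simp
          have z: "h i = 0" if "h \<in> Y" for h using that i by (simp add: nonzero_vectors_def)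
          have "?g f i = 0" "f i = 0" by (rule z[OF gY], rule z[OF f])
          then show ?thesis using False by (simp only: extend_def lessThan_iff if_False)
        qed
        then show "extend ?S ?g f = ?g f" by (rule HOL.ext)
      qed
      also have "\<dots> = lift (transpose (c a) ?o) \<circ> lift (transpose ?o w)"
        by (rule lift_comp[symmetric]) (rule tY[OF o w(1)])
      also have "\<dots> = transpose a ?x0 \<circ> transpose ?x0 ?z"
        using t[OF a x0(2)] t[OF x0(2) z(1)] by (simp only: x0 z)
      finally have "transpose a ?x0 \<circ> transpose ?x0 ?z \<in> G" using w(4) by (simp add: KS_def)
      moreover have "?z \<noteq> a" "?z \<noteq> ?x0" using w z x0 by metis+
      ultimately have "(a, ?x0) \<in> three_cycle_edge X G"
        unfolding three_cycle_edge_def using a x0(2) z(1) False by auto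
      then show ?thesis by blast
    qed simp
  qed
qed

end

section \<open>Uniform expanders\<close>

lemma gen_perm_group:
  assumes X: "finite X" and S: "\<And>s. s \<in> S \<Longrightarrow> s permutes X"
  shows "perm_group X (gen_perm S)"
proof -
  have perm: "f permutes X" if "f \<in> gen_perm S" for f
    using that
  proof induction
    case gen_id
    show ?case by (rule permutes_id)
  next
    case (gen_mul f h)
    show ?case by (rule permutes_compose[OF gen_mul.IH S[OF gen_mul.hyps(1)]])
  next
    case (gen_inv f h)
    show ?case by (rule permutes_compose[OF gen_inv.IH permutes_inv[OF S[OF gen_inv.hyps(1)]]])
  qed
  have comp: "f \<circ> g \<in> gen_perm S" if "f \<in> gen_perm S" "g \<in> gen_perm S" for f g
    using that(1)
  proof induction
    case gen_id
    then show ?case using that(2) by (simp add: id_def)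
  qed (simp_all only: comp_assoc gen_perm.intros)
  have gen: "s \<in> gen_perm S" "inv s \<in> gen_perm S" if "s \<in> S" for s
    using gen_perm.gen_mul[OF that gen_perm.gen_id] gen_perm.gen_inv[OF that gen_perm.gen_id] by simp_all
  have "inv f \<in> gen_perm S" if "f \<in> gen_perm S" for f
    using that
  proof induction
    case gen_id
    show ?case unfolding inv_id by (rule gen_perm.gen_id)
  next
    case (gen_mul f h)
    then have eq: "inv (f \<circ> h) = inv h \<circ> inv f"
      using S perm by (intro o_inv_distrib) (auto intro: permutes_bij)
    show ?case unfolding eq by (rule comp[OF gen_mul.IH gen(2)[OF gen_mul.hyps(1)]])
  next
    case (gen_inv f h)
    then have eq: "inv (inv f \<circ> h) = inv h \<circ> f"
      using S perm inv_inv_eq[OF permutes_bij[OF S[OF gen_inv.hyps(1)]]]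
      by (subst o_inv_distrib) (auto intro: permutes_bij bij_imp_bij_inv)
    show ?case unfolding eq by (rule comp[OF gen_inv.IH gen(1)[OF gen_inv.hyps(1)]])
  qed
  then show ?thesis
    using X perm comp gen_perm.gen_id by (auto simp: perm_group_def)
qed

lemma gen_perm_generator: "s \<in> S \<Longrightarrow> s \<in> gen_perm S"
  using gen_perm.gen_mul[OF _ gen_perm.gen_id, of s S] by simp

lemma gen_perm_subset: assumes H: "perm_group X H" and "S \<subseteq> H" shows "gen_perm S \<subseteq> H"
proof
  fix f assume "f \<in> gen_perm S"
  then show "f \<in> H"
  proof induction
    case gen_id
    show ?case by (rule perm_group_id[OF H])
  next
    case (gen_mul f h)
    then show ?case using assms perm_group_comp[OF H] by blast
  next
    case (gen_inv f h)
    then show ?case using assms perm_group_comp[OF H] perm_group_inv[OF H] by blast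
  qed
qed

text \<open>Word length estimates turn into membership statements for this length function.\<close>

lemma length_fun_membership:
  assumes G: "perm_group X G"
  shows "length_fun (\<lambda>g. if g \<in> G then 0 else 1)"
  unfolding length_fun_def
proof (intro conjI allI impI)
  fix f g :: "'a \<Rightarrow> 'a"
  show "(if f \<circ> g \<in> G then 0 else 1 :: real) \<le> (if f \<in> G then 0 else 1) + (if g \<in> G then 0 else 1)"
    using perm_group_comp[OF G] by auto
  assume f: "bij f"
  then have "inv f \<in> G \<longleftrightarrow> f \<in> G"
    using perm_group_inv[OF G] by (metis inv_inv_eq)
  then show "(if inv f \<in> G then 0 else 1 :: real) = (if f \<in> G then 0 else 1)" by simp
qed

context coords
begin

text \<open>The length estimates with bound 0, for the length that vanishes exactly on
  \<open>G\<close>, produce all transvections and all squares from the few given ones.\<close>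

lemma Alt_subset_of_generators:
  assumes G: "perm_group X G" and s: "coprime s n" "\<And>i. i < n \<Longrightarrow> el i (\<lambda>f. f ((i + s) mod n)) \<in> G"
    and sq: "\<And>i. i < n \<Longrightarrow> \<exists>j<n. j \<noteq> i \<and> el i (\<lambda>f. (f j)\<^sup>2) \<in> G"
  shows "Alt X \<subseteq> G"
proof -
  let ?l = "\<lambda>g. if g \<in> G then 0 else 1 :: real"
  note l = length_fun_membership[OF G]
  have mem: "?l g \<le> 0 \<longleftrightarrow> g \<in> G" for g by simp
  have tv: "el i (\<lambda>f. f j) \<in> G" if "i < n" "j < n" "i \<noteq> j" for i j
    using l_transvections[OF l, of s 0 i j] s that by (auto split: if_splits)
  have lin: "?l (el i (\<lambda>f. t * f j)) \<le> 0" if "i < n" "j < n" "i \<noteq> j" for i j t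
    using scale_in_perm_group[OF G adm_coord tv[OF that]] that by simp
  interpret coords_group p n X c G
  proof
    fix i k assume ik: "i < n" "k < n" "i \<noteq> k"
    obtain j where j: "j < n" "j \<noteq> i" "el i (\<lambda>f. (f j)\<^sup>2) \<in> G" using sq[OF ik(1)] by blast
    have "?l (el i (\<lambda>f. 1 * (f k)\<^sup>2)) \<le> 14 * 0"
      by (rule l_quadratic[OF l, where j = j]) (use lin ik j in auto)
    then show "el i (\<lambda>f. (f k)\<^sup>2) \<in> G" by (auto split: if_splits)
  qed (use G tv in auto)
  show ?thesis by (rule Alt_subset_G)
qed

lemma Alt_subset_roots: "Alt X \<subseteq> gen_perm {root_perm i e t | i e t. i < n \<and> e \<in> {1, 2}}"
proof (rule Alt_subset_of_generators[of _ 1])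
  let ?S = "{root_perm i e t | i e t. i < n \<and> e \<in> {1, 2}}"
  show "perm_group X (gen_perm ?S)"
    by (rule gen_perm_group[OF finite_X]) (auto simp: root_perm_def intro!: el_permutes adm_scale root_adm[unfolded power_one_right] root_adm)
  have mem: "root_perm i e t \<in> gen_perm ?S" if "i < n" "e \<in> {1, 2}" for i e t
    by (rule gen_perm_generator) (use that in blast)
  have r: "el i (\<lambda>f. f (succ i)) = root_perm i 1 1" "el i (\<lambda>f. (f (succ i))\<^sup>2) = root_perm i 2 1" for i
    by (simp_all add: root_perm_def)
  fix i assume i: "i < n"
  show "el i (\<lambda>f. f ((i + 1) mod n)) \<in> gen_perm ?S"
    unfolding succ_def[symmetric] r by (rule mem) (use i in auto)
  have "el i (\<lambda>f. (f (succ i))\<^sup>2) \<in> gen_perm ?S"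
    unfolding r by (rule mem) (use i in auto)
  then show "\<exists>j<n. j \<noteq> i \<and> el i (\<lambda>f. (f j)\<^sup>2) \<in> gen_perm ?S"
    using succ[OF i] by blast
qed simp

section \<open>Rotation of the coordinates\<close>

definition rot :: "nat \<Rightarrow> (nat \<Rightarrow> int) \<Rightarrow> nat \<Rightarrow> int" where
  "rot k f = (\<lambda>i. if i < n then f ((i + k) mod n) else 0)"

definition rho :: "'a \<Rightarrow> 'a" where
  "rho = lift (rot 1)"

lemma n_pos: "n > 0" using n by simp

lemma rot_Y: assumes "f \<in> Y" shows "rot k f \<in> Y"
proof (rule Y_I)
  show "0 \<le> rot k f i \<and> rot k f i < p" if "i < n" for i
    using assms that n_pos by (simp add: rot_def nonzero_vectors_def)
  show "rot k f i = 0" if "i \<ge> n" for i using that by (simp add: rot_def)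
  have "\<exists>j. f j \<noteq> 0" using assms by (auto simp: nonzero_vectors_def fun_eq_iff)
  then obtain j where "f j \<noteq> 0" by blast
  then have j: "j < n" "f j \<noteq> 0" using assms by (auto simp: nonzero_vectors_def intro: leI)
  have "((j + (n - k mod n)) mod n + k) mod n = (j + (n - k mod n + k mod n)) mod n"
    by (metis add.assoc mod_add_left_eq mod_add_right_eq)
  also have "n - k mod n + k mod n = n" using n_pos by simp
  finally have "rot k f ((j + (n - k mod n)) mod n) = f j"
    using j n_pos by (simp add: rot_def)
  then show "rot k f \<noteq> (\<lambda>_. 0)" using j by (metis)
qed

lemma rot_rot: "rot k (rot m f) = rot (k + m) f"
  using n_pos by (auto simp: rot_def fun_eq_iff mod_add_left_eq add.assoc)

lemma rot_n: "f \<in> Y \<Longrightarrow> rot n f = f"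
  by (auto simp: rot_def nonzero_vectors_def fun_eq_iff)

lemma rho_permutes: "rho permutes X"
  unfolding rho_def
  by (rule lift_permutes[where G = "rot (n - 1)"]) (use n_pos in \<open>simp_all add: rot_Y rot_rot rot_n\<close>)

lemma rho_bij: "bij rho" using rho_permutes permutes_bij by blast

lemma rho_funpow: "rho ^^ Suc k = lift (rot (Suc k))"
proof (induction k)
  case (Suc k)
  have "lift (rot 1) \<circ> lift (rot (Suc k)) = lift (rot 1 \<circ> rot (Suc k))"
    by (rule lift_comp) (rule rot_Y)
  also have "rot 1 \<circ> rot (Suc k) = rot (Suc (Suc k))" by (rule HOL.ext) (simp add: rot_rot)
  finally show ?case using Suc unfolding funpow.simps(2)[of "Suc k"] by (simp only: rho_def)
qed (simp add: rho_def)

text \<open>The order of the rotation divides the odd number n.\<close>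

lemma rho_Alt: assumes "odd n" shows "rho \<in> Alt X"
proof -
  have "rho ^^ n = lift (rot n)" using rho_funpow[of "n - 1"] n_pos by simp
  also have "\<dots> = id" by (rule lift_id) (rule rot_n)
  finally have "evenperm rho"
    using evenperm_of_odd_order[OF finite_X rho_permutes] assms by blast
  then show ?thesis using rho_permutes by (simp add: Alt_def)
qed

lemma succ_eq_iff: "i < n \<Longrightarrow> j < n \<Longrightarrow> succ i = succ j \<longleftrightarrow> i = j"
  by (auto simp: succ_def mod_Suc split: if_splits)

lemma rho_conj:
  assumes ij: "i < n" "j < n" "i \<noteq> j" and \<phi>: "\<phi> 0 = 0"
  shows "el (succ i) (\<lambda>f. \<phi> (f (succ j))) = inv rho \<circ> (el i (\<lambda>f. \<phi> (f j)) \<circ> rho)"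
proof -
  have a: "adm (succ i) (\<lambda>f. \<phi> (f (succ j)))"
    using ij succ_eq_iff succ \<phi> by (auto simp: adm_def)
  have rot1: "rot 1 = (\<lambda>f k. if k < n then f (succ k) else 0)"
    by (intro HOL.ext) (simp add: rot_def succ_def)
  have e: "ef i (\<lambda>f. \<phi> (f j)) \<circ> rot 1 = rot 1 \<circ> ef (succ i) (\<lambda>f. \<phi> (f (succ j)))"
    unfolding rot1 using ij succ_eq_iff[OF _ ij(1)] by (auto simp: fun_eq_iff ef_def)
  have "el i (\<lambda>f. \<phi> (f j)) \<circ> rho = lift (ef i (\<lambda>f. \<phi> (f j)) \<circ> rot 1)"
    unfolding el_def rho_def by (rule lift_comp) (rule rot_Y)
  moreover have "rho \<circ> el (succ i) (\<lambda>f. \<phi> (f (succ j))) = lift (rot 1 \<circ> ef (succ i) (\<lambda>f. \<phi> (f (succ j))))"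
    unfolding el_def rho_def by (rule lift_comp) (rule ef_Y[OF a])
  ultimately have "el i (\<lambda>f. \<phi> (f j)) \<circ> rho = rho \<circ> el (succ i) (\<lambda>f. \<phi> (f (succ j)))"
    by (simp only: e)
  then show ?thesis
    using rho_bij by (simp add: fun_eq_iff bij_is_inj)
qed

lemma length_fun_nonneg: assumes "length_fun l" "bij f" shows "0 \<le> l f"
proof -
  have li: "l (inv f) = l f" using assms by (simp add: length_fun_def)
  have "l (id \<circ> id) \<le> l id + l id" using assms by (simp only: length_fun_def bij_id)
  then have "0 \<le> l id" by simp
  moreover have "l (f \<circ> inv f) \<le> l f + l (inv f)"
    using assms bij_imp_bij_inv[OF assms(2)] unfolding length_fun_def by blast
  moreover have "f \<circ> inv f = id" using assms(2) by (simp add: bij_is_surj surj_iff[symmetric])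
  ultimately show ?thesis using li by simp
qed

text \<open>Each conjugation by the rotation moves the indices one step and costs two rotations; at
  most n steps are needed.\<close>

lemma l_rotate:
  fixes l :: "('a \<Rightarrow> 'a) \<Rightarrow> real" and \<delta> :: real
  assumes l: "length_fun l" and d: "0 < d" "d < n" and i: "i0 < n" "i < n" and \<phi>: "\<phi> 0 = 0" and rho: "l rho \<le> \<delta>"
  shows "l (el i (\<lambda>f. \<phi> (f ((i + d) mod n)))) \<le> l (el i0 (\<lambda>f. \<phi> (f ((i0 + d) mod n)))) + 2 * real n * \<delta>"
proof -
  have ne: "(i + d) mod n \<noteq> i" if "i < n" for i
  proof
    assume "(i + d) mod n = i"
    then have "(i + d) mod n = (i + 0) mod n" using that by simp
    then have "[i + d = i + 0] (mod n)" by (simp only: cong_def)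
    then have "[d = 0] (mod n)" by (simp only: cong_add_lcancel_nat)
    then show False using d by (simp add: cong_def)
  qed
  have *: "l (el ((i0 + k) mod n) (\<lambda>f. \<phi> (f ((i0 + k + d) mod n)))) \<le> l (el i0 (\<lambda>f. \<phi> (f ((i0 + d) mod n)))) + 2 * real k * l rho" for k
  proof (induction k)
    case 0
    then show ?case using i by simp
  next
    case (Suc k)
    let ?i = "(i0 + k) mod n"
    have lt: "?i < n" "(?i + d) mod n < n" using n_pos by simp_all
    have s: "succ ?i = (i0 + Suc k) mod n" "succ ((i0 + k + d) mod n) = (i0 + Suc k + d) mod n" "(?i + d) mod n = (i0 + k + d) mod n"
      by (simp_all add: succ_def mod_simps)
    have "adm ?i (\<lambda>f. \<phi> (f ((?i + d) mod n)))" using ne[OF lt(1)] lt \<phi> by (auto simp: adm_def)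
    then have b: "bij (el ?i (\<lambda>f. \<phi> (f ((?i + d) mod n))))" by (rule el_bij)
    have "l (el (succ ?i) (\<lambda>f. \<phi> (f (succ ((?i + d) mod n))))) \<le> l (inv rho) + l (el ?i (\<lambda>f. \<phi> (f ((?i + d) mod n))) \<circ> rho)"
      unfolding rho_conj[where \<phi> = \<phi>, OF lt ne[OF lt(1), symmetric] \<phi>]
      by (intro l_comp[OF l] bij_imp_bij_inv rho_bij bij_comp b)
    also have "\<dots> \<le> l (inv rho) + (l (el ?i (\<lambda>f. \<phi> (f ((?i + d) mod n)))) + l rho)"
      by (intro add_left_mono l_comp[OF l] rho_bij b)
    also have "\<dots> = l (el ?i (\<lambda>f. \<phi> (f ((?i + d) mod n)))) + 2 * l rho"
      by (simp add: l_inv[OF l rho_bij])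
    finally show ?case using Suc unfolding s by (simp add: algebra_simps)
  qed
  \<comment> \<open>The number of steps from \<open>i0\<close> to \<open>i\<close>, written so that
    no natural subtraction truncates.\<close>
  define k where "k = (i + (n - i0)) mod n"
  have k: "(i0 + k) mod n = i" "k \<le> n" 
    using i n_pos by (simp_all add: k_def mod_add_right_eq)
  have kd: "(i0 + k + d) mod n = (i + d) mod n" using k(1) by (metis mod_add_left_eq)
  have "2 * real k * l rho \<le> 2 * real n * \<delta>"
    using k(2) rho length_fun_nonneg[OF l rho_bij] by (intro mult_mono) auto
  then show ?thesis using *[of k] unfolding k kd by simp
qed

lemma lift_eqI:
  assumes c_X: "\<And>x. c x \<in> Y \<Longrightarrow> x \<in> X" and F: "\<And>f. f \<in> Y \<Longrightarrow> F f \<in> Y"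
    and "\<And>x. x \<in> X \<Longrightarrow> c (g x) = F (c x)" "\<And>x. x \<notin> X \<Longrightarrow> g x = x"
  shows "g = lift F"
proof
  fix x
  show "g x = lift F x"
  proof (cases "x \<in> X")
    case True
    then have "c (g x) = F (c x)" "g x \<in> X" using assms c_Y[of x] by metis+
    then show ?thesis using True inv_c[of "g x"] by (simp add: lift_def)
  qed (use assms lift_outside in auto)
qed

end

lemma expander_eps_mono: "expander_eps H Q e \<Longrightarrow> e' \<le> e \<Longrightarrow> expander_eps H Q e'"
  unfolding expander_eps_def by (meson order_trans)

lemma finite_uniform_eps:
  assumes "finite A" "\<And>p. p \<in> A \<Longrightarrow> \<exists>e>0. expander_eps (H p) (Q p) e"
  shows "\<exists>e>0. \<forall>p\<in>A. expander_eps (H p) (Q p) e"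
  using assms
proof (induction A rule: finite_induct)
  case (insert a A)
  then obtain e1 e2 where "e1 > 0" "\<forall>p\<in>A. expander_eps (H p) (Q p) e1" "e2 > 0" "expander_eps (H a) (Q a) e2"
    by blast
  then show ?case
    by (intro exI[of _ "min e1 e2"]) (auto intro: expander_eps_mono)
qed (auto intro: exI[of _ 1])

text \<open>\<open>words\<close> concerns every length function so that one computation serves
  twice: with \<open>\<delta>\<close> equal to 0 and the membership length it yields generation,
  with the displacement length the gap.\<close>

theorem uniform_expanders:
  fixes X :: "nat \<Rightarrow> 'a set" and S :: "nat \<Rightarrow> ('a \<Rightarrow> 'a) set" and c :: "'a \<Rightarrow> nat \<Rightarrow> int"
  assumes co: "\<And>p. prime p \<Longrightarrow> odd p \<Longrightarrow> coords (int p) n (X p) c"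
    and S: "\<And>p. prime p \<Longrightarrow> odd p \<Longrightarrow> S p \<subseteq> Alt (X p)" "\<And>p. finite (S p)" "\<And>p. S p \<noteq> {}"
    and s: "coprime s n" and C: "C \<ge> 0"
    and words: "\<And>p l \<delta> i. prime p \<Longrightarrow> odd p \<Longrightarrow> length_fun l \<Longrightarrow> (\<And>g. g \<in> S p \<Longrightarrow> l g \<le> \<delta>) \<Longrightarrow> i < n \<Longrightarrow>
      l (coords.el (int p) (X p) c i (\<lambda>f. f ((i + s) mod n))) \<le> C * \<delta> \<and>
      (\<exists>j<n. j \<noteq> i \<and> l (coords.el (int p) (X p) c i (\<lambda>f. (f j)\<^sup>2)) \<le> C * \<delta>)"
  shows "\<exists>eps>0. \<forall>p. prime p \<and> odd p \<longrightarrow>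
    gen_perm (S p) = Alt (X p) \<and> expander_eps (Alt (X p)) (S p \<union> inv ` S p) eps"
proof -
  have gen: "gen_perm (S p) = Alt (X p)" if pp: "prime p" "odd p" for p
  proof
    interpret coords "int p" n "X p" c by (rule co[OF pp])
    show "gen_perm (S p) \<subseteq> Alt (X p)"
      by (rule gen_perm_subset[OF perm_group_Alt[OF finite_X] S(1)[OF pp]])
    have G: "perm_group (X p) (gen_perm (S p))"
      using S(1)[OF pp] by (intro gen_perm_group finite_X) (auto simp: Alt_def)
    let ?l = "\<lambda>g. if g \<in> gen_perm (S p) then 0 else 1 :: real"
    have w: "?l (el i (\<lambda>f. f ((i + s) mod n))) \<le> C * 0 \<and> (\<exists>j<n. j \<noteq> i \<and> ?l (el i (\<lambda>f. (f j)\<^sup>2)) \<le> C * 0)" if "i < n" for i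
      by (rule words[OF pp length_fun_membership[OF G] _ that]) (simp add: gen_perm_generator)
    show "Alt (X p) \<subseteq> gen_perm (S p)"
    proof (rule Alt_subset_of_generators[OF G s])
      fix i assume i: "i < n"
      show "el i (\<lambda>f. f ((i + s) mod n)) \<in> gen_perm (S p)" using w[OF i] by (auto split: if_splits)
      show "\<exists>j<n. j \<noteq> i \<and> el i (\<lambda>f. (f j)\<^sup>2) \<in> gen_perm (S p)"
      proof -
        obtain j where j: "j < n" "j \<noteq> i" "?l (el i (\<lambda>f. (f j)\<^sup>2)) \<le> C * 0" using w[OF i] by blast
        then have "el i (\<lambda>f. (f j)\<^sup>2) \<in> gen_perm (S p)" by (auto split: if_splits)
        with j show ?thesis by blast
      qed
    qed
  qed
  have Q: "finite (S p \<union> inv ` S p)" "S p \<union> inv ` S p \<noteq> {}" for p using S by auto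
  have QA: "S p \<union> inv ` S p \<subseteq> Alt (X p)" if pp: "prime p" "odd p" for p
  proof -
    interpret coords "int p" n "X p" c by (rule co[OF pp])
    show ?thesis using S(1)[OF pp] perm_group_inv[OF perm_group_Alt[OF finite_X]] by blast
  qed
  have finX: "finite (X p)" if pp: "prime p" "odd p" for p
    using coords.finite_X[OF co[OF pp]] .
  define M where "M = 4480 * real n ^ 2 * 4 ^ n * C"
  have M0: "M \<ge> 0" using C by (simp add: M_def)
  \<comment> \<open>M + 1 instead of M keeps the constant well defined even if M = 0.\<close>
  have large: "expander_eps (Alt (X p)) (S p \<union> inv ` S p) (1 / (M + 1))" if pp: "prime p" "odd p" and P: "p \<ge> 128 * n ^ 2" for p
  proof (rule expander_epsI[OF perm_group_Alt[OF finX[OF pp]] _ Q QA[OF pp]])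
    interpret coords "int p" n "X p" c by (rule co[OF pp])
    show "1 / (M + 1) > 0" using M0 by simp
    fix v \<delta> assume v: "v \<in> mean_zero (Alt (X p))" and \<delta>: "\<And>g. g \<in> S p \<union> inv ` S p \<Longrightarrow> norm (lreg g v - v) \<le> \<delta>"
    have \<delta>0: "\<delta> \<ge> 0" using S(3)[of p] \<delta> norm_ge_zero order_trans by blast
    have w: "norm (lreg (el i (\<lambda>f. f ((i + s) mod n))) v - v) \<le> C * \<delta> \<and> (\<exists>j<n. j \<noteq> i \<and> norm (lreg (el i (\<lambda>f. (f j)\<^sup>2)) v - v) \<le> C * \<delta>)" if "i < n" for i
      by (rule words[OF pp length_fun_displacement _ that]) (use \<delta> in auto)
    have "int p \<ge> int (128 * n ^ 2)" using P by (simp only: of_nat_le_iff)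
    then have "norm v \<le> 4480 * real n ^ 2 * 4 ^ n * (C * \<delta>)"
      using w by (intro uniform_gap[OF Alt_subset_roots _ v s]) auto
    also have "\<dots> = M * \<delta>" by (simp add: M_def)
    also have "\<dots> \<le> (M + 1) * \<delta>" using \<delta>0 by (simp add: algebra_simps)
    finally show "1 / (M + 1) * norm v \<le> \<delta>" using M0 by (simp add: field_simps)
  qed
  have single: "\<exists>e>0. expander_eps (Alt (X p)) (S p \<union> inv ` S p) e" if pp: "prime p" "odd p" for p
  proof -
    have bij: "bij g" if "g \<in> S p" for g using S(1)[OF pp] that permutes_bij by (auto simp: Alt_def)
    obtain L :: nat where L: "\<And>v \<delta>. v \<in> mean_zero (Alt (X p)) \<Longrightarrow> (\<forall>g\<in>S p. norm (lreg g v - v) \<le> \<delta>) \<Longrightarrow> norm v \<le> real L * \<delta>"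
      using gen_perm_uniform_gap[OF perm_group_Alt[OF finX[OF pp]], of "S p"] gen[OF pp] bij by blast
    have "expander_eps (Alt (X p)) (S p \<union> inv ` S p) (1 / (real L + 1))"
    proof (rule expander_epsI[OF perm_group_Alt[OF finX[OF pp]] _ Q QA[OF pp]])
      fix v \<delta> assume v: "v \<in> mean_zero (Alt (X p))" and \<delta>: "\<And>g. g \<in> S p \<union> inv ` S p \<Longrightarrow> norm (lreg g v - v) \<le> \<delta>"
      have \<delta>0: "\<delta> \<ge> 0" using S(3)[of p] \<delta> norm_ge_zero order_trans by blast
      have "norm v \<le> real L * \<delta>" using \<delta> by (intro L[OF v]) auto
      also have "\<dots> \<le> (real L + 1) * \<delta>" using \<delta>0 by (simp add: algebra_simps)
      finally show "1 / (real L + 1) * norm v \<le> \<delta>" by (simp add: field_simps)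
    qed simp
    then show ?thesis by (intro exI[of _ "1 / (real L + 1)"]) simp
  qed
  let ?A = "{p. p < 128 * n ^ 2 \<and> prime p \<and> odd p}"
  obtain e where e: "e > 0" "\<forall>p\<in>?A. expander_eps (Alt (X p)) (S p \<union> inv ` S p) e"
    using finite_uniform_eps[of ?A "\<lambda>p. Alt (X p)" "\<lambda>p. S p \<union> inv ` S p"] single by auto
  let ?e = "min e (1 / (M + 1))"
  have "expander_eps (Alt (X p)) (S p \<union> inv ` S p) ?e" if pp: "prime p" "odd p" for p
  proof (cases "p < 128 * n ^ 2")
    case True
    then have "expander_eps (Alt (X p)) (S p \<union> inv ` S p) e" using e(2) pp by blast
    then show ?thesis by (rule expander_eps_mono) simp
  next
    case False
    then show ?thesis using large[OF pp] by (auto intro: expander_eps_mono)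
  qed
  moreover have "?e > 0" using e(1) M0 by simp
  ultimately show ?thesis using gen by blast
qed

section \<open>The two concrete coordinate systems\<close>

definition coords3 :: "nat \<times> nat \<times> nat \<Rightarrow> nat \<Rightarrow> int" where
  "coords3 = (\<lambda>(x, y, z) i. if i = 0 then int x else if i = 1 then int y else if i = 2 then int z else 0)"

lemma coords3_iff: "coords3 t \<in> nonzero_vectors (int p) 3 \<longleftrightarrow> t \<in> X3 p"
proof -
  obtain a b c where t: "t = (a, b, c)" by (cases t)
  have v: "coords3 t 0 = int a" "coords3 t 1 = int b" "coords3 t 2 = int c" by (simp_all add: t coords3_def)
  have le: "i = 0 \<or> i = 1 \<or> i = 2" if "i < 3" for i :: nat using that by linarith
  have "(\<forall>i<3. 0 \<le> coords3 t i \<and> coords3 t i < int p) \<longleftrightarrow> a < p \<and> b < p \<and> c < p"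
  proof -
    have "(\<forall>i<3. Q i) \<longleftrightarrow> Q 0 \<and> Q 1 \<and> Q 2" for Q :: "nat \<Rightarrow> bool"
    proof
      assume "Q 0 \<and> Q 1 \<and> Q 2"
      then show "\<forall>i<3. Q i" using le by blast
    qed simp
    then show ?thesis by (simp only: v of_nat_0_le_iff of_nat_less_iff simp_thms)
  qed
  moreover have z: "\<forall>i\<ge>3. coords3 t i = 0" by (simp add: t coords3_def)
  moreover have "coords3 t = (\<lambda>_. 0) \<longleftrightarrow> a = 0 \<and> b = 0 \<and> c = 0"
  proof
    assume "coords3 t = (\<lambda>_. 0)"
    then show "a = 0 \<and> b = 0 \<and> c = 0" using v by simp
  qed (auto simp: t coords3_def)
  ultimately show ?thesis by (auto simp: nonzero_vectors_def X3_def t)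
qed

lemma coords3: assumes p: "prime p" "odd p" shows "coords (int p) 3 (X3 p) coords3"
proof
  show "prime (int p)" "odd (int p)" "3 \<le> (3::nat)" using p by simp_all
  show "bij_betw coords3 (X3 p) (nonzero_vectors (int p) 3)"
  proof (rule bij_betw_byWitness[where f' = "\<lambda>f. (nat (f 0), nat (f 1), nat (f 2))"])
    show "\<forall>a\<in>X3 p. (\<lambda>f. (nat (f 0), nat (f 1), nat (f 2))) (coords3 a) = a" by (auto simp: coords3_def)
    show inv: "\<forall>f\<in>nonzero_vectors (int p) 3. coords3 (nat (f 0), nat (f 1), nat (f 2)) = f"
    proof
      fix f assume f: "f \<in> nonzero_vectors (int p) 3"
      show "coords3 (nat (f 0), nat (f 1), nat (f 2)) = f"
      proof
        fix i :: nat
        consider "i = 0" | "i = 1" | "i = 2" | "i \<ge> 3" by linarith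
        then show "coords3 (nat (f 0), nat (f 1), nat (f 2)) i = f i"
          using f by cases (auto simp: coords3_def nonzero_vectors_def)
      qed
    qed
    show "coords3 ` X3 p \<subseteq> nonzero_vectors (int p) 3" using coords3_iff by blast
    show "(\<lambda>f. (nat (f 0), nat (f 1), nat (f 2))) ` nonzero_vectors (int p) 3 \<subseteq> X3 p"
    proof (rule image_subsetI)
      fix f assume f: "f \<in> nonzero_vectors (int p) 3"
      then have "coords3 (nat (f 0), nat (f 1), nat (f 2)) = f" using inv by blast
      then show "(nat (f 0), nat (f 1), nat (f 2)) \<in> X3 p" using f unfolding coords3_iff[symmetric] by (simp only:)
    qed
  qed
qed

definition coords7 :: "nat list \<Rightarrow> nat \<Rightarrow> int" where
  "coords7 xs i = (if length xs = 7 \<and> i < 7 then int (xs ! i) else 0)"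

lemma coords7_iff: "coords7 xs \<in> nonzero_vectors (int p) 7 \<longleftrightarrow> xs \<in> X7 p"
proof (cases "length xs = 7")
  case True
  have "xs = replicate 7 0 \<longleftrightarrow> (\<forall>i<7. xs ! i = 0)"
    using True by (auto simp: list_eq_iff_nth_eq)
  then show ?thesis using True
    by (auto simp: coords7_def nonzero_vectors_def X7_def fun_eq_iff)
qed (auto simp: coords7_def nonzero_vectors_def X7_def)

lemma coords7: assumes p: "prime p" "odd p" shows "coords (int p) 7 (X7 p) coords7"
proof
  show "prime (int p)" "odd (int p)" "3 \<le> (7::nat)" using p by simp_all
  show "bij_betw coords7 (X7 p) (nonzero_vectors (int p) 7)"
  proof (rule bij_betw_byWitness[where f' = "\<lambda>f. map (\<lambda>i. nat (f i)) [0..<7]"])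
    show "\<forall>xs\<in>X7 p. map (\<lambda>i. nat (coords7 xs i)) [0..<7] = xs"
      by (auto simp: coords7_def X7_def list_eq_iff_nth_eq simp del: upt_rec_numeral)
    show inv: "\<forall>f\<in>nonzero_vectors (int p) 7. coords7 (map (\<lambda>i. nat (f i)) [0..<7]) = f"
      by (auto simp: coords7_def nonzero_vectors_def fun_eq_iff simp del: upt_rec_numeral)
    show "coords7 ` X7 p \<subseteq> nonzero_vectors (int p) 7" using coords7_iff by blast
    show "(\<lambda>f. map (\<lambda>i. nat (f i)) [0..<7]) ` nonzero_vectors (int p) 7 \<subseteq> X7 p"
    proof (rule image_subsetI)
      fix f assume f: "f \<in> nonzero_vectors (int p) 7"
      then have "coords7 (map (\<lambda>i. nat (f i)) [0..<7]) = f" using inv by blast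
      then show "map (\<lambda>i. nat (f i)) [0..<7] \<in> X7 p" using f unfolding coords7_iff[symmetric] by (simp only:)
    qed
  qed
qed

lemma X3_generators:
  assumes p: "prime p" "odd p"
  shows "sigma3 p = coords.rho 3 (X3 p) coords3"
    and "alpha3 p = coords.el (int p) (X3 p) coords3 0 (\<lambda>f. f 1)"
    and "beta3 p = coords.el (int p) (X3 p) coords3 0 (\<lambda>f. (f 1)\<^sup>2)"
proof -
  interpret coords "int p" 3 "X3 p" coords3 by (rule coords3[OF p])
  have cX: "coords3 x \<in> Y \<Longrightarrow> x \<in> X3 p" for x using coords3_iff by blast
  have a: "adm 0 (\<lambda>f. f 1)" "adm 0 (\<lambda>f. (f 1)\<^sup>2)" by (intro adm_coord adm_power; simp)+
  show "sigma3 p = rho" unfolding rho_def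
  proof (rule lift_eqI[OF cX rot_Y])
    show "coords3 (sigma3 p x) = rot 1 (coords3 x)" if "x \<in> X3 p" for x
    proof
      fix i :: nat
      consider "i = 0" | "i = 1" | "i = 2" | "i \<ge> 3" by linarith
      then show "coords3 (sigma3 p x) i = rot 1 (coords3 x) i"
        using that by cases (auto simp: sigma3_def coords3_def rot_def split: prod.splits)
    qed
  qed (auto simp: sigma3_def)
  show "alpha3 p = el 0 (\<lambda>f. f 1)" unfolding el_def
  proof (rule lift_eqI[OF cX ef_Y[OF a(1)]])
    show "coords3 (alpha3 p x) = ef 0 (\<lambda>f. f 1) (coords3 x)" if "x \<in> X3 p" for x
      using that by (auto simp: alpha3_def coords3_def ef_def fun_eq_iff zmod_int split: prod.splits)
  qed (auto simp: alpha3_def)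
  show "beta3 p = el 0 (\<lambda>f. (f 1)\<^sup>2)" unfolding el_def
  proof (rule lift_eqI[OF cX ef_Y[OF a(2)]])
    show "coords3 (beta3 p x) = ef 0 (\<lambda>f. (f 1)\<^sup>2) (coords3 x)" if "x \<in> X3 p" for x
      using that by (auto simp: beta3_def coords3_def ef_def fun_eq_iff zmod_int split: prod.splits)
  qed (auto simp: beta3_def)
qed

lemma X7_generators:
  assumes p: "prime p" "odd p"
  shows "rho7 p = coords.rho 7 (X7 p) coords7"
    and "gamma7 p = coords.el (int p) (X7 p) coords7 0 (\<lambda>f. f 1) \<circ> coords.el (int p) (X7 p) coords7 3 (\<lambda>f. (f 5)\<^sup>2)"
proof -
  interpret coords "int p" 7 "X7 p" coords7 by (rule coords7[OF p])
  have cX: "coords7 x \<in> Y \<Longrightarrow> x \<in> X7 p" for x using coords7_iff by blast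
  have a: "adm 0 (\<lambda>f. f 1)" "adm 3 (\<lambda>f. (f 5)\<^sup>2)"
    by (intro adm_coord adm_power; simp)+
  show "rho7 p = rho" unfolding rho_def
  proof (rule lift_eqI[OF cX rot_Y])
    show "coords7 (rho7 p xs) = rot 1 (coords7 xs)" if "xs \<in> X7 p" for xs
    proof
      fix i
      have "length xs = 7" using that by (simp add: X7_def)
      then show "coords7 (rho7 p xs) i = rot 1 (coords7 xs) i"
        using that by (cases "i < 7") (simp_all add: rho7_def coords7_def rot_def nth_rotate1)
    qed
  qed (auto simp: rho7_def)
  \<comment> \<open>Neither factor reads a coordinate that the other changes, so the simultaneous
    update in \<open>gamma7\<close> is the composition.\<close>
  have "el 0 (\<lambda>f. f 1) \<circ> el 3 (\<lambda>f. (f 5)\<^sup>2) = lift (ef 0 (\<lambda>f. f 1) \<circ> ef 3 (\<lambda>f. (f 5)\<^sup>2))"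
    unfolding el_def by (rule lift_comp) (rule ef_Y[OF a(2)])
  also have "\<dots> = gamma7 p"
  proof (rule sym, rule lift_eqI[OF cX])
    show "(ef 0 (\<lambda>f. f 1) \<circ> ef 3 (\<lambda>f. (f 5)\<^sup>2)) f \<in> Y" if "f \<in> Y" for f
      using ef_Y[OF a(1) ef_Y[OF a(2) that]] by simp
    show "coords7 (gamma7 p xs) = (ef 0 (\<lambda>f. f 1) \<circ> ef 3 (\<lambda>f. (f 5)\<^sup>2)) (coords7 xs)" if "xs \<in> X7 p" for xs
    proof
      fix i
      have "length xs = 7" using that by (simp add: X7_def)
      then show "coords7 (gamma7 p xs) i = (ef 0 (\<lambda>f. f 1) \<circ> ef 3 (\<lambda>f. (f 5)\<^sup>2)) (coords7 xs) i"
        using that by (simp add: gamma7_def coords7_def ef_def nth_list_update zmod_int)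
    qed
  qed (auto simp: gamma7_def)
  finally show "gamma7 p = el 0 (\<lambda>f. f 1) \<circ> el 3 (\<lambda>f. (f 5)\<^sup>2)" by simp
qed

text \<open>With \<open>\<gamma>\<^sub>0 = A\<^sub>0 B\<^sub>0\<close> the given permutation and \<open>\<gamma>\<^sub>1 = A\<^sub>1 B\<^sub>1\<close> its conjugate by the rotation, the quadratic factors
  commute with everything in sight, so that \<open>\<gamma>\<^sub>1\<inverse> \<gamma>\<^sub>0 \<gamma>\<^sub>1 \<gamma>\<^sub>0\<inverse> = A\<^sub>1\<inverse> A\<^sub>0 A\<^sub>1 A\<^sub>0\<inverse>\<close> is a transvection.\<close>

lemma X7_words:
  assumes pp: "prime p" "odd p" and l: "length_fun l" and \<delta>: "l (rho7 p) \<le> \<delta>" "l (gamma7 p) \<le> \<delta>" and i: "i < 7"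
  shows "l (coords.el (int p) (X7 p) coords7 i (\<lambda>f. f ((i + 2) mod 7))) \<le> 22 * \<delta>"
    and "l (coords.el (int p) (X7 p) coords7 i (\<lambda>f. (f ((i + 2) mod 7))\<^sup>2)) \<le> (4 ^ 7 * 22 + 15) * \<delta>"
proof -
  interpret coords "int p" 7 "X7 p" coords7 by (rule coords7[OF pp])
  note g = X7_generators[OF pp]
  define A0 where "A0 = el 0 (\<lambda>f. f 1)"
  define A1 where "A1 = el 1 (\<lambda>f. f 2)"
  define B0 where "B0 = el 3 (\<lambda>f. (f 5)\<^sup>2)"
  define B1 where "B1 = el 4 (\<lambda>f. (f 6)\<^sup>2)"
  have adm: "adm 0 (\<lambda>f. f 1)" "adm 1 (\<lambda>f. f 2)" "adm 3 (\<lambda>f. (f 5)\<^sup>2)" "adm 4 (\<lambda>f. (f 6)\<^sup>2)" "adm 0 (\<lambda>f. f 2)"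
    by (intro adm_coord adm_power; simp)+
  have bij: "bij A0" "bij A1" "bij B0" "bij B1"
    unfolding A0_def A1_def B0_def B1_def by (intro el_bij adm)+
  have comm: "A0 \<circ> B0 = B0 \<circ> A0" "A1 \<circ> B0 = B0 \<circ> A1" "A0 \<circ> B1 = B1 \<circ> A0" "B0 \<circ> B1 = B1 \<circ> B0"
    unfolding A0_def A1_def B0_def B1_def by (intro el_commute adm; simp)+
  define g0 where "g0 = A0 \<circ> B0"
  define g1 where "g1 = A1 \<circ> B1"
  have bg: "bij g0" "bij g1" unfolding g0_def g1_def by (intro bij_comp bij)+
  have rho: "l rho \<le> \<delta>" using \<delta>(1) g(1) by simp
  have g0: "l g0 \<le> \<delta>" using \<delta>(2) g(2) by (simp add: g0_def A0_def B0_def)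
  have "g1 = inv rho \<circ> (g0 \<circ> rho)"
  proof -
    have s: "succ 0 = 1" "succ 1 = 2" "succ 3 = 4" "succ 5 = 6" by (simp_all add: succ_def)
    have "A1 = inv rho \<circ> (A0 \<circ> rho)" "B1 = inv rho \<circ> (B0 \<circ> rho)"
      using rho_conj[of 0 1 "\<lambda>x. x"] rho_conj[of 3 5 "\<lambda>x. x\<^sup>2"]
      by (simp_all add: A0_def A1_def B0_def B1_def s[unfolded One_nat_def] One_nat_def)
    then show ?thesis
      using rho_bij by (simp add: g0_def g1_def fun_eq_iff bij_is_surj surj_f_inv_f)
  qed
  moreover have "l (inv rho \<circ> (g0 \<circ> rho)) \<le> l (inv rho) + l (g0 \<circ> rho)"
    by (intro l_comp[OF l] bij_imp_bij_inv rho_bij bij_comp bg)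
  moreover have "l (g0 \<circ> rho) \<le> l g0 + l rho" by (intro l_comp[OF l] rho_bij bg)
  ultimately have g1: "l g1 \<le> 3 * \<delta>" using rho g0 by (simp add: l_inv[OF l rho_bij])
  have "g0 \<circ> g1 = g1 \<circ> (el 0 (\<lambda>f. f 2) \<circ> g0)"
  proof -
    have "A0 \<circ> A1 = A1 \<circ> el 0 (\<lambda>f. ef 1 (\<lambda>f. f 2) f 1)"
      unfolding A0_def A1_def by (rule el_conj'[OF adm(1,2)]) auto
    also have "el 0 (\<lambda>f. ef 1 (\<lambda>f. f 2) f 1) = el 0 (\<lambda>f. f 2 + f 1)"
      by (rule el_cong) (simp add: ef_def add.commute)
    also have "\<dots> = el 0 (\<lambda>f. f 2) \<circ> A0" unfolding A0_def by (rule el_add[OF adm(5,1), symmetric])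
    finally have AA: "A0 \<circ> A1 = A1 \<circ> (el 0 (\<lambda>f. f 2) \<circ> A0)" .
    have c: "el 0 (\<lambda>f. f 2) \<circ> B1 = B1 \<circ> el 0 (\<lambda>f. f 2)"
      unfolding B1_def by (intro el_commute adm; simp)
    have "g0 \<circ> g1 = A0 \<circ> (B0 \<circ> A1) \<circ> B1" by (simp add: g0_def g1_def comp_assoc)
    also have "\<dots> = (A0 \<circ> A1) \<circ> (B0 \<circ> B1)" by (simp add: comm(2)[symmetric] comp_assoc)
    also have "\<dots> = A1 \<circ> el 0 (\<lambda>f. f 2) \<circ> (A0 \<circ> B1) \<circ> B0" unfolding AA comm(4) by (simp add: comp_assoc)
    also have "\<dots> = A1 \<circ> (el 0 (\<lambda>f. f 2) \<circ> B1) \<circ> (A0 \<circ> B0)" unfolding comm(3) by (simp add: comp_assoc)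
    also have "\<dots> = g1 \<circ> (el 0 (\<lambda>f. f 2) \<circ> g0)" unfolding c by (simp add: g0_def g1_def comp_assoc)
    finally show ?thesis .
  qed
  then have "inv g1 \<circ> (g0 \<circ> g1) \<circ> inv g0 = inv g1 \<circ> (g1 \<circ> (el 0 (\<lambda>f. f 2) \<circ> g0)) \<circ> inv g0" by (simp only:)
  also have "\<dots> = el 0 (\<lambda>f. f 2)"
    using bg by (simp add: fun_eq_iff bij_is_inj bij_is_surj surj_f_inv_f)
  finally have "l (el 0 (\<lambda>f. f 2)) = l (inv g1 \<circ> (g0 \<circ> g1) \<circ> inv g0)" by simp
  also have "\<dots> \<le> l (inv g1 \<circ> (g0 \<circ> g1)) + l (inv g0)"
    by (intro l_comp[OF l] bij_comp bij_imp_bij_inv bg)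
  also have "l (inv g1 \<circ> (g0 \<circ> g1)) \<le> l (inv g1) + l (g0 \<circ> g1)"
    by (intro l_comp[OF l] bij_comp bij_imp_bij_inv bg)
  also have "l (g0 \<circ> g1) \<le> l g0 + l g1" by (intro l_comp[OF l] bg)
  \<comment> \<open>The four factors cost 3 + 1 + 3 + 1.\<close>
  finally have e02: "l (el 0 (\<lambda>f. f 2)) \<le> 8 * \<delta>" using g0 g1 by (simp add: l_inv[OF l] bg)
  have tv: "l (el i (\<lambda>f. f ((i + 2) mod 7))) \<le> 22 * \<delta>" if "i < 7" for i
    using l_rotate[OF l, of 2 0 i "\<lambda>x. x" \<delta>] that rho e02 by (simp add: numeral_2_eq_2)
  then show "l (el i (\<lambda>f. f ((i + 2) mod 7))) \<le> 22 * \<delta>" using i .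
  have c72: "coprime 2 (7 :: nat)" by simp
  \<comment> \<open>Shifts by 2 are coprime to 7, so all transvections are now short, in particular
    \<open>A0\<close>; dividing it out of \<open>g0\<close> isolates the quadratic factor
    \<open>B0\<close>. Rotating \<open>B0\<close> adds 14 to the 1 for \<open>g0\<close>, hence the
    15.\<close>
  have "l A0 \<le> 4 ^ 7 * (22 * \<delta>)"
    unfolding A0_def by (rule l_transvections[OF l tv c72]) auto
  moreover have "B0 = inv A0 \<circ> g0" using bij by (simp add: g0_def fun_eq_iff bij_is_inj)
  moreover have "l (inv A0 \<circ> g0) \<le> l (inv A0) + l g0" by (intro l_comp[OF l] bij_imp_bij_inv bij bg)
  ultimately have "l B0 \<le> 4 ^ 7 * (22 * \<delta>) + \<delta>" using g0 by (simp add: l_inv[OF l] bij)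
  then show "l (el i (\<lambda>f. (f ((i + 2) mod 7))\<^sup>2)) \<le> (4 ^ 7 * 22 + 15) * \<delta>"
    using l_rotate[OF l, of 2 3 i "\<lambda>x. x\<^sup>2" \<delta>] i rho by (simp add: B0_def)
qed

theorem theorem1p5:
  shows "(\<exists>eps>0. \<forall>p::nat. prime p \<and> odd p \<longrightarrow>
            gen_perm {sigma3 p, alpha3 p, beta3 p} = Alt (X3 p) \<and>
            expander_eps (Alt (X3 p))
              {sigma3 p, inv (sigma3 p), alpha3 p, inv (alpha3 p), beta3 p, inv (beta3 p)} eps)
       \<and> (\<exists>eps>0. \<forall>p::nat. prime p \<and> odd p \<longrightarrow>
            gen_perm {rho7 p, gamma7 p} = Alt (X7 p) \<and>
            expander_eps (Alt (X7 p)) {rho7 p, inv (rho7 p), gamma7 p, inv (gamma7 p)} eps)"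
proof
  let ?S = "\<lambda>p. {sigma3 p, alpha3 p, beta3 p}"
  have "\<exists>eps>0. \<forall>p. prime p \<and> odd p \<longrightarrow>
    gen_perm (?S p) = Alt (X3 p) \<and> expander_eps (Alt (X3 p)) (?S p \<union> inv ` ?S p) eps"
  \<comment> \<open>C = 7 is 1 for the generator and 2 * 3 for at most three conjugations by the
    rotation.\<close>
  proof (rule uniform_expanders[OF coords3, where s = 1 and C = 7])
    fix p :: nat assume pp: "prime p" "odd p"
    interpret coords "int p" 3 "X3 p" coords3 by (rule coords3[OF pp])
    note g = X3_generators[OF pp]
    have a: "adm 0 (\<lambda>f. f 1)" "adm 0 (\<lambda>f. (f 1)\<^sup>2)" by (intro adm_coord adm_power; simp)+
    show "?S p \<subseteq> Alt (X3 p)"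
      unfolding g using rho_Alt el_Alt[OF a(1)] el_Alt[OF a(2)] by simp
    fix l \<delta> and i :: nat assume l: "length_fun l" and "\<And>s. s \<in> ?S p \<Longrightarrow> l s \<le> \<delta>" and i: "i < 3"
    then have \<delta>: "l rho \<le> \<delta>" "l (el 0 (\<lambda>f. f 1)) \<le> \<delta>" "l (el 0 (\<lambda>f. (f 1)\<^sup>2)) \<le> \<delta>"
      unfolding g by auto
    have ne: "(i + 1) mod 3 \<noteq> i" "(i + 1) mod 3 < 3" using succ[OF i] by (simp_all add: succ_def)
    have "l (el i (\<lambda>f. f ((i + 1) mod 3))) \<le> 7 * \<delta>"
      using l_rotate[OF l, of 1 0 i "\<lambda>x. x" \<delta>] i \<delta> by simp
    moreover have "l (el i (\<lambda>f. (f ((i + 1) mod 3))\<^sup>2)) \<le> 7 * \<delta>"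
      using l_rotate[OF l, of 1 0 i "\<lambda>x. x\<^sup>2" \<delta>] i \<delta> by simp
    ultimately show "l (el i (\<lambda>f. f ((i + 1) mod 3))) \<le> 7 * \<delta> \<and> (\<exists>j<3. j \<noteq> i \<and> l (el i (\<lambda>f. (f j)\<^sup>2)) \<le> 7 * \<delta>)"
      using ne by blast
  qed simp_all
  moreover have "?S p \<union> inv ` ?S p = {sigma3 p, inv (sigma3 p), alpha3 p, inv (alpha3 p), beta3 p, inv (beta3 p)}" for p
    by auto
  ultimately show "\<exists>eps>0. \<forall>p::nat. prime p \<and> odd p \<longrightarrow>
            gen_perm {sigma3 p, alpha3 p, beta3 p} = Alt (X3 p) \<and>
            expander_eps (Alt (X3 p))
              {sigma3 p, inv (sigma3 p), alpha3 p, inv (alpha3 p), beta3 p, inv (beta3 p)} eps"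
    by simp
next
  let ?S = "\<lambda>p. {rho7 p, gamma7 p}"
  have "\<exists>eps>0. \<forall>p. prime p \<and> odd p \<longrightarrow>
    gen_perm (?S p) = Alt (X7 p) \<and> expander_eps (Alt (X7 p)) (?S p \<union> inv ` ?S p) eps"
  \<comment> \<open>The shift is 2 because the commutator of \<open>gamma7\<close> with its rotate
    adds the third coordinate to the first; \<open>C\<close> is the larger of the two bounds in
    \<open>X7_words\<close>.\<close>
  proof (rule uniform_expanders[OF coords7, where s = 2 and C = "4 ^ 7 * 22 + 15"])
    fix p :: nat assume pp: "prime p" "odd p"
    interpret coords "int p" 7 "X7 p" coords7 by (rule coords7[OF pp])
    note g = X7_generators[OF pp]
    have a: "adm 0 (\<lambda>f. f 1)" "adm 3 (\<lambda>f. (f 5)\<^sup>2)"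
    by (intro adm_coord adm_power; simp)+
    show "?S p \<subseteq> Alt (X7 p)"
      unfolding g using rho_Alt perm_group_comp[OF perm_group_Alt[OF finite_X] el_Alt[OF a(1)] el_Alt[OF a(2)]] by simp
    fix l \<delta> and i :: nat assume l: "length_fun l" and "\<And>s. s \<in> ?S p \<Longrightarrow> l s \<le> \<delta>" and i: "i < 7"
    then have \<delta>: "l (rho7 p) \<le> \<delta>" "l (gamma7 p) \<le> \<delta>" by auto
    have "0 \<le> \<delta>" using length_fun_nonneg[OF l rho_bij] \<delta>(1) g(1) by simp
    then have "22 * \<delta> \<le> (4 ^ 7 * 22 + 15) * \<delta>" by (intro mult_right_mono) auto
    moreover have "(i + 2) mod 7 \<noteq> i" "(i + 2) mod 7 < 7" using i by presburger+
    ultimately show "l (el i (\<lambda>f. f ((i + 2) mod 7))) \<le> (4 ^ 7 * 22 + 15) * \<delta> \<and>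
        (\<exists>j<7. j \<noteq> i \<and> l (el i (\<lambda>f. (f j)\<^sup>2)) \<le> (4 ^ 7 * 22 + 15) * \<delta>)"
      using X7_words[OF pp l \<delta> i] by (meson order_trans)
  qed simp_all
  moreover have "?S p \<union> inv ` ?S p = {rho7 p, inv (rho7 p), gamma7 p, inv (gamma7 p)}" for p
    by auto
  ultimately show "\<exists>eps>0. \<forall>p::nat. prime p \<and> odd p \<longrightarrow>
            gen_perm {rho7 p, gamma7 p} = Alt (X7 p) \<and>
            expander_eps (Alt (X7 p)) {rho7 p, inv (rho7 p), gamma7 p, inv (gamma7 p)} eps"
    by simp
qed

end
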